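(* Let $\mathbb{F}$ be $\mathbb{R}$ or $\mathbb{C}$, let $X,Y$ be Banach spaces over $\mathbb{F}$, and let $k\ge1$ be an integer. Suppose that a set $\{x_\alpha\}\subset S_X$ of uniformly strongly exposed points is a norming subset of $\mathcal{P}({}^kX)$, i.e. $\|P\|=\sup_\alpha|P(x_\alpha)|$ for all $P\in\mathcal{P}({}^kX)$. Then the set of strongly norm attaining elements of $\mathcal{P}({}^kX:Y)$ is dense in $\mathcal{P}({}^kX:Y)$. In particular, the set of all $P\in\mathcal{P}({}^kX)$ at which the norm of $\mathcal{P}({}^kX)$ is Fréchet differentiable is a dense $G_\delta$ subset of $\mathcal{P}({}^kX)$.
   Context: $\mathcal{P}({}^kX:Y)$ is the Banach space of continuous $k$-homogeneous polynomials $P:X\to Y$ (maps of the form $P(x)=L(x,\dots,x)$ for a continuous $k$-linear $L$) with norm $\|P\|=\sup_{x\in B_X}\|P(x)\|$; $\mathcal{P}({}^kX)=\mathcal{P}({}^kX:\mathbb{F})$. A set $\{x_\alpha\}\subset S_X$ is uniformly strongly exposed if there are a function $\delta(\epsilon)>0$ ($\epsilon>0$) and functionals $f_\alpha\in S_{X^*}$ with $f_\alpha(x_\alpha)=1$ such that for every $\alpha$ and every $x$ with $\|x\|\le1$ and $\operatorname{Re}f_\alpha(x)\ge1-\delta(\epsilon)$ one has $\|x-x_\alpha\|\le\epsilon$. A nonzero $P$ strongly attains its norm at $x\in B_X$ if for every sequence $\{x_n\}\subset B_X$ with $\|P(x_n)\|\to\|P\|$ there are a scalar $\lambda$ with $|\lambda|=1$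 and a subsequence of $\{x_n\}$ converging to $\lambda x$; $P$ is strongly norm attaining if it strongly attains its norm at some point. The norm of a Banach space $Z$ is Fréchet differentiable at $z$ if $\lim_{\delta\to0}\sup_{\|y\|=1}\frac{\|z+\delta y\|+\|z-\delta y\|-2\|z\|}{\delta}=0$. *)

theory Defs
  imports "HOL-Analysis.Analysis"
begin

text \<open>The scalar field \<open>\<bbbF>\<close> is represented as a subfield F of the complex numbers,
  either the reals or all of the complex numbers.\<close>
definition scalar_field :: "complex set \<Rightarrow> bool" where
  "scalar_field F \<longleftrightarrow> F = \<real> \<or> F = UNIV"

text \<open>A (real) normed space 'a carries an \<open>F\<close>-vector space structure via the scalar
  multiplication \<open>s\<close> (only its values at scalars in F matter), compatible with the real
  structure and the norm.  Together with the class banach this makes 'a a Banach space over F.\<close>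
definition normed_space_over :: "complex set \<Rightarrow> (complex \<Rightarrow> 'a::real_normed_vector \<Rightarrow> 'a) \<Rightarrow> bool" where
  "normed_space_over F s \<longleftrightarrow>
     (\<forall>c\<in>F. \<forall>x y. s c (x + y) = s c x + s c y) \<and>
     (\<forall>c\<in>F. \<forall>d\<in>F. \<forall>x. s (c + d) x = s c x + s d x) \<and>
     (\<forall>c\<in>F. \<forall>d\<in>F. \<forall>x. s (c * d) x = s c (s d x)) \<and>
     (\<forall>x. s 1 x = x) \<and>
     (\<forall>r x. s (complex_of_real r) x = r *\<^sub>R x) \<and>
     (\<forall>c\<in>F. \<forall>x. norm (s c x) = norm c * norm x)"

definition F_linear :: "complex set \<Rightarrow> (complex \<Rightarrow> 'a \<Rightarrow> 'a) \<Rightarrow> (complex \<Rightarrow> 'b \<Rightarrow> 'b)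
    \<Rightarrow> ('a::ab_group_add \<Rightarrow> 'b::ab_group_add) \<Rightarrow> bool" where
  "F_linear F s t f \<longleftrightarrow> (\<forall>x y. f (x + y) = f x + f y) \<and> (\<forall>c\<in>F. \<forall>x. f (s c x) = t c (f x))"

text \<open>Continuous k-linear maps \<open>L : X^k \<rightarrow> Y\<close>; arguments are functions on \<open>{..<k}\<close>.\<close>
definition F_multilinear :: "complex set \<Rightarrow> (complex \<Rightarrow> 'a \<Rightarrow> 'a) \<Rightarrow> (complex \<Rightarrow> 'b \<Rightarrow> 'b)
    \<Rightarrow> nat \<Rightarrow> ((nat \<Rightarrow> 'a::real_normed_vector) \<Rightarrow> 'b::real_normed_vector) \<Rightarrow> bool" where
  "F_multilinear F s t k L \<longleftrightarrow>
     (\<forall>i<k. \<forall>xs. F_linear F s t (\<lambda>v. L (xs(i := v)))) \<and>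
     (\<forall>xs ys. (\<forall>i<k. xs i = ys i) \<longrightarrow> L xs = L ys) \<and>
     (\<exists>C. \<forall>xs. norm (L xs) \<le> C * (\<Prod>i<k. norm (xs i)))"

definition hpoly :: "complex set \<Rightarrow> (complex \<Rightarrow> 'a \<Rightarrow> 'a) \<Rightarrow> (complex \<Rightarrow> 'b \<Rightarrow> 'b)
    \<Rightarrow> nat \<Rightarrow> ('a::real_normed_vector \<Rightarrow> 'b::real_normed_vector) set" where
  "hpoly F s t k = {P. \<exists>L. F_multilinear F s t k L \<and> P = (\<lambda>x. L (\<lambda>_. x))}"

text \<open>\<open>\<P>(^k X) = \<P>(^k X : \<bbbF>)\<close>, with \<open>\<bbbF>\<close> = F viewed inside the complex numbers.\<close>
definition hpoly_scalar :: "complex set \<Rightarrow> (complex \<Rightarrow> 'a \<Rightarrow> 'a) \<Rightarrow> nat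
    \<Rightarrow> ('a::real_normed_vector \<Rightarrow> complex) set" where
  "hpoly_scalar F s k = {P \<in> hpoly F s (*) k. \<forall>x. P x \<in> F}"

definition pnorm :: "('a::real_normed_vector \<Rightarrow> 'b::real_normed_vector) \<Rightarrow> real" where
  "pnorm P = (SUP x\<in>cball 0 1. norm (P x))"

definition strongly_attains_at :: "complex set \<Rightarrow> (complex \<Rightarrow> 'a \<Rightarrow> 'a)
    \<Rightarrow> ('a::real_normed_vector \<Rightarrow> 'b::real_normed_vector) \<Rightarrow> 'a \<Rightarrow> bool" where
  "strongly_attains_at F s P x \<longleftrightarrow> P \<noteq> (\<lambda>_. 0) \<and> norm x \<le> 1 \<and>
     (\<forall>xn. (\<forall>n. norm (xn n) \<le> 1) \<longrightarrow> ((\<lambda>n. norm (P (xn n))) \<longlonglongrightarrow> pnorm P) \<longrightarrow>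
        (\<exists>c\<in>F. norm c = 1 \<and> (\<exists>r. strict_mono r \<and> ((\<lambda>n. xn (r n)) \<longlonglongrightarrow> s c x))))"

definition strongly_norm_attaining :: "complex set \<Rightarrow> (complex \<Rightarrow> 'a \<Rightarrow> 'a)
    \<Rightarrow> ('a::real_normed_vector \<Rightarrow> 'b::real_normed_vector) \<Rightarrow> bool" where
  "strongly_norm_attaining F s P \<longleftrightarrow> (\<exists>x. strongly_attains_at F s P x)"

definition unif_strongly_exposed :: "complex set \<Rightarrow> (complex \<Rightarrow> 'a \<Rightarrow> 'a)
    \<Rightarrow> 'a::real_normed_vector set \<Rightarrow> bool" where
  "unif_strongly_exposed F s A \<longleftrightarrow> A \<subseteq> sphere 0 1 \<and>
     (\<exists>\<delta>::real \<Rightarrow> real. (\<forall>e>0. \<delta> e > 0) \<and>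
       (\<exists>f::'a \<Rightarrow> 'a \<Rightarrow> complex. \<forall>a\<in>A.
          F_linear F s (*) (f a) \<and> bounded_linear (f a) \<and> (\<forall>x. f a x \<in> F) \<and>
          pnorm (f a) = 1 \<and> f a a = 1 \<and>
          (\<forall>e>0. \<forall>x. norm x \<le> 1 \<longrightarrow> Re (f a x) \<ge> 1 - \<delta> e \<longrightarrow> norm (x - a) \<le> e)))"

definition dense_in_pnorm :: "('a::real_normed_vector \<Rightarrow> 'b::real_normed_vector) set \<Rightarrow> ('a \<Rightarrow> 'b) set \<Rightarrow> bool" where
  "dense_in_pnorm D H \<longleftrightarrow> (\<forall>P\<in>H. \<forall>\<epsilon>>0. \<exists>Q\<in>D. pnorm (\<lambda>x. Q x - P x) < \<epsilon>)"

definition open_in_pnorm :: "('a::real_normed_vector \<Rightarrow> 'b::real_normed_vector) set \<Rightarrow> ('a \<Rightarrow> 'b) set \<Rightarrow> bool" where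
  "open_in_pnorm U H \<longleftrightarrow> U \<subseteq> H \<and> (\<forall>P\<in>U. \<exists>r>0. \<forall>Q\<in>H. pnorm (\<lambda>x. Q x - P x) < r \<longrightarrow> Q \<in> U)"

definition gdelta_in_pnorm :: "('a::real_normed_vector \<Rightarrow> 'b::real_normed_vector) set \<Rightarrow> ('a \<Rightarrow> 'b) set \<Rightarrow> bool" where
  "gdelta_in_pnorm D H \<longleftrightarrow> (\<exists>U::nat \<Rightarrow> ('a \<Rightarrow> 'b) set. (\<forall>n. open_in_pnorm (U n) H) \<and> D = (\<Inter>n. U n))"

definition frechet_diff_norm_at :: "('a::real_normed_vector \<Rightarrow> complex) set \<Rightarrow> ('a \<Rightarrow> complex) \<Rightarrow> bool" where
  "frechet_diff_norm_at H P \<longleftrightarrow>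
     ((\<lambda>\<delta>::real. SUP Q\<in>{Q\<in>H. pnorm Q = 1}.
         (pnorm (\<lambda>x. P x + of_real \<delta> * Q x) + pnorm (\<lambda>x. P x - of_real \<delta> * Q x) - 2 * pnorm P) / \<delta>)
       \<longlongrightarrow> 0) (at 0)"

end

theory Submission
  imports Defs "HOL-Computational_Algebra.Polynomial"
begin

text \<open>
  The proof follows the Lindenstrauss--Bourgain perturbation method.  Given \<open>P \<noteq> 0\<close>, we add
  rank-one bumps \<open>\<gamma>(n) f(a n)(x)^k P n (a n)\<close>, where \<open>a n \<in> A\<close> is nearly maximal for the current
  polynomial \<open>P n\<close>, \<open>f (a n)\<close> strongly exposes \<open>a n\<close>, and \<open>\<gamma>(n) = g0 2^-(n*n)\<close> decays super-geometrically.
  The limit stays close to \<open>P\<close>, and each near-maximal point of the limit is close to a rotation of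
  \<open>a N\<close> for large \<open>N\<close>; an abstract strong attainment criterion turns this into strong attainment.
  Hahn--Banach transfers the norming hypothesis from scalar to vector-valued polynomials.  For scalar
  polynomials, strong attainment at \<open>x0\<close> makes the first-order terms of \<open>\<parallel>Q +- d R\<parallel>\<close> cancel
  uniformly (using a Lipschitz bound obtained by Lagrange interpolation along lines), which is
  Frechet differentiability; the set of such points is a \<open>G\<delta>\<close> by a monotonicity argument.
\<close>


lemma sf_cases: "scalar_field F \<Longrightarrow> (F = \<real> \<Longrightarrow> P) \<Longrightarrow> (F = UNIV \<Longrightarrow> P) \<Longrightarrow> P"
  unfolding scalar_field_def by blast

lemma sf_of_real: "scalar_field F \<Longrightarrow> complex_of_real r \<in> F"
  by (erule sf_cases) auto

lemma sf_0: "scalar_field F \<Longrightarrow> 0 \<in> F"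
  using sf_of_real[of F 0] by simp

lemma sf_1: "scalar_field F \<Longrightarrow> 1 \<in> F"
  using sf_of_real[of F 1] by simp

lemma sf_add: "scalar_field F \<Longrightarrow> x \<in> F \<Longrightarrow> y \<in> F \<Longrightarrow> x + y \<in> F"
  by (erule sf_cases) auto

lemma sf_mult: "scalar_field F \<Longrightarrow> x \<in> F \<Longrightarrow> y \<in> F \<Longrightarrow> x * y \<in> F"
  by (erule sf_cases) auto

lemma sf_uminus: "scalar_field F \<Longrightarrow> x \<in> F \<Longrightarrow> - x \<in> F"
  by (erule sf_cases) auto

lemma sf_diff: "scalar_field F \<Longrightarrow> x \<in> F \<Longrightarrow> y \<in> F \<Longrightarrow> x - y \<in> F"
  by (erule sf_cases) auto

lemma sf_cnj: "scalar_field F \<Longrightarrow> x \<in> F \<Longrightarrow> cnj x \<in> F"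
  by (erule sf_cases) (auto simp: Reals_cnj_iff)

lemma sf_divide: "scalar_field F \<Longrightarrow> x \<in> F \<Longrightarrow> y \<in> F \<Longrightarrow> x / y \<in> F"
  by (erule sf_cases) auto

lemma sf_power: "scalar_field F \<Longrightarrow> x \<in> F \<Longrightarrow> x ^ n \<in> F"
  by (induction n) (auto simp: sf_1 sf_mult)

lemma sf_prod: "scalar_field F \<Longrightarrow> (\<And>i. i \<in> I \<Longrightarrow> g i \<in> F) \<Longrightarrow> prod g I \<in> F"
  by (induction I rule: infinite_finite_induct) (auto simp: sf_1 sf_mult)

lemma sf_closed: "scalar_field F \<Longrightarrow> closed F"
  by (erule sf_cases) (auto simp: closed_complex_Reals)

text \<open>The unimodular scalars form a compact set; this is what lets us extract convergent
  rotation factors in the strong attainment argument.\<close>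
lemma sf_sphere_compact: "scalar_field F \<Longrightarrow> compact {c \<in> F. norm c = 1}"
proof -
  assume sf: "scalar_field F"
  have "{c \<in> F. norm c = 1} = F \<inter> sphere 0 1" by auto
  moreover have "compact (F \<inter> sphere 0 1)"
    using sf_closed[OF sf] by (intro closed_Int_compact) auto
  ultimately show ?thesis by simp
qed

context
  fixes F :: "complex set" and s :: "complex \<Rightarrow> 'a::real_normed_vector \<Rightarrow> 'a"
  assumes sf: "scalar_field F" and ns: "normed_space_over F s"
begin

lemma ns_add: "c \<in> F \<Longrightarrow> s c (x + y) = s c x + s c y"
  using ns unfolding normed_space_over_def by blast

lemma ns_add_scalar: "c \<in> F \<Longrightarrow> d \<in> F \<Longrightarrow> s (c + d) x = s c x + s d x"
  using ns unfolding normed_space_over_def by blast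

lemma ns_mult: "c \<in> F \<Longrightarrow> d \<in> F \<Longrightarrow> s (c * d) x = s c (s d x)"
  using ns unfolding normed_space_over_def by blast

lemma ns_one: "s 1 x = x"
  using ns unfolding normed_space_over_def by blast

lemma ns_of_real: "s (complex_of_real r) x = r *\<^sub>R x"
  using ns unfolding normed_space_over_def by blast

lemma ns_norm: "c \<in> F \<Longrightarrow> norm (s c x) = norm c * norm x"
  using ns unfolding normed_space_over_def by blast

lemma ns_zero_scalar: "s 0 x = 0"
  using ns_of_real[of 0] by simp

lemma ns_zero_vec: "c \<in> F \<Longrightarrow> s c 0 = 0"
  using ns_add[of c 0 0] by simp

lemma ns_uminus_scalar: "c \<in> F \<Longrightarrow> s (- c) x = - s c x"
  using ns_add_scalar[of c "-c" x] sf_uminus[OF sf, of c] ns_zero_scalar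
  by (simp add: eq_neg_iff_add_eq_0 add.commute)

lemma ns_diff_scalar: "c \<in> F \<Longrightarrow> d \<in> F \<Longrightarrow> s (c - d) x = s c x - s d x"
  using ns_add_scalar[of c "-d" x] ns_uminus_scalar[of d x] sf_uminus[OF sf, of d] by simp

lemma ns_uminus_vec: "c \<in> F \<Longrightarrow> s c (- x) = - s c x"
  using ns_add[of c x "-x"] ns_zero_vec[of c] by (simp add: eq_neg_iff_add_eq_0 add.commute)

lemma ns_diff_vec: "c \<in> F \<Longrightarrow> s c (x - y) = s c x - s c y"
  using ns_add[of c x "-y"] ns_uminus_vec[of c y] by simp

lemma ns_scaleR_comm: "c \<in> F \<Longrightarrow> s c (r *\<^sub>R x) = r *\<^sub>R s c x"
proof -
  assume c: "c \<in> F"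
  have "s c (r *\<^sub>R x) = s c (s (complex_of_real r) x)" by (simp add: ns_of_real)
  also have "\<dots> = s (c * complex_of_real r) x" using c sf_of_real[OF sf] by (simp add: ns_mult)
  also have "\<dots> = s (complex_of_real r * c) x" by (simp add: mult.commute)
  also have "\<dots> = r *\<^sub>R s c x" using c sf_of_real[OF sf] by (simp add: ns_mult ns_of_real)
  finally show ?thesis .
qed

text \<open>Each scalar multiplication is a bounded real-linear map, hence commutes with series.\<close>
lemma ns_bounded_linear: "c \<in> F \<Longrightarrow> bounded_linear (s c)"
  apply (rule bounded_linear_intro[where K="norm c"])
  by (auto simp: ns_add ns_scaleR_comm ns_norm)

lemma ns_cancel: "c \<in> F \<Longrightarrow> norm c = 1 \<Longrightarrow> s (cnj c) (s c x) = x"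
proof -
  assume c: "c \<in> F" "norm c = 1"
  have "cnj c * c = 1" using c(2) by (metis complex_norm_square mult.commute norm_one of_real_1 power_one)
  then show ?thesis using c sf_cnj[OF sf] ns_mult[of "cnj c" c x] by (simp add: ns_one)
qed

lemma ns_dist_scalar: "c \<in> F \<Longrightarrow> d \<in> F \<Longrightarrow> norm (s c x - s d x) = norm (c - d) * norm x"
  using ns_diff_scalar[of c d x] ns_norm[of "c - d" x] sf_diff[OF sf, of c d] by simp

end

text \<open>The scalars themselves form a normed space over F; this covers scalar-valued polynomials.\<close>
lemma ns_complex: "scalar_field F \<Longrightarrow> normed_space_over F ((*) :: complex \<Rightarrow> complex \<Rightarrow> complex)"
  unfolding normed_space_over_def by (auto simp: algebra_simps norm_mult scaleR_conv_of_real)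

text \<open>\<open>pnorm\<close> is a genuine seminorm only on maps bounded on the unit ball.\<close>

definition pbounded :: "('a::real_normed_vector \<Rightarrow> 'b::real_normed_vector) \<Rightarrow> bool" where
  "pbounded P \<longleftrightarrow> (\<exists>B. \<forall>x\<in>cball 0 1. norm (P x) \<le> B)"

lemma pbounded_bdd: "pbounded P \<Longrightarrow> bdd_above ((\<lambda>x. norm (P x)) ` cball 0 1)"
  unfolding pbounded_def bdd_above_def by auto

lemma pnorm_le: "(\<And>x. norm x \<le> 1 \<Longrightarrow> norm (P x) \<le> B) \<Longrightarrow> pnorm P \<le> B"
  unfolding pnorm_def by (rule cSUP_least) auto

lemma pnorm_ge: "pbounded P \<Longrightarrow> norm x \<le> 1 \<Longrightarrow> norm (P x) \<le> pnorm P"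
  unfolding pnorm_def by (rule cSUP_upper) (auto simp: pbounded_bdd)

lemma pnorm_nonneg: "pbounded P \<Longrightarrow> 0 \<le> pnorm P"
proof -
  assume "pbounded P"
  then have "norm (P 0) \<le> pnorm P" by (intro pnorm_ge) auto
  then show ?thesis using norm_ge_zero order_trans by blast
qed

lemma pboundedI: "(\<And>x. norm x \<le> 1 \<Longrightarrow> norm (P x) \<le> B) \<Longrightarrow> pbounded P"
  unfolding pbounded_def by force

lemma pbounded_add: "pbounded P \<Longrightarrow> pbounded Q \<Longrightarrow> pbounded (\<lambda>x. P x + Q x)"
  by (rule pboundedI[where B="pnorm P + pnorm Q"])
     (meson add_mono norm_triangle_le pnorm_ge)

lemma pbounded_diff: "pbounded P \<Longrightarrow> pbounded Q \<Longrightarrow> pbounded (\<lambda>x. P x - Q x)"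
  by (rule pboundedI[where B="pnorm P + pnorm Q"])
     (meson add_mono norm_triangle_ineq4 order_trans pnorm_ge)

lemma pnorm_add: "pbounded P \<Longrightarrow> pbounded Q \<Longrightarrow> pnorm (\<lambda>x. P x + Q x) \<le> pnorm P + pnorm Q"
  by (rule pnorm_le) (meson add_mono norm_triangle_le pnorm_ge)

lemma pnorm_diff: "pbounded P \<Longrightarrow> pbounded Q \<Longrightarrow> pnorm (\<lambda>x. P x - Q x) \<le> pnorm P + pnorm Q"
  by (rule pnorm_le) (meson add_mono norm_triangle_ineq4 order_trans pnorm_ge)

lemma pnorm_sub_le: "pbounded P \<Longrightarrow> pbounded Q \<Longrightarrow> pnorm P \<le> pnorm Q + pnorm (\<lambda>x. P x - Q x)"
proof -
  assume a: "pbounded P" "pbounded Q"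
  have "pnorm (\<lambda>x. Q x + (P x - Q x)) \<le> pnorm Q + pnorm (\<lambda>x. P x - Q x)"
    using a by (intro pnorm_add pbounded_diff)
  then show ?thesis by simp
qed

lemma pnorm_scale: "pbounded P \<Longrightarrow> pnorm (\<lambda>x. c * (P x :: complex)) = norm c * pnorm P"
proof (cases "c = 0")
  case True
  then show ?thesis unfolding pnorm_def by simp
next
  case False
  assume P: "pbounded P"
  have "pnorm (\<lambda>x. c * P x) \<le> norm c * pnorm P"
    by (rule pnorm_le) (simp add: norm_mult P pnorm_ge mult_left_mono)
  moreover have "pnorm P \<le> pnorm (\<lambda>x. c * P x) / norm c"
  proof (rule pnorm_le)
    fix x :: 'a assume x: "norm x \<le> 1"
    have "pbounded (\<lambda>x. c * P x)"
      by (rule pboundedI[where B="norm c * pnorm P"]) (simp add: norm_mult P pnorm_ge mult_left_mono)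
    then have "norm c * norm (P x) \<le> pnorm (\<lambda>x. c * P x)"
      using pnorm_ge[OF _ x] by (metis norm_mult)
    then show "norm (P x) \<le> pnorm (\<lambda>x. c * P x) / norm c"
      using False by (simp add: field_simps)
  qed
  ultimately show ?thesis using False by (simp add: field_simps)
qed

lemma pnorm_zero_fun: "pnorm (\<lambda>x::'a::real_normed_vector. 0::'b::real_normed_vector) = 0"
  unfolding pnorm_def by simp




lemma F_multilinearI:
  "(\<And>i xs. i < k \<Longrightarrow> F_linear F s t (\<lambda>v. L (xs(i := v)))) \<Longrightarrow>
   (\<And>xs ys. (\<And>i. i < k \<Longrightarrow> xs i = ys i) \<Longrightarrow> L xs = L ys) \<Longrightarrow>
   (\<And>xs. norm (L xs) \<le> C * (\<Prod>i<k. norm (xs i))) \<Longrightarrow> F_multilinear F s t k L"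
  unfolding F_multilinear_def by blast


context
  fixes F :: "complex set" and s :: "complex \<Rightarrow> 'a::real_normed_vector \<Rightarrow> 'a"
    and t :: "complex \<Rightarrow> 'b::real_normed_vector \<Rightarrow> 'b" and k :: nat
  assumes sf: "scalar_field F" and nsX: "normed_space_over F s" and nsY: "normed_space_over F t"
begin

lemma ml_add: "F_multilinear F s t k L \<Longrightarrow> i < k \<Longrightarrow> L (xs(i := u + v)) = L (xs(i := u)) + L (xs(i := v))"
  unfolding F_multilinear_def F_linear_def by blast

lemma ml_smult: "F_multilinear F s t k L \<Longrightarrow> i < k \<Longrightarrow> c \<in> F \<Longrightarrow> L (xs(i := s c u)) = t c (L (xs(i := u)))"
  unfolding F_multilinear_def F_linear_def by blast

lemma ml_cong: "F_multilinear F s t k L \<Longrightarrow> (\<And>i. i < k \<Longrightarrow> xs i = ys i) \<Longrightarrow> L xs = L ys"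
  unfolding F_multilinear_def by blast

lemma ml_bound: "F_multilinear F s t k L \<Longrightarrow> \<exists>C\<ge>0. \<forall>xs. norm (L xs) \<le> C * (\<Prod>i<k. norm (xs i))"
proof -
  assume "F_multilinear F s t k L"
  then obtain C where C: "\<forall>xs. norm (L xs) \<le> C * (\<Prod>i<k. norm (xs i))"
    unfolding F_multilinear_def by blast
  have "norm (L xs) \<le> max C 0 * (\<Prod>i<k. norm (xs i))" for xs
    by (rule order_trans[OF C[rule_format]]) (intro mult_right_mono prod_nonneg; simp)
  then show ?thesis by (intro exI[of _ "max C 0"]) auto
qed

lemma ml_hom_slots:
  assumes L: "F_multilinear F s t k L" and c: "c \<in> F"
  shows "m \<le> k \<Longrightarrow> L (\<lambda>i. if i < m then s c (xs i) else xs i) = t (c ^ m) (L xs)"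
proof (induction m)
  case 0
  then show ?case by (simp add: ns_one[OF sf nsY])
next
  case (Suc m)
  define ys where "ys = (\<lambda>i. if i < m then s c (xs i) else xs i)"
  have "(\<lambda>i. if i < Suc m then s c (xs i) else xs i) = ys(m := s c (xs m))"
    by (auto simp: ys_def)
  moreover have "ys(m := xs m) = ys" by (auto simp: ys_def)
  ultimately have "L (\<lambda>i. if i < Suc m then s c (xs i) else xs i) = t c (L ys)"
    using ml_smult[OF L, of m c ys "xs m"] Suc.prems c by simp
  also have "\<dots> = t c (t (c ^ m) (L xs))" using Suc by (simp add: ys_def)
  also have "\<dots> = t (c ^ Suc m) (L xs)"
    using ns_mult[OF sf nsY, of c "c^m"] c sf_power[OF sf] by simp
  finally show ?case .
qed

lemma hpolyE: "P \<in> hpoly F s t k \<Longrightarrow> (\<And>L. F_multilinear F s t k L \<Longrightarrow> P = (\<lambda>x. L (\<lambda>_. x)) \<Longrightarrow> R) \<Longrightarrow> R"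
  unfolding hpoly_def by blast

lemma hpolyI: "F_multilinear F s t k L \<Longrightarrow> (\<And>x. P x = L (\<lambda>_. x)) \<Longrightarrow> P \<in> hpoly F s t k"
  unfolding hpoly_def by auto

lemma hpoly_hom: "P \<in> hpoly F s t k \<Longrightarrow> c \<in> F \<Longrightarrow> P (s c x) = t (c ^ k) (P x)"
proof -
  assume P: "P \<in> hpoly F s t k" and c: "c \<in> F"
  from P obtain L where L: "F_multilinear F s t k L" and PL: "P = (\<lambda>x. L (\<lambda>_. x))" by (rule hpolyE)
  have "P (s c x) = L (\<lambda>i. if i < k then s c x else x)"
    unfolding PL by (rule ml_cong[OF L]) auto
  also have "\<dots> = t (c ^ k) (P x)" using ml_hom_slots[OF L c, of k "\<lambda>_. x"] by (simp add: PL)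
  finally show ?thesis .
qed

lemma hpoly_homR: "P \<in> hpoly F s t k \<Longrightarrow> P (r *\<^sub>R x) = r ^ k *\<^sub>R P x"
  using hpoly_hom[of P "complex_of_real r" x] sf_of_real[OF sf]
  by (simp add: ns_of_real[OF sf nsX] flip: ns_of_real[OF sf nsY] of_real_power)

lemma hpoly_zero: "P \<in> hpoly F s t k \<Longrightarrow> k \<ge> 1 \<Longrightarrow> P 0 = 0"
  using hpoly_homR[of P 0 0] by (simp add: power_0_left)

lemma hpoly_bound: "P \<in> hpoly F s t k \<Longrightarrow> \<exists>C\<ge>0. \<forall>x. norm (P x) \<le> C * norm x ^ k"
proof -
  assume P: "P \<in> hpoly F s t k"
  then obtain L where L: "F_multilinear F s t k L" and PL: "P = (\<lambda>x. L (\<lambda>_. x))" by (rule hpolyE)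
  obtain C where C: "C \<ge> 0" "\<forall>xs. norm (L xs) \<le> C * (\<Prod>i<k. norm (xs i))" using ml_bound[OF L] by blast
  have "norm (P x) \<le> C * norm x ^ k" for x
    using C(2)[rule_format, of "\<lambda>_. x"] by (simp add: PL)
  then show ?thesis using C(1) by blast
qed

lemma hpoly_pbounded: "P \<in> hpoly F s t k \<Longrightarrow> pbounded P"
proof -
  assume P: "P \<in> hpoly F s t k"
  obtain C where C: "C \<ge> 0" "\<forall>x. norm (P x) \<le> C * norm x ^ k" using hpoly_bound[OF P] by blast
  show ?thesis
  proof (rule pboundedI[where B=C])
    fix x :: 'a assume "norm x \<le> 1"
    then have "norm x ^ k \<le> 1" by (simp add: power_le_one)
    then show "norm (P x) \<le> C" using C by (meson mult_left_le order_trans)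
  qed
qed

lemma hpoly_pnorm_bound:
  assumes P: "P \<in> hpoly F s t k" and k: "k \<ge> 1"
  shows "norm (P x) \<le> pnorm P * norm x ^ k"
proof (cases "x = 0")
  case True
  then show ?thesis using hpoly_zero[OF P k] k by (simp add: power_0_left)
next
  case False
  define u where "u = (1 / norm x) *\<^sub>R x"
  have u: "norm u \<le> 1" using False by (simp add: u_def)
  have xeq: "x = norm x *\<^sub>R u" using False by (simp add: u_def)
  have "P x = P (norm x *\<^sub>R u)" using xeq by (rule arg_cong)
  also have "\<dots> = norm x ^ k *\<^sub>R P u" by (rule hpoly_homR[OF P])
  finally have "P x = norm x ^ k *\<^sub>R P u" .
  then have "norm (P x) = norm x ^ k * norm (P u)" by simp
  also have "\<dots> \<le> norm x ^ k * pnorm P"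
    by (intro mult_left_mono pnorm_ge hpoly_pbounded[OF P] u) simp
  finally show ?thesis by (simp add: mult.commute)
qed

lemma hpoly_pnorm_nonneg: "P \<in> hpoly F s t k \<Longrightarrow> 0 \<le> pnorm P"
  by (intro pnorm_nonneg hpoly_pbounded)

lemma hpoly_pnorm_zero: "P \<in> hpoly F s t k \<Longrightarrow> k \<ge> 1 \<Longrightarrow> pnorm P = 0 \<Longrightarrow> P x = 0"
  using hpoly_pnorm_bound[of P x] by simp

lemma ml_add_fun: "F_multilinear F s t k L1 \<Longrightarrow> F_multilinear F s t k L2 \<Longrightarrow>
   F_multilinear F s t k (\<lambda>xs. L1 xs + L2 xs)"
proof -
  assume L1: "F_multilinear F s t k L1" and L2: "F_multilinear F s t k L2"
  obtain C1 where C1: "\<forall>xs. norm (L1 xs) \<le> C1 * (\<Prod>i<k. norm (xs i))" using ml_bound[OF L1] by blast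
  obtain C2 where C2: "\<forall>xs. norm (L2 xs) \<le> C2 * (\<Prod>i<k. norm (xs i))" using ml_bound[OF L2] by blast
  show ?thesis
  proof (rule F_multilinearI[where C="C1 + C2"])
  fix xs :: "nat \<Rightarrow> 'a"
  have "norm (L1 xs + L2 xs) \<le> norm (L1 xs) + norm (L2 xs)" by (rule norm_triangle_ineq)
  also have "\<dots> \<le> C1 * (\<Prod>i<k. norm (xs i)) + C2 * (\<Prod>i<k. norm (xs i))"
    using C1 C2 by (intro add_mono) auto
  also have "\<dots> = (C1 + C2) * (\<Prod>i<k. norm (xs i))" by (rule distrib_right[symmetric])
  finally show "norm (L1 xs + L2 xs) \<le> (C1 + C2) * (\<Prod>i<k. norm (xs i))" .
  next
  show "F_linear F s t (\<lambda>v. L1 (xs(i := v)) + L2 (xs(i := v)))" if "i < k" for i xs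
    unfolding F_linear_def
  proof (intro conjI allI ballI)
    fix x y
    show "L1 (xs(i := x + y)) + L2 (xs(i := x + y)) = L1 (xs(i := x)) + L2 (xs(i := x)) + (L1 (xs(i := y)) + L2 (xs(i := y)))"
      unfolding ml_add[OF L1 that] ml_add[OF L2 that] by (simp only: add_ac)
  next
    fix c x assume c: "c \<in> F"
    show "L1 (xs(i := s c x)) + L2 (xs(i := s c x)) = t c (L1 (xs(i := x)) + L2 (xs(i := x)))"
      unfolding ml_smult[OF L1 that c] ml_smult[OF L2 that c] ns_add[OF sf nsY c] ..
  qed
  next
  fix xs ys :: "nat \<Rightarrow> 'a" assume "\<And>i. i < k \<Longrightarrow> xs i = ys i"
  then show "L1 xs + L2 xs = L1 ys + L2 ys"
    using ml_cong[OF L1] ml_cong[OF L2] by metis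
  qed
qed

lemma hpoly_add: "P \<in> hpoly F s t k \<Longrightarrow> Q \<in> hpoly F s t k \<Longrightarrow> (\<lambda>x. P x + Q x) \<in> hpoly F s t k"
proof -
  assume P: "P \<in> hpoly F s t k" and Q: "Q \<in> hpoly F s t k"
  obtain L1 where L1: "F_multilinear F s t k L1" "P = (\<lambda>x. L1 (\<lambda>_. x))" using P by (rule hpolyE)
  obtain L2 where L2: "F_multilinear F s t k L2" "Q = (\<lambda>x. L2 (\<lambda>_. x))" using Q by (rule hpolyE)
  show ?thesis by (rule hpolyI[OF ml_add_fun[OF L1(1) L2(1)]]) (simp add: L1(2) L2(2))
qed

end

lemma ml_compose:
  fixes F :: "complex set" and s :: "complex \<Rightarrow> 'a::real_normed_vector \<Rightarrow> 'a"
    and t :: "complex \<Rightarrow> 'b::real_normed_vector \<Rightarrow> 'b"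
    and t' :: "complex \<Rightarrow> 'c::real_normed_vector \<Rightarrow> 'c"
  assumes L: "F_multilinear F s t k L" and psi: "F_linear F t t' \<psi>"
    and B: "\<And>y. norm (\<psi> y) \<le> B * norm y"
  shows "F_multilinear F s t' k (\<lambda>xs. \<psi> (L xs))"
proof -
  obtain C where C: "\<forall>xs. norm (L xs) \<le> C * (\<Prod>i<k. norm (xs i))"
    using L unfolding F_multilinear_def by blast
  have B0: "B \<ge> 0 \<or> (\<forall>y. \<psi> y = 0)"
  proof (cases "B \<ge> 0")
    case False
    have "\<psi> y = 0" for y
    proof -
      have "B * norm y \<le> 0" using False by (simp add: mult_nonpos_nonneg)
      then have "norm (\<psi> y) \<le> 0" using B[of y] by linarith
      then show ?thesis by simp
    qed
    then show ?thesis by blast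
  qed simp
  obtain D where D: "\<And>xs. norm (\<psi> (L xs)) \<le> D * (\<Prod>i<k. norm (xs i))"
  proof (cases "B \<ge> 0")
    case True
    have "norm (\<psi> (L xs)) \<le> (B * C) * (\<Prod>i<k. norm (xs i))" for xs
    proof -
      have "norm (\<psi> (L xs)) \<le> B * norm (L xs)" by (rule B)
      also have "\<dots> \<le> B * (C * (\<Prod>i<k. norm (xs i)))" using True C by (intro mult_left_mono) auto
      finally show ?thesis by (simp add: mult.assoc)
    qed
    then show ?thesis using that by blast
  next
    case False
    then show ?thesis using B0 that[of 0] by auto
  qed
  show ?thesis
  proof (rule F_multilinearI[OF _ _ D])
    fix i xs assume that: "i < (k::nat)"
    have Li: "F_linear F s t (\<lambda>v. L (xs(i := v)))" using L that unfolding F_multilinear_def by blast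
    have a1: "L (xs(i := x + y)) = L (xs(i := x)) + L (xs(i := y))" for x y
      using Li unfolding F_linear_def by blast
    have a2: "c \<in> F \<Longrightarrow> L (xs(i := s c x)) = t c (L (xs(i := x)))" for c x
      using Li unfolding F_linear_def by blast
    have p1: "\<psi> (u + v) = \<psi> u + \<psi> v" for u v using psi unfolding F_linear_def by blast
    have p2: "c \<in> F \<Longrightarrow> \<psi> (t c u) = t' c (\<psi> u)" for c u using psi unfolding F_linear_def by blast
    show "F_linear F s t' (\<lambda>v. \<psi> (L (xs(i := v))))" unfolding F_linear_def by (simp add: a1 a2 p1 p2)
  next
    fix xs ys :: "nat \<Rightarrow> 'a" assume "\<And>i. i < k \<Longrightarrow> xs i = ys i"
    then have "L xs = L ys" using L unfolding F_multilinear_def by blast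
    then show "\<psi> (L xs) = \<psi> (L ys)" by simp
  qed
qed

lemma hpoly_compose:
  fixes F :: "complex set" and s :: "complex \<Rightarrow> 'a::real_normed_vector \<Rightarrow> 'a"
    and t :: "complex \<Rightarrow> 'b::real_normed_vector \<Rightarrow> 'b"
    and t' :: "complex \<Rightarrow> 'c::real_normed_vector \<Rightarrow> 'c"
  assumes P: "P \<in> hpoly F s t k" and psi: "F_linear F t t' \<psi>"
    and B: "\<And>y. norm (\<psi> y) \<le> B * norm y"
  shows "(\<lambda>x. \<psi> (P x)) \<in> hpoly F s t' k"
proof -
  obtain L where L: "F_multilinear F s t k L" "P = (\<lambda>x. L (\<lambda>_. x))" using P unfolding hpoly_def by blast
  show ?thesis unfolding hpoly_def using ml_compose[OF L(1) psi B] L(2) by blast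
qed

lemma F_linear_cmult: "F_linear F (*) (*) (\<lambda>y. c * (y::complex))"
  unfolding F_linear_def by (auto simp: algebra_simps)

lemma hpoly_scalar_cmult:
  assumes sf: "scalar_field F" and P: "P \<in> hpoly_scalar F s k" and c: "c \<in> F"
  shows "(\<lambda>x. c * P x) \<in> hpoly_scalar F s k"
proof -
  have "(\<lambda>x. c * P x) \<in> hpoly F s (*) k"
    using hpoly_compose[where t="(*)" and t'="(*)" and B="norm c" and \<psi>="\<lambda>y. c * y", OF _ F_linear_cmult]
      P by (simp add: norm_mult hpoly_scalar_def) blast
  then show ?thesis using P c sf_mult[OF sf] by (auto simp: hpoly_scalar_def)
qed


context
  fixes F :: "complex set" and s :: "complex \<Rightarrow> 'a::real_normed_vector \<Rightarrow> 'a"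
    and t :: "complex \<Rightarrow> 'b::banach \<Rightarrow> 'b" and k :: nat
  assumes sf: "scalar_field F" and nsX: "normed_space_over F s" and nsY: "normed_space_over F t"
begin

lemma prod_upd_split:
  assumes i: "i < k"
  shows "(\<Prod>j<k. g ((xs(i := w)) j)) = g w * (\<Prod>j\<in>{..<k} - {i}. g (xs j))"
proof -
  have "(\<Prod>j<k. g ((xs(i := w)) j)) = g ((xs(i := w)) i) * (\<Prod>j\<in>{..<k} - {i}. g ((xs(i := w)) j))"
    by (rule prod.remove) (use i in auto)
  also have "(\<Prod>j\<in>{..<k} - {i}. g ((xs(i := w)) j)) = (\<Prod>j\<in>{..<k} - {i}. g (xs j))"
    by (rule prod.cong) auto
  finally show ?thesis by simp
qed

lemma ml_rank_one:
  fixes g :: "'a \<Rightarrow> complex"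
  assumes fl: "F_linear F s (*) g" and gF: "\<And>x. g x \<in> F" and gb: "\<And>x. norm (g x) \<le> norm x"
    and \<beta>: "\<beta> \<in> F"
  shows "F_multilinear F s t k (\<lambda>xs. t (\<beta> * (\<Prod>i<k. g (xs i))) y)"
    and "norm (t (\<beta> * (\<Prod>i<k. g (xs i))) y) \<le> (norm \<beta> * norm y) * (\<Prod>i<k. norm (xs i))"
proof -
  have gadd: "g (u + v) = g u + g v" for u v using fl unfolding F_linear_def by blast
  have gsc: "c \<in> F \<Longrightarrow> g (s c u) = c * g u" for c u using fl unfolding F_linear_def by blast
  have prodF: "(\<Prod>i\<in>I. g (xs i)) \<in> F" for I xs by (rule sf_prod[OF sf gF])
  have bnd: "norm (t (\<beta> * (\<Prod>i<k. g (xs i))) y) \<le> (norm \<beta> * norm y) * (\<Prod>i<k. norm (xs i))" for xs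
  proof -
    have mF: "\<beta> * (\<Prod>i<k. g (xs i)) \<in> F" by (rule sf_mult[OF sf \<beta> prodF])
    have "norm (t (\<beta> * (\<Prod>i<k. g (xs i))) y) = norm \<beta> * (\<Prod>i<k. norm (g (xs i))) * norm y"
      using ns_norm[OF sf nsY mF, of y] by (simp add: norm_mult prod_norm)
    also have "norm \<beta> * (\<Prod>i<k. norm (g (xs i))) * norm y \<le> norm \<beta> * (\<Prod>i<k. norm (xs i)) * norm y"
    proof -
      have "(\<Prod>i<k. norm (g (xs i))) \<le> (\<Prod>i<k. norm (xs i))"
        by (rule prod_mono) (simp add: gb)
      then show ?thesis by (intro mult_right_mono mult_left_mono) auto
    qed
    finally show ?thesis by (simp add: ac_simps)
  qed
  then show "norm (t (\<beta> * (\<Prod>i<k. g (xs i))) y) \<le> (norm \<beta> * norm y) * (\<Prod>i<k. norm (xs i))" .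
  show "F_multilinear F s t k (\<lambda>xs. t (\<beta> * (\<Prod>i<k. g (xs i))) y)"
  proof (rule F_multilinearI[OF _ _ bnd])
    fix i xs assume i: "i < k"
    define R where "R = (\<Prod>j\<in>{..<k} - {i}. g (xs j))"
    have RF: "R \<in> F" unfolding R_def by (rule prodF)
    have sp: "(\<Prod>j<k. g ((xs(i := w)) j)) = g w * R" for w unfolding R_def by (rule prod_upd_split[OF i])
    show "F_linear F s t (\<lambda>v. t (\<beta> * (\<Prod>j<k. g ((xs(i := v)) j))) y)"
      unfolding F_linear_def sp
    proof (intro conjI allI ballI)
      fix u v
      have e1: "\<beta> * (g (u + v) * R) = \<beta> * (g u * R) + \<beta> * (g v * R)" by (simp add: gadd distrib_left distrib_right)
      have F1: "\<beta> * (g u * R) \<in> F" and F2: "\<beta> * (g v * R) \<in> F"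
        using \<beta> gF RF sf_mult[OF sf] by auto
      show "t (\<beta> * (g (u + v) * R)) y = t (\<beta> * (g u * R)) y + t (\<beta> * (g v * R)) y"
        unfolding e1 by (rule ns_add_scalar[OF sf nsY F1 F2])
    next
      fix c u assume c: "c \<in> F"
      have e1: "\<beta> * (g (s c u) * R) = c * (\<beta> * (g u * R))" by (simp add: gsc[OF c] ac_simps)
      have F1: "\<beta> * (g u * R) \<in> F" using \<beta> gF RF sf_mult[OF sf] by auto
      show "t (\<beta> * (g (s c u) * R)) y = t c (t (\<beta> * (g u * R)) y)"
        unfolding e1 by (rule ns_mult[OF sf nsY c F1])
    qed
  next
    fix xs ys :: "nat \<Rightarrow> 'a" assume "\<And>i. i < k \<Longrightarrow> xs i = ys i"
    then have "(\<Prod>i<k. g (xs i)) = (\<Prod>i<k. g (ys i))" by (intro prod.cong) auto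
    then show "t (\<beta> * (\<Prod>i<k. g (xs i))) y = t (\<beta> * (\<Prod>i<k. g (ys i))) y" by simp
  qed
qed

lemma hpoly_rank_one:
  fixes g :: "'a \<Rightarrow> complex"
  assumes fl: "F_linear F s (*) g" and gF: "\<And>x. g x \<in> F" and gb: "\<And>x. norm (g x) \<le> norm x"
    and \<beta>: "\<beta> \<in> F"
  shows "(\<lambda>x. t (\<beta> * g x ^ k) y) \<in> hpoly F s t k"
  by (rule hpolyI[OF sf nsX nsY ml_rank_one(1)[OF fl gF gb \<beta>]]) simp

lemma ml_series:
  fixes L :: "nat \<Rightarrow> (nat \<Rightarrow> 'a) \<Rightarrow> 'b" and c :: "nat \<Rightarrow> real"
  assumes Lj: "\<And>j. F_multilinear F s t k (L j)"
    and bnd: "\<And>j xs. norm (L j xs) \<le> c j * (\<Prod>i<k. norm (xs i))"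
    and sc: "summable c"
  shows "F_multilinear F s t k (\<lambda>xs. \<Sum>j. L j xs)"
    and "norm (\<Sum>j. L j xs) \<le> suminf c * (\<Prod>i<k. norm (xs i))"
proof -
  have summ: "summable (\<lambda>j. L j xs)" for xs
    by (rule summable_comparison_test'[OF summable_mult2[OF sc], of 0]) (rule bnd)
  have b2: "norm (\<Sum>j. L j xs) \<le> suminf c * (\<Prod>i<k. norm (xs i))" for xs
  proof -
    have "norm (\<Sum>j. L j xs) \<le> (\<Sum>j. c j * (\<Prod>i<k. norm (xs i)))"
      by (rule norm_suminf_le[OF bnd summable_mult2[OF sc]])
    also have "\<dots> = suminf c * (\<Prod>i<k. norm (xs i))" by (rule suminf_mult2[OF sc, symmetric])
    finally show ?thesis .
  qed
  then show "norm (\<Sum>j. L j xs) \<le> suminf c * (\<Prod>i<k. norm (xs i))" .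
  show "F_multilinear F s t k (\<lambda>xs. \<Sum>j. L j xs)"
  proof (rule F_multilinearI[OF _ _ b2])
    fix i xs assume i: "i < k"
    show "F_linear F s t (\<lambda>v. \<Sum>j. L j (xs(i := v)))"
      unfolding F_linear_def
    proof (intro conjI allI ballI)
      fix u v
      have "(\<Sum>j. L j (xs(i := u + v))) = (\<Sum>j. L j (xs(i := u)) + L j (xs(i := v)))"
        by (rule suminf_cong) (rule ml_add[OF sf nsX nsY Lj i])
      also have "\<dots> = (\<Sum>j. L j (xs(i := u))) + (\<Sum>j. L j (xs(i := v)))"
        by (rule suminf_add[OF summ summ, symmetric])
      finally show "(\<Sum>j. L j (xs(i := u + v))) = (\<Sum>j. L j (xs(i := u))) + (\<Sum>j. L j (xs(i := v)))" .
    next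
      fix a u assume a: "a \<in> F"
      have "(\<Sum>j. L j (xs(i := s a u))) = (\<Sum>j. t a (L j (xs(i := u))))"
        by (rule suminf_cong) (rule ml_smult[OF sf nsX nsY Lj i a])
      also have "\<dots> = t a (\<Sum>j. L j (xs(i := u)))"
        by (rule bounded_linear.suminf[OF ns_bounded_linear[OF sf nsY a] summ, symmetric])
      finally show "(\<Sum>j. L j (xs(i := s a u))) = t a (\<Sum>j. L j (xs(i := u)))" .
    qed
  next
    fix xs ys :: "nat \<Rightarrow> 'a" assume "\<And>i. i < k \<Longrightarrow> xs i = ys i"
    then have "L j xs = L j ys" for j using ml_cong[OF sf nsX nsY Lj] by blast
    then show "(\<Sum>j. L j xs) = (\<Sum>j. L j ys)" by simp
  qed
qed

end


section \<open>Hahn--Banach and norming of vector-valued polynomials\<close>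

text \<open>Zorn-style proof of the real Hahn--Banach theorem for the norm.  A dominated graph is the
  graph of a real-linear functional on a subspace that is bounded above by the norm; maximal
  dominated graphs are total because any dominated graph extends to one more direction.\<close>

definition dominated_graph :: "('b::real_normed_vector \<times> real) set \<Rightarrow> bool" where
  "dominated_graph G \<longleftrightarrow> (0, 0) \<in> G \<and> (\<forall>u a v b. (u, a) \<in> G \<longrightarrow> (v, b) \<in> G \<longrightarrow> (u + v, a + b) \<in> G) \<and>
     (\<forall>u a r. (u, a) \<in> G \<longrightarrow> (r *\<^sub>R u, r * a) \<in> G) \<and> (\<forall>u a. (u, a) \<in> G \<longrightarrow> a \<le> norm u)"

lemma dominated_graph_add: "dominated_graph G \<Longrightarrow> (u, a) \<in> G \<Longrightarrow> (v, b) \<in> G \<Longrightarrow> (u + v, a + b) \<in> G"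
  unfolding dominated_graph_def by blast

lemma dominated_graph_scale: "dominated_graph G \<Longrightarrow> (u, a) \<in> G \<Longrightarrow> (r *\<^sub>R u, r * a) \<in> G"
  unfolding dominated_graph_def by blast

lemma dominated_graph_dom: "dominated_graph G \<Longrightarrow> (u, a) \<in> G \<Longrightarrow> a \<le> norm u"
  unfolding dominated_graph_def by blast

lemma dominated_graph_zero: "dominated_graph G \<Longrightarrow> (0, 0) \<in> G"
  unfolding dominated_graph_def by blast

lemma dominated_graph_fun: "dominated_graph G \<Longrightarrow> (u, a) \<in> G \<Longrightarrow> (u, b) \<in> G \<Longrightarrow> a = b"
proof -
  assume G: "dominated_graph G" and a: "(u, a) \<in> G" and b: "(u, b) \<in> G"
  have "((-1) *\<^sub>R u, (-1) * b) \<in> G" by (rule dominated_graph_scale[OF G b])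
  then have "(u + (-1) *\<^sub>R u, a + (-1) * b) \<in> G" by (rule dominated_graph_add[OF G a])
  then have 1: "a - b \<le> 0" using dominated_graph_dom[OF G] by fastforce
  have "((-1) *\<^sub>R u, (-1) * a) \<in> G" by (rule dominated_graph_scale[OF G a])
  then have "(u + (-1) *\<^sub>R u, b + (-1) * a) \<in> G" by (rule dominated_graph_add[OF G b])
  then have 2: "b - a \<le> 0" using dominated_graph_dom[OF G] by fastforce
  from 1 2 show ?thesis by simp
qed

lemma dominated_graph_one_step:
  fixes G :: "('b::real_normed_vector \<times> real) set"
  assumes G: "dominated_graph G"
    and c_up: "\<And>v b. (v, b) \<in> G \<Longrightarrow> b - norm (v - z) \<le> c"
    and c_low: "\<And>u a. (u, a) \<in> G \<Longrightarrow> c \<le> norm (u + z) - a"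
  shows "dominated_graph {(u + t *\<^sub>R z, a + t * c) | u a t. (u, a) \<in> G}"
proof -
  define G' where "G' = {(u + t *\<^sub>R z, a + t * c) | u a t. (u, a) \<in> G}"
  have dom: "a + t * c \<le> norm (u + t *\<^sub>R z)" if ua: "(u, a) \<in> G" for u a t
  proof (cases "t > 0")
    case True
    have "((1/t) *\<^sub>R u, (1/t) * a) \<in> G" by (rule dominated_graph_scale[OF G ua])
    from c_low[OF this] have "c \<le> norm ((1/t) *\<^sub>R u + z) - (1/t) * a" .
    then have "t * c \<le> t * norm ((1/t) *\<^sub>R u + z) - a" using True by (simp add: field_simps)
    also have "t * norm ((1/t) *\<^sub>R u + z) = norm (t *\<^sub>R ((1/t) *\<^sub>R u + z))" using True by simp
    also have "t *\<^sub>R ((1/t) *\<^sub>R u + z) = u + t *\<^sub>R z" using True by (simp add: algebra_simps)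
    finally show ?thesis by simp
  next
    case False
    show ?thesis
    proof (cases "t = 0")
      case True
      then show ?thesis using dominated_graph_dom[OF G ua] by simp
    next
      case False
      define r where "r = - t"
      have r: "r > 0" using False \<open>\<not> t > 0\<close> by (simp add: r_def)
      have "((1/r) *\<^sub>R u, (1/r) * a) \<in> G" by (rule dominated_graph_scale[OF G ua])
      from c_up[OF this] have "(1/r) * a - norm ((1/r) *\<^sub>R u - z) \<le> c" .
      then have "a - r * norm ((1/r) *\<^sub>R u - z) \<le> r * c" using r by (simp add: field_simps)
      also have "r * norm ((1/r) *\<^sub>R u - z) = norm (r *\<^sub>R ((1/r) *\<^sub>R u - z))" using r by simp
      also have "r *\<^sub>R ((1/r) *\<^sub>R u - z) = u + t *\<^sub>R z" using r by (simp add: algebra_simps r_def)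
      finally show ?thesis by (simp add: r_def)
    qed
  qed
  show ?thesis
    unfolding G'_def[symmetric] dominated_graph_def
  proof (intro conjI allI impI)
    show "(0, 0) \<in> G'" unfolding G'_def using dominated_graph_zero[OF G]
      by (intro CollectI exI[of _ 0] exI[of _ "0::real"]) auto
  next
    fix u a v b assume "(u, a) \<in> G'" "(v, b) \<in> G'"
    then obtain u1 a1 t1 u2 a2 t2 where 1: "(u1, a1) \<in> G" "u = u1 + t1 *\<^sub>R z" "a = a1 + t1 * c"
      and 2: "(u2, a2) \<in> G" "v = u2 + t2 *\<^sub>R z" "b = a2 + t2 * c" unfolding G'_def by blast
    have "(u1 + u2, a1 + a2) \<in> G" by (rule dominated_graph_add[OF G 1(1) 2(1)])
    moreover have "u + v = (u1 + u2) + (t1 + t2) *\<^sub>R z" "a + b = (a1 + a2) + (t1 + t2) * c"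
      using 1 2 by (simp_all add: algebra_simps)
    ultimately show "(u + v, a + b) \<in> G'" unfolding G'_def by blast
  next
    fix u a r assume "(u, a) \<in> G'"
    then obtain u1 a1 t1 where 1: "(u1, a1) \<in> G" "u = u1 + t1 *\<^sub>R z" "a = a1 + t1 * c"
      unfolding G'_def by blast
    have "(r *\<^sub>R u1, r * a1) \<in> G" by (rule dominated_graph_scale[OF G 1(1)])
    moreover have "r *\<^sub>R u = r *\<^sub>R u1 + (r * t1) *\<^sub>R z" "r * a = r * a1 + (r * t1) * c"
      using 1 by (simp_all add: algebra_simps)
    ultimately show "(r *\<^sub>R u, r * a) \<in> G'" unfolding G'_def by blast
  next
    fix u a assume "(u, a) \<in> G'"
    then obtain u1 a1 t1 where 1: "(u1, a1) \<in> G" "u = u1 + t1 *\<^sub>R z" "a = a1 + t1 * c"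
      unfolding G'_def by blast
    show "a \<le> norm u" using dom[OF 1(1), of t1] 1 by simp
  qed
qed

text \<open>A dominated graph whose domain misses \<open>z\<close> has a proper dominated extension; \<open>c\<close> is
  taken as the supremum of the lower bounds.\<close>
lemma dominated_graph_extend:
  fixes G :: "('b::real_normed_vector \<times> real) set"
  assumes G: "dominated_graph G" and z: "z \<notin> Domain G"
  shows "\<exists>G'. dominated_graph G' \<and> G \<subseteq> G' \<and> G' \<noteq> G"
proof -
  define S where "S = {b - norm (v - z) | v b. (v, b) \<in> G}"
  have S_ne: "S \<noteq> {}" using dominated_graph_zero[OF G] unfolding S_def by blast
  have key: "b - norm (v - z) \<le> norm (u + z) - a" if "(u, a) \<in> G" "(v, b) \<in> G" for u a v b
  proof -
    have "a + b \<le> norm (u + v)" using dominated_graph_dom[OF G dominated_graph_add[OF G that]] .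
    also have "norm (u + v) = norm ((u + z) + (v - z))" by (simp add: algebra_simps)
    also have "\<dots> \<le> norm (u + z) + norm (v - z)" by (rule norm_triangle_ineq)
    finally show ?thesis by simp
  qed
  have S_bdd: "bdd_above S"
    unfolding bdd_above_def S_def using key[OF dominated_graph_zero[OF G]] by auto
  define c where "c = Sup S"
  have c_up: "b - norm (v - z) \<le> c" if "(v, b) \<in> G" for v b
    unfolding c_def by (rule cSup_upper[OF _ S_bdd]) (use that S_def in blast)
  have c_low: "c \<le> norm (u + z) - a" if "(u, a) \<in> G" for u a
    unfolding c_def by (rule cSup_least[OF S_ne]) (use key[OF that] S_def in blast)
  define G' where "G' = {(u + t *\<^sub>R z, a + t * c) | u a t. (u, a) \<in> G}"
  have "dominated_graph G'" unfolding G'_def by (rule dominated_graph_one_step[OF G c_up c_low])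
  moreover have "G \<subseteq> G'"
  proof
    fix p assume "p \<in> G"
    then obtain u a where "p = (u, a)" "(u, a) \<in> G" by (cases p) auto
    then show "p \<in> G'" unfolding G'_def by (intro CollectI exI[of _ u] exI[of _ a] exI[of _ "0::real"]) auto
  qed
  moreover have "(z, c) \<in> G'" unfolding G'_def using dominated_graph_zero[OF G]
    by (intro CollectI exI[of _ 0] exI[of _ "0::real"] exI[of _ "1::real"]) auto
  then have "G' \<noteq> G" using z by (auto simp: Domain_iff)
  ultimately show ?thesis by blast
qed

lemma dominated_graph_line: "dominated_graph {(r *\<^sub>R y0, r * norm y0) | r. True}"
  unfolding dominated_graph_def
  proof (intro conjI allI impI)
    show "(0, 0) \<in> {(r *\<^sub>R y0, r * norm y0) |r. True}" by (intro CollectI exI[of _ 0]) auto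
  next
    fix u a v b assume "(u, a) \<in> {(r *\<^sub>R y0, r * norm y0) |r. True}" "(v, b) \<in> {(r *\<^sub>R y0, r * norm y0) |r. True}"
    then obtain r1 r2 where "u = r1 *\<^sub>R y0" "a = r1 * norm y0" "v = r2 *\<^sub>R y0" "b = r2 * norm y0" by blast
    then show "(u + v, a + b) \<in> {(r *\<^sub>R y0, r * norm y0) |r. True}"
      by (intro CollectI exI[of _ "r1 + r2"]) (simp add: algebra_simps)
  next
    fix u a r assume "(u, a) \<in> {(r *\<^sub>R y0, r * norm y0) |r. True}"
    then obtain r1 where "u = r1 *\<^sub>R y0" "a = r1 * norm y0" by blast
    then show "(r *\<^sub>R u, r * a) \<in> {(r *\<^sub>R y0, r * norm y0) |r. True}"
      by (intro CollectI exI[of _ "r * r1"]) (simp add: algebra_simps)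
  next
    fix u a assume "(u, a) \<in> {(r *\<^sub>R y0, r * norm y0) |r. True}"
    then obtain r1 where "u = r1 *\<^sub>R y0" "a = r1 * norm y0" by blast
    then show "a \<le> norm u" by (simp add: mult_right_mono)
  qed

lemma dominated_graph_chain_Union:
  assumes ne: "C \<noteq> {}" and lg: "\<And>X. X \<in> C \<Longrightarrow> dominated_graph X"
    and tot: "\<And>X Y. X \<in> C \<Longrightarrow> Y \<in> C \<Longrightarrow> X \<subseteq> Y \<or> Y \<subseteq> X"
  shows "dominated_graph (\<Union>C)"
  unfolding dominated_graph_def
proof -
  obtain X0 where X0: "X0 \<in> C" using ne by blast
  show "(0, 0) \<in> \<Union>C \<and> (\<forall>u a v b. (u, a) \<in> \<Union>C \<longrightarrow> (v, b) \<in> \<Union>C \<longrightarrow> (u + v, a + b) \<in> \<Union>C) \<and>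
     (\<forall>u a r. (u, a) \<in> \<Union>C \<longrightarrow> (r *\<^sub>R u, r * a) \<in> \<Union>C) \<and> (\<forall>u a. (u, a) \<in> \<Union>C \<longrightarrow> a \<le> norm u)"
  proof (intro conjI allI impI)
    show "(0, 0) \<in> \<Union>C" using dominated_graph_zero[OF lg[OF X0]] X0 by blast
  next
    fix u a v b assume "(u, a) \<in> \<Union>C" "(v, b) \<in> \<Union>C"
    then obtain X Y where XY: "X \<in> C" "Y \<in> C" "(u, a) \<in> X" "(v, b) \<in> Y" by blast
    show "(u + v, a + b) \<in> \<Union>C"
    proof (cases "X \<subseteq> Y")
      case True
      then show ?thesis using dominated_graph_add[OF lg[OF XY(2)], of u a v b] XY by blast
    next
      case False
      then have "Y \<subseteq> X" using tot[OF XY(1,2)] by blast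
      then show ?thesis using dominated_graph_add[OF lg[OF XY(1)], of u a v b] XY by blast
    qed
  next
    fix u a r assume "(u, a) \<in> \<Union>C"
    then obtain X where "X \<in> C" "(u, a) \<in> X" by blast
    then show "(r *\<^sub>R u, r * a) \<in> \<Union>C" using dominated_graph_scale[OF lg] by blast
  next
    fix u a assume "(u, a) \<in> \<Union>C"
    then obtain X where "X \<in> C" "(u, a) \<in> X" by blast
    then show "a \<le> norm u" using dominated_graph_dom[OF lg] by blast
  qed
qed

lemma real_Hahn_Banach:
  fixes y0 :: "'b::real_normed_vector"
  shows "\<exists>g. (\<forall>u v. g (u + v) = g u + g v) \<and> (\<forall>r u. g (r *\<^sub>R u) = r * g u) \<and>
             g y0 = norm y0 \<and> (\<forall>y. g y \<le> norm y)"
proof -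
  define M where "M = {G :: ('b \<times> real) set. dominated_graph G \<and> (y0, norm y0) \<in> G}"
  have "{(r *\<^sub>R y0, r * norm y0) | r. True} \<in> M"
    unfolding M_def using dominated_graph_line[of y0] by (auto intro!: exI[of _ 1])
  then have "M \<noteq> {}" by blast
  moreover have "\<Union>C \<in> M" if C: "C \<noteq> {}" "subset.chain M C" for C
  proof -
    have CM: "C \<subseteq> M" and tot: "\<And>X Y. X \<in> C \<Longrightarrow> Y \<in> C \<Longrightarrow> X \<subseteq> Y \<or> Y \<subseteq> X"
      using C(2) unfolding subset_chain_def by blast+
    have "dominated_graph (\<Union>C)"
      by (rule dominated_graph_chain_Union[OF C(1) _ tot]) (use CM M_def in blast)
    moreover have "(y0, norm y0) \<in> \<Union>C" using C(1) CM unfolding M_def by blast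
    ultimately show ?thesis unfolding M_def by blast
  qed
  ultimately obtain G where GM: "G \<in> M" and Gmax: "\<And>X. X \<in> M \<Longrightarrow> G \<subseteq> X \<Longrightarrow> X = G"
    using subset_Zorn_nonempty[of M] by blast
  have G: "dominated_graph G" and Gy: "(y0, norm y0) \<in> G" using GM unfolding M_def by blast+
  have Gdom: "Domain G = UNIV"
  proof (rule ccontr)
    assume "Domain G \<noteq> UNIV"
    then obtain z where "z \<notin> Domain G" by blast
    from dominated_graph_extend[OF G this] obtain G' where G': "dominated_graph G'" "G \<subseteq> G'" "G' \<noteq> G" by blast
    have "G' \<in> M" using G' Gy unfolding M_def by blast
    then show False using Gmax G' by blast
  qed
  define g where "g y = (THE a. (y, a) \<in> G)" for y
  have gG: "(y, g y) \<in> G" for y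
  proof -
    obtain a where a: "(y, a) \<in> G" using Gdom by blast
    have "g y = a" unfolding g_def by (rule the_equality[where P="\<lambda>a. (y, a) \<in> G", OF a]) (use dominated_graph_fun[OF G a] in blast)
    then show ?thesis using a by simp
  qed
  have gI: "(y, a) \<in> G \<Longrightarrow> g y = a" for y a using dominated_graph_fun[OF G gG] by blast
  show ?thesis
  proof (intro exI[of _ g] conjI allI)
    show "g (u + v) = g u + g v" for u v by (rule gI[OF dominated_graph_add[OF G gG gG]])
    show "g (r *\<^sub>R u) = r * g u" for r u by (rule gI[OF dominated_graph_scale[OF G gG]])
    show "g y0 = norm y0" by (rule gI[OF Gy])
    show "g y \<le> norm y" for y by (rule dominated_graph_dom[OF G gG])
  qed
qed

text \<open>Complexification of a real functional: over \<open>\<complex>\<close> the real functional \<open>g\<close> determines the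
  complex-linear functional \<open>y \<mapsto> g y - i g (i y)\<close>, whose real part is \<open>g\<close>.\<close>
definition complexify :: "(complex \<Rightarrow> 'b \<Rightarrow> 'b) \<Rightarrow> ('b \<Rightarrow> real) \<Rightarrow> 'b \<Rightarrow> complex" where
  "complexify t g y = complex_of_real (g y) - \<i> * complex_of_real (g (t \<i> y))"

lemma Re_complexify: "Re (complexify t g y) = g y"
  by (simp add: complexify_def)

context
  fixes t :: "complex \<Rightarrow> 'b::real_normed_vector \<Rightarrow> 'b" and g :: "'b \<Rightarrow> real"
  assumes ns: "normed_space_over UNIV t"
    and gadd: "\<And>u v. g (u + v) = g u + g v" and gsc: "\<And>r u. g (r *\<^sub>R u) = r * g u"
begin

private lemma sf_UNIV: "scalar_field UNIV"
  by (simp add: scalar_field_def)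

lemma complexify_linear: "F_linear UNIV t (*) (complexify t g)"
proof -
  note sf = sf_UNIV
  define \<psi> where "\<psi> = complexify t g"
  have tR: "t (complex_of_real r) y = r *\<^sub>R y" for r y by (rule ns_of_real[OF sf ns])
  have ti_add: "t \<i> (u + v) = t \<i> u + t \<i> v" for u v using ns_add[OF sf ns, of \<i>] by simp
  have ti_sc: "t \<i> (r *\<^sub>R u) = r *\<^sub>R t \<i> u" for r u using ns_scaleR_comm[OF sf ns, of \<i>] by simp
  have tii: "t \<i> (t \<i> y) = - y" for y
  proof -
    have "t \<i> (t \<i> y) = t (\<i> * \<i>) y" using ns_mult[OF sf ns, of \<i> \<i> y] by simp
    also have "\<dots> = t (complex_of_real (-1)) y" by simp
    also have "\<dots> = - y" using tR[of "-1" y] by simp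
    finally show ?thesis .
  qed
  have tdec: "t c y = Re c *\<^sub>R y + Im c *\<^sub>R t \<i> y" for c y
  proof -
    have "t c y = t (complex_of_real (Re c) + \<i> * complex_of_real (Im c)) y"
      by (rule arg_cong[where f="\<lambda>c. t c y"]) (simp add: complex_eq_iff)
    also have "\<dots> = t (complex_of_real (Re c)) y + t (\<i> * complex_of_real (Im c)) y"
      by (rule ns_add_scalar[OF sf ns]) auto
    also have "t (\<i> * complex_of_real (Im c)) y = t \<i> (Im c *\<^sub>R y)"
      using ns_mult[OF sf ns, of \<i> "complex_of_real (Im c)" y] by (simp add: tR)
    finally show ?thesis by (simp add: tR ti_sc)
  qed
  have psi_add: "\<psi> (u + v) = \<psi> u + \<psi> v" for u v
    unfolding \<psi>_def complexify_def gadd ti_add by (simp add: complex_eq_iff)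
  have psi_sc: "\<psi> (r *\<^sub>R u) = complex_of_real r * \<psi> u" for r u
    unfolding \<psi>_def complexify_def gsc ti_sc by (simp add: complex_eq_iff)
  have gneg: "g (- y) = - g y" for y using gsc[of "-1" y] by simp
  have psi_i: "\<psi> (t \<i> y) = \<i> * \<psi> y" for y
    unfolding \<psi>_def complexify_def tii gneg by (simp add: complex_eq_iff)
  have psi_t: "\<psi> (t c y) = c * \<psi> y" for c y
  proof -
    have "\<psi> (t c y) = \<psi> (Re c *\<^sub>R y + Im c *\<^sub>R t \<i> y)"
      by (rule arg_cong[where f=\<psi>, OF tdec])
    also have "\<dots> = complex_of_real (Re c) * \<psi> y + complex_of_real (Im c) * (\<i> * \<psi> y)"
      by (simp only: psi_add psi_sc psi_i)
    also have "\<dots> = c * \<psi> y" by (simp add: complex_eq_iff)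
    finally show ?thesis .
  qed
  show ?thesis unfolding F_linear_def \<psi>_def[symmetric] by (simp add: psi_add psi_t)
qed

text \<open>If \<open>g \<le> \<parallel>\<cdot>\<parallel>\<close> then the complexification has norm at most one: rotate \<open>y\<close> so that the
  value becomes real and positive.\<close>
lemma complexify_norm:
  assumes gle: "\<And>y. g y \<le> norm y"
  shows "norm (complexify t g y) \<le> norm y"
proof -
  define \<psi> where "\<psi> = complexify t g"
  have psi_t: "\<psi> (t c y) = c * \<psi> y" for c y
    using complexify_linear unfolding F_linear_def \<psi>_def by blast
  show ?thesis
  proof (cases "\<psi> y = 0")
    case True then show ?thesis by (simp add: \<psi>_def)
  next
    case False
    define u where "u = cnj (\<psi> y) / complex_of_real (norm (\<psi> y))"
    have nu: "norm u = 1" using False by (simp add: u_def norm_divide)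
    have cw: "cnj (\<psi> y) * \<psi> y = complex_of_real (norm (\<psi> y)) * complex_of_real (norm (\<psi> y))"
      using complex_norm_square[of "\<psi> y"] by (simp add: mult.commute power2_eq_square)
    have "u * \<psi> y = cnj (\<psi> y) * \<psi> y / complex_of_real (norm (\<psi> y))" by (simp add: u_def)
    also have "\<dots> = complex_of_real (norm (\<psi> y))" unfolding cw using False by simp
    finally have "\<psi> (t u y) = complex_of_real (norm (\<psi> y))" by (simp add: psi_t)
    then have "norm (\<psi> y) = g (t u y)" using Re_complexify[of t g "t u y"] by (simp add: \<psi>_def)
    also have "\<dots> \<le> norm (t u y)" by (rule gle)
    also have "\<dots> = norm y" using ns_norm[OF sf_UNIV ns, of u y] nu by simp
    finally show ?thesis by (simp add: \<psi>_def)
  qed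
qed

end

lemma Hahn_Banach_F:
  fixes t :: "complex \<Rightarrow> 'b::real_normed_vector \<Rightarrow> 'b"
  assumes sf: "scalar_field F" and ns: "normed_space_over F t"
  shows "\<exists>\<psi>. F_linear F t (*) \<psi> \<and> (\<forall>y. \<psi> y \<in> F) \<and> (\<forall>y. norm (\<psi> y) \<le> norm y) \<and>
              \<psi> y0 = complex_of_real (norm y0)"
proof -
  obtain g where gadd: "\<And>u v. g (u + v) = g u + g v" and gsc: "\<And>r u. g (r *\<^sub>R u) = r * g u"
    and gy0: "g y0 = norm y0" and gle: "\<And>y. g y \<le> norm y"
    using real_Hahn_Banach[of y0] by blast
  show ?thesis
  proof (rule sf_cases[OF sf])
    assume FR: "F = \<real>"
    have gabs: "\<bar>g y\<bar> \<le> norm y" for y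
      using gle[of y] gle[of "(-1) *\<^sub>R y"] gsc[of "-1" y] by simp
    show ?thesis
    proof (intro exI[of _ "\<lambda>y. complex_of_real (g y)"] conjI allI)
      show "F_linear F t (*) (\<lambda>y. complex_of_real (g y))"
        unfolding F_linear_def
      proof (intro conjI allI ballI)
        fix x y show "complex_of_real (g (x + y)) = complex_of_real (g x) + complex_of_real (g y)"
          by (simp add: gadd)
      next
        fix c x assume "c \<in> F"
        then obtain r where c: "c = complex_of_real r" using FR by (auto elim: Reals_cases)
        show "complex_of_real (g (t c x)) = c * complex_of_real (g x)"
          unfolding c ns_of_real[OF sf ns] by (simp add: gsc)
      qed
    qed (use FR gabs gy0 in auto)
  next
    assume FU: "F = UNIV"
    then have nsU: "normed_space_over UNIV t" using ns by simp
    define \<psi> where "\<psi> = complexify t g"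
    have psi_norm: "norm (\<psi> y) \<le> norm y" for y
      unfolding \<psi>_def by (rule complexify_norm[OF nsU gadd gsc gle])
    have psi_y0: "\<psi> y0 = complex_of_real (norm y0)"
    proof -
      have r: "Re (\<psi> y0) = norm y0" unfolding \<psi>_def by (simp add: Re_complexify gy0)
      have "norm (\<psi> y0) = Re (\<psi> y0)"
        using psi_norm[of y0] r abs_Re_le_cmod[of "\<psi> y0"] by linarith
      then have "(Im (\<psi> y0))\<^sup>2 = 0" using cmod_power2[of "\<psi> y0"] by simp
      then show ?thesis using r by (simp add: complex_eq_iff)
    qed
    show ?thesis
      using complexify_linear[OF nsU gadd gsc] FU psi_norm psi_y0 unfolding \<psi>_def by auto
  qed
qed

text \<open>The norming hypothesis on scalar polynomials transfers to vector-valued ones: compose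
  with a Hahn--Banach functional norming the value \<open>Q x\<close>.\<close>
lemma norming_vector_valued:
  fixes sX :: "complex \<Rightarrow> 'a::real_normed_vector \<Rightarrow> 'a"
    and sY :: "complex \<Rightarrow> 'b::real_normed_vector \<Rightarrow> 'b"
  assumes sf: "scalar_field F" and nsX: "normed_space_over F sX" and nsY: "normed_space_over F sY"
    and k: "k \<ge> 1" and A: "A \<noteq> {}" "A \<subseteq> cball 0 1"
    and norming: "\<forall>P\<in>hpoly_scalar F sX k. pnorm P = (SUP a\<in>A. norm (P a))"
    and Q: "Q \<in> hpoly F sX sY k"
  shows "pnorm Q \<le> (SUP a\<in>A. norm (Q a))"
proof (rule pnorm_le)
  fix x :: 'a assume x: "norm x \<le> 1"
  obtain \<psi> where psi: "F_linear F sY (*) \<psi>" "\<And>y. \<psi> y \<in> F" "\<And>y. norm (\<psi> y) \<le> norm y"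
    "\<psi> (Q x) = complex_of_real (norm (Q x))"
    using Hahn_Banach_F[OF sf nsY, of "Q x"] by blast
  have R: "(\<lambda>x. \<psi> (Q x)) \<in> hpoly F sX (*) k"
    by (rule hpoly_compose[OF Q psi(1), where B=1]) (simp add: psi(3))
  then have RS: "(\<lambda>x. \<psi> (Q x)) \<in> hpoly_scalar F sX k" using psi(2) by (simp add: hpoly_scalar_def)
  have "norm (Q x) = norm (\<psi> (Q x))" by (simp add: psi(4))
  also have "\<dots> \<le> pnorm (\<lambda>x. \<psi> (Q x))"
    by (rule pnorm_ge[OF hpoly_pbounded[OF sf nsX ns_complex[OF sf] R] x])
  also have "\<dots> = (SUP a\<in>A. norm (\<psi> (Q a)))" using norming RS by blast
  also have "\<dots> \<le> (SUP a\<in>A. norm (Q a))"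
  proof (rule cSUP_mono[OF A(1)])
    show "bdd_above ((\<lambda>a. norm (Q a)) ` A)"
      unfolding bdd_above_def using A(2) pnorm_ge[OF hpoly_pbounded[OF sf nsX nsY Q]] by fastforce
    show "\<exists>m\<in>A. norm (\<psi> (Q n)) \<le> norm (Q m)" if "n \<in> A" for n using that psi(3) by blast
  qed
  finally show "norm (Q x) \<le> (SUP a\<in>A. norm (Q a))" .
qed


section \<open>A criterion for strong norm attainment\<close>

text \<open>A suitably rotated subsequence of \<open>aa\<close> is Cauchy; its limit is the point of strong attainment.\<close>

lemma half_pow_small: "e > 0 \<Longrightarrow> \<exists>i. (1/2::real) ^ i < e"
  by (rule real_arch_pow_inv) auto

lemma half_pow_mono: "i \<le> j \<Longrightarrow> (1/2::real) ^ j \<le> (1/2) ^ i"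
  by (rule power_decreasing) auto

lemma geometric_Cauchy_limit:
  fixes b :: "nat \<Rightarrow> 'a::banach"
  assumes bstep: "\<And>i. norm (b (Suc i) - b i) \<le> 2 * (1/2) ^ i"
  shows "\<exists>x0. b \<longlonglongrightarrow> x0 \<and> (\<forall>n. norm (b n - x0) \<le> 4 * (1/2) ^ n)"
proof -
  define e :: "nat \<Rightarrow> real" where "e i = (1/2) ^ i" for i
  have bdist: "norm (b m - b n) \<le> 4 * e n - 4 * e m" if "n \<le> m" for m n
    using that
  proof (induction m)
    case 0 then show ?case by simp
  next
    case (Suc m)
    show ?case
    proof (cases "n = Suc m")
      case True then show ?thesis by simp
    next
      case False
      then have "n \<le> m" using Suc.prems by simp
      have "norm (b (Suc m) - b n) \<le> norm (b (Suc m) - b m) + norm (b m - b n)"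
        by (rule norm_diff_triangle_le) auto
      also have "\<dots> \<le> 2 * e m + (4 * e n - 4 * e m)"
        using bstep Suc.IH[OF \<open>n \<le> m\<close>] by (intro add_mono) (auto simp: e_def)
      also have "\<dots> = 4 * e n - 4 * e (Suc m)" by (simp add: e_def)
      finally show ?thesis .
    qed
  qed
  have bdist2: "norm (b m - b n) \<le> 4 * e n" if "n \<le> m" for m n
  proof -
    have "0 < e m" by (simp add: e_def)
    then show ?thesis using bdist[OF that] by linarith
  qed
  have "Cauchy b"
  proof (rule CauchyI)
    fix r :: real assume r: "r > 0"
    obtain M0 where M0: "(1/2::real) ^ M0 < r / 4" using half_pow_small[of "r/4"] r by auto
    show "\<exists>M. \<forall>m\<ge>M. \<forall>n\<ge>M. norm (b m - b n) < r"
    proof (intro exI[of _ M0] allI impI)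
      fix m n assume mn: "m \<ge> M0" "n \<ge> M0"
      have "norm (b m - b n) \<le> 4 * e M0"
      proof (cases "n \<le> m")
        case True
        then have "norm (b m - b n) \<le> 4 * e n" by (rule bdist2)
        also have "\<dots> \<le> 4 * e M0" using half_pow_mono[OF mn(2)] by (simp add: e_def)
        finally show ?thesis .
      next
        case False
        then have "norm (b n - b m) \<le> 4 * e m" by (intro bdist2) simp
        also have "\<dots> \<le> 4 * e M0" using half_pow_mono[OF mn(1)] by (simp add: e_def)
        finally show ?thesis by (simp add: norm_minus_commute)
      qed
      also have "\<dots> < r" using M0 by (simp add: e_def)
      finally show "norm (b m - b n) < r" .
    qed
  qed
  then obtain x0 where bx0: "b \<longlonglongrightarrow> x0" using Cauchy_convergent_iff convergent_def by blast
  have "norm (b n - x0) \<le> 4 * e n" for n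
  proof -
    have "(\<lambda>m. norm (b m - b n)) \<longlonglongrightarrow> norm (x0 - b n)"
      by (intro tendsto_intros bx0)
    moreover have "eventually (\<lambda>m. norm (b m - b n) \<le> 4 * e n) sequentially"
      using bdist2 by (auto simp: eventually_sequentially)
    ultimately have "norm (x0 - b n) \<le> 4 * e n" by (rule tendsto_upperbound) simp
    then show ?thesis by (simp add: norm_minus_commute)
  qed
  then show ?thesis using bx0 by (auto simp: e_def)
qed

context
  fixes F :: "complex set" and s :: "complex \<Rightarrow> 'a::banach \<Rightarrow> 'a"
  assumes sf: "scalar_field F" and ns: "normed_space_over F s"
begin

definition "unimodular = {c \<in> F. norm c = 1}"

lemma unimodular_mult: "c \<in> unimodular \<Longrightarrow> d \<in> unimodular \<Longrightarrow> c * d \<in> unimodular"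
  unfolding unimodular_def using sf_mult[OF sf] by (auto simp: norm_mult)

lemma unimodular_cnj: "c \<in> unimodular \<Longrightarrow> cnj c \<in> unimodular"
  unfolding unimodular_def using sf_cnj[OF sf] by auto

lemma unimodular_1: "1 \<in> unimodular"
  unfolding unimodular_def using sf_1[OF sf] by auto

lemma unimodular_rot_norm: "c \<in> unimodular \<Longrightarrow> norm (s c x) = norm x"
  unfolding unimodular_def using ns_norm[OF sf ns] by auto

lemma unimodular_rot_diff: "c \<in> unimodular \<Longrightarrow> norm (s c x - s c y) = norm (x - y)"
  using unimodular_rot_norm[of c "x - y"] ns_diff_vec[OF sf ns, of c x y] unfolding unimodular_def by auto

lemma unimodular_rot_mult: "c \<in> unimodular \<Longrightarrow> d \<in> unimodular \<Longrightarrow> s (c * d) x = s c (s d x)"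
  using ns_mult[OF sf ns] unfolding unimodular_def by auto

lemma unimodular_cancel: "c \<in> unimodular \<Longrightarrow> s (cnj c) (s c x) = x"
  using ns_cancel[OF sf ns] unfolding unimodular_def by auto

lemma unimodular_compact: "compact unimodular"
  unfolding unimodular_def by (rule sf_sphere_compact[OF sf])

lemma unimodular_triangle:
  assumes c: "c \<in> unimodular" and d: "d \<in> unimodular" and x: "norm (x - s c z) \<le> e1" and y: "norm (y - s d z) \<le> e2"
  shows "norm (s (c * cnj d) y - x) \<le> e1 + e2"
proof -
  have cd: "cnj d \<in> unimodular" by (rule unimodular_cnj[OF d])
  have "s (c * cnj d) y = s c (s (cnj d) y)" by (rule unimodular_rot_mult[OF c cd])
  have "norm (s (c * cnj d) y - s c z) = norm (s c (s (cnj d) y) - s c (s (cnj d) (s d z)))"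
    using unimodular_rot_mult[OF c cd] unimodular_cancel[OF d] by simp
  also have "\<dots> = norm (s (cnj d) y - s (cnj d) (s d z))" by (rule unimodular_rot_diff[OF c])
  also have "\<dots> = norm (y - s d z)" by (rule unimodular_rot_diff[OF cd])
  finally have 1: "norm (s (c * cnj d) y - s c z) \<le> e2" using y by simp
  have "norm (s (c * cnj d) y - x) \<le> norm (s (c * cnj d) y - s c z) + norm (x - s c z)"
    by (rule norm_diff_triangle_le[OF order_refl]) (simp add: norm_minus_commute)
  then show ?thesis using 1 x by simp
qed

lemma continuous_on_rotation: "continuous_on unimodular (\<lambda>c. s c x0)"
  unfolding continuous_on_iff
proof (intro ballI allI impI)
  fix c and r :: real assume c: "c \<in> unimodular" and r: "r > 0"
  show "\<exists>d>0. \<forall>c'\<in>unimodular. dist c' c < d \<longrightarrow> dist (s c' x0) (s c x0) < r"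
  proof (intro exI[of _ "r / (norm x0 + 1)"] conjI ballI impI)
    have pos: "norm x0 + 1 > 0" using norm_ge_zero[of x0] by linarith
    show "r / (norm x0 + 1) > 0" using r pos by (rule divide_pos_pos)
    fix c' assume c': "c' \<in> unimodular" and d: "dist c' c < r / (norm x0 + 1)"
    have "dist (s c' x0) (s c x0) = norm (c' - c) * norm x0"
      unfolding dist_norm using ns_dist_scalar[OF sf ns, of c' c x0] c c' unfolding unimodular_def by simp
    also have "\<dots> \<le> norm (c' - c) * (norm x0 + 1)" by (simp add: mult_left_mono)
    also have "\<dots> < r" using d pos by (simp add: dist_norm pos_less_divide_eq)
    finally show "dist (s c' x0) (s c x0) < r" .
  qed
qed

text \<open>A sequence that approaches the orbit of \<open>x0\<close> under rotations has a subsequence converging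
  to one point of the orbit, by compactness of the unimodular scalars.\<close>
lemma rotation_subsequence:
  fixes xn :: "nat \<Rightarrow> 'a"
  assumes close: "\<And>\<epsilon>. \<epsilon> > 0 \<Longrightarrow> \<exists>J. \<forall>j\<ge>J. \<exists>c\<in>unimodular. norm (xn j - s c x0) \<le> \<epsilon>"
  shows "\<exists>c\<in>unimodular. \<exists>r. strict_mono r \<and> (\<lambda>n. xn (r n)) \<longlonglongrightarrow> s c x0"
proof -
  have cont: "continuous_on unimodular (\<lambda>c. norm (xn j - s c x0))" for j
    using continuous_on_rotation by (intro continuous_intros)
  have "\<forall>j. \<exists>c\<in>unimodular. \<forall>c'\<in>unimodular. norm (xn j - s c x0) \<le> norm (xn j - s c' x0)"
    using continuous_attains_inf[OF unimodular_compact _ cont] unimodular_1 by blast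
  then obtain lam where lam: "\<And>j. lam j \<in> unimodular"
    and lam_min: "\<And>j c'. c' \<in> unimodular \<Longrightarrow> norm (xn j - s (lam j) x0) \<le> norm (xn j - s c' x0)"
    by metis
  have lam0: "(\<lambda>j. norm (xn j - s (lam j) x0)) \<longlonglongrightarrow> 0"
  proof (rule LIMSEQ_I)
    fix r :: real assume r: "r > 0"
    obtain J where J: "\<And>j. j \<ge> J \<Longrightarrow> \<exists>c\<in>unimodular. norm (xn j - s c x0) \<le> r / 2"
      using close[of "r/2"] r by auto
    have "norm (xn n - s (lam n) x0) \<le> r / 2" if "n \<ge> J" for n
      using J[OF that] lam_min order_trans by blast
    then show "\<exists>no. \<forall>n\<ge>no. norm (norm (xn n - s (lam n) x0) - 0) < r"
      using r by (intro exI[of _ J]) force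
  qed
  have "seq_compact unimodular" by (rule compact_imp_seq_compact[OF unimodular_compact])
  then obtain c r where c: "c \<in> unimodular" and r: "strict_mono r" and lr: "(lam \<circ> r) \<longlonglongrightarrow> c"
    using seq_compactE lam by metis
  have "(\<lambda>n. xn (r n) - s c x0) \<longlonglongrightarrow> 0"
  proof (rule Lim_null_comparison)
    show "eventually (\<lambda>n. norm (xn (r n) - s c x0) \<le>
            norm (xn (r n) - s (lam (r n)) x0) + norm (lam (r n) - c) * norm x0) sequentially"
    proof (intro always_eventually allI)
      fix n
      have "norm (xn (r n) - s c x0) \<le> norm (xn (r n) - s (lam (r n)) x0) + norm (s (lam (r n)) x0 - s c x0)"
        by (rule norm_diff_triangle_le) auto
      also have "norm (s (lam (r n)) x0 - s c x0) = norm (lam (r n) - c) * norm x0"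
        using ns_dist_scalar[OF sf ns, of "lam (r n)" c x0] lam[of "r n"] c unfolding unimodular_def by simp
      finally show "norm (xn (r n) - s c x0) \<le> norm (xn (r n) - s (lam (r n)) x0) + norm (lam (r n) - c) * norm x0" .
    qed
    have a: "(\<lambda>n. norm (xn (r n) - s (lam (r n)) x0)) \<longlonglongrightarrow> 0"
      using LIMSEQ_subseq_LIMSEQ[OF lam0 r] by (simp add: o_def)
    have "(\<lambda>n. lam (r n) - c) \<longlonglongrightarrow> c - c" using lr by (intro tendsto_intros) (simp add: o_def)
    then have "(\<lambda>n. norm (lam (r n) - c)) \<longlonglongrightarrow> 0" using tendsto_norm_zero by fastforce
    then have b: "(\<lambda>n. norm (lam (r n) - c) * norm x0) \<longlonglongrightarrow> 0" using tendsto_mult_left_zero by blast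
    show "(\<lambda>n. norm (xn (r n) - s (lam (r n)) x0) + norm (lam (r n) - c) * norm x0) \<longlonglongrightarrow> 0"
      using tendsto_add[OF a b] by simp
  qed
  then have "(\<lambda>n. xn (r n)) \<longlonglongrightarrow> s c x0" by (rule LIM_zero_cancel)
  then show ?thesis using c r by blast
qed

text \<open>If from index \<open>N i\<close> on all terms of \<open>aa\<close> lie within \<open>2^-i\<close> of a rotation of \<open>aa (N i)\<close>, then
  some point \<open>x0\<close> of the unit ball lies within \<open>5 \<cdot> 2^-i\<close> of a rotation of every \<open>aa (N i)\<close>: rotate a
  suitable subsequence of \<open>aa\<close> into a Cauchy sequence and take its limit.\<close>
lemma rotated_limit:
  fixes aa :: "nat \<Rightarrow> 'a" and N :: "nat \<Rightarrow> nat"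
  assumes aa: "\<And>n. norm (aa n) \<le> 1"
    and near: "\<And>i m. m \<ge> N i \<Longrightarrow> \<exists>c\<in>unimodular. norm (aa m - s c (aa (N i))) \<le> (1/2) ^ i"
  shows "\<exists>x0. norm x0 \<le> 1 \<and> (\<forall>i. \<exists>c\<in>unimodular. norm (aa (N i) - s c x0) \<le> 5 * (1/2) ^ i)"
proof -
  define e :: "nat \<Rightarrow> real" where "e i = (1/2) ^ i" for i
  define NN where "NN i = (\<Sum>j\<le>i. N j)" for i
  have NN1: "N i \<le> NN i" for i unfolding NN_def by (rule member_le_sum) auto
  have NN2: "N i \<le> NN (Suc i)" for i unfolding NN_def by (rule member_le_sum) auto
  have "\<forall>i. \<exists>d\<in>unimodular. norm (s d (aa (NN (Suc i))) - aa (NN i)) \<le> 2 * e i"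
  proof
    fix i
    obtain c1 where c1: "c1 \<in> unimodular" "norm (aa (NN i) - s c1 (aa (N i))) \<le> e i"
      using near[OF NN1] unfolding e_def by blast
    obtain c2 where c2: "c2 \<in> unimodular" "norm (aa (NN (Suc i)) - s c2 (aa (N i))) \<le> e i"
      using near[OF NN2] unfolding e_def by blast
    have "norm (s (c1 * cnj c2) (aa (NN (Suc i))) - aa (NN i)) \<le> e i + e i"
      by (rule unimodular_triangle[OF c1(1) c2(1) c1(2) c2(2)])
    then show "\<exists>d\<in>unimodular. norm (s d (aa (NN (Suc i))) - aa (NN i)) \<le> 2 * e i"
      using unimodular_mult[OF c1(1) unimodular_cnj[OF c2(1)]] by (intro bexI[of _ "c1 * cnj c2"]) auto
  qed
  then obtain dd where dd: "\<And>i. dd i \<in> unimodular"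
    "\<And>i. norm (s (dd i) (aa (NN (Suc i))) - aa (NN i)) \<le> 2 * e i"
    by metis
  text \<open>Accumulated rotations \<open>mu i = dd 0 \<cdots> dd (i - 1)\<close> align the terms \<open>aa (NN i)\<close>.\<close>
  define mu where "mu = rec_nat 1 (\<lambda>i m. m * dd i)"
  have mu0: "mu 0 = 1" and muS: "mu (Suc i) = mu i * dd i" for i by (simp_all add: mu_def)
  have muU: "mu i \<in> unimodular" for i
    by (induction i) (simp_all add: mu0 muS unimodular_1 unimodular_mult dd)
  define b where "b i = s (mu i) (aa (NN i))" for i
  have bnorm: "norm (b i) \<le> 1" for i unfolding b_def using unimodular_rot_norm[OF muU] aa by simp
  have bstep: "norm (b (Suc i) - b i) \<le> 2 * (1/2) ^ i" for i
  proof -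
    have "b (Suc i) = s (mu i) (s (dd i) (aa (NN (Suc i))))"
      unfolding b_def muS by (rule unimodular_rot_mult[OF muU dd(1)])
    then have "norm (b (Suc i) - b i) = norm (s (dd i) (aa (NN (Suc i))) - aa (NN i))"
      unfolding b_def by (simp add: unimodular_rot_diff[OF muU])
    then show ?thesis using dd(2) by (simp add: e_def)
  qed
  obtain x0 where bx0: "b \<longlonglongrightarrow> x0" and bdist: "\<And>n. norm (b n - x0) \<le> 4 * e n"
    using geometric_Cauchy_limit[OF bstep] unfolding e_def by blast
  have x0norm: "norm x0 \<le> 1"
    by (rule tendsto_upperbound[OF tendsto_norm[OF bx0]]) (simp_all add: bnorm)
  have "\<exists>c\<in>unimodular. norm (aa (N i) - s c x0) \<le> 5 * e i" for i
  proof -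
    obtain c2 where c2: "c2 \<in> unimodular" "norm (aa (NN i) - s c2 (aa (N i))) \<le> e i"
      using near[OF NN1] unfolding e_def by blast
    have c2': "cnj c2 \<in> unimodular" by (rule unimodular_cnj[OF c2(1)])
    have "norm (aa (N i) - s (cnj c2) (aa (NN i))) = norm (s c2 (aa (N i)) - aa (NN i))"
      using unimodular_rot_diff[OF c2', of "s c2 (aa (N i))" "aa (NN i)"]
      by (simp add: unimodular_cancel[OF c2(1)])
    then have h1: "norm (aa (N i) - s (cnj c2) (aa (NN i))) \<le> e i"
      using c2(2) by (simp add: norm_minus_commute)
    have h2: "norm (x0 - s (mu i) (aa (NN i))) \<le> 4 * e i"
      using bdist[of i] by (simp add: b_def norm_minus_commute)
    have "norm (s (cnj c2 * cnj (mu i)) x0 - aa (N i)) \<le> e i + 4 * e i"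
      by (rule unimodular_triangle[OF c2' muU h1 h2])
    then show ?thesis
      using unimodular_mult[OF c2' unimodular_cnj[OF muU]]
      by (intro bexI[of _ "cnj c2 * cnj (mu i)"]) (auto simp: norm_minus_commute)
  qed
  then show ?thesis using x0norm unfolding e_def by blast
qed

lemma strong_attainment_criterion:
  fixes aa :: "nat \<Rightarrow> 'a" and phi :: "'a \<Rightarrow> real" and M :: real
  assumes aa: "\<And>n. norm (aa n) \<le> 1"
    and K: "\<And>e. e > 0 \<Longrightarrow> \<exists>N \<tau>. \<tau> > 0 \<and>
        (\<forall>x. norm x \<le> 1 \<longrightarrow> phi x \<ge> M - \<tau> \<longrightarrow> (\<exists>c\<in>F. norm c = 1 \<and> norm (x - s c (aa N)) \<le> e)) \<and>
        (\<forall>m\<ge>N. phi (aa m) \<ge> M - \<tau>)"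
  shows "\<exists>x0. norm x0 \<le> 1 \<and> (\<forall>xn. (\<forall>n. norm (xn n) \<le> 1) \<longrightarrow> (\<lambda>n. phi (xn n)) \<longlonglongrightarrow> M \<longrightarrow>
          (\<exists>c\<in>F. norm c = 1 \<and> (\<exists>r. strict_mono r \<and> (\<lambda>n. xn (r n)) \<longlonglongrightarrow> s c x0)))"
proof -
  define e :: "nat \<Rightarrow> real" where "e i = (1/2) ^ i" for i
  have "\<forall>i. \<exists>N \<tau>. \<tau> > 0 \<and>
        (\<forall>x. norm x \<le> 1 \<longrightarrow> phi x \<ge> M - \<tau> \<longrightarrow> (\<exists>c\<in>unimodular. norm (x - s c (aa N)) \<le> e i)) \<and>
        (\<forall>m\<ge>N. phi (aa m) \<ge> M - \<tau>)"
    using K[of "e _"] unfolding unimodular_def e_def by (simp add: Bex_def)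
  then obtain N \<tau> where tpos: "\<And>i. \<tau> i > 0"
    and KN: "\<And>i x. norm x \<le> 1 \<Longrightarrow> phi x \<ge> M - \<tau> i \<Longrightarrow> \<exists>c\<in>unimodular. norm (x - s c (aa (N i))) \<le> e i"
    and KA: "\<And>i m. m \<ge> N i \<Longrightarrow> phi (aa m) \<ge> M - \<tau> i"
    by metis
  have near: "\<And>i m. m \<ge> N i \<Longrightarrow> \<exists>c\<in>unimodular. norm (aa m - s c (aa (N i))) \<le> (1/2) ^ i"
    using KN KA aa unfolding e_def by blast
  obtain x0 where x0: "norm x0 \<le> 1"
    and x0N: "\<And>i. \<exists>c\<in>unimodular. norm (aa (N i) - s c x0) \<le> 5 * e i"
    using rotated_limit[of aa N, OF aa near] unfolding e_def by blast
  show ?thesis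
  proof (intro exI[of _ x0] conjI x0 allI impI)
    fix xn :: "nat \<Rightarrow> 'a" assume xn1: "\<forall>n. norm (xn n) \<le> 1" and xnM: "(\<lambda>n. phi (xn n)) \<longlonglongrightarrow> M"
    text \<open>A near-maximal \<open>xn j\<close> is close to a rotation of \<open>aa (N i)\<close>, hence of \<open>x0\<close>.\<close>
    have close: "\<exists>J. \<forall>j\<ge>J. \<exists>c\<in>unimodular. norm (xn j - s c x0) \<le> 6 * e i" for i
    proof -
      have "eventually (\<lambda>j. phi (xn j) > M - \<tau> i) sequentially"
        using xnM tpos[of i] by (intro order_tendstoD(1)) auto
      then obtain J where J: "\<And>j. j \<ge> J \<Longrightarrow> phi (xn j) > M - \<tau> i" by (auto simp: eventually_sequentially)
      obtain c where c: "c \<in> unimodular" "norm (aa (N i) - s c x0) \<le> 5 * e i" using x0N by blast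
      have "\<exists>c\<in>unimodular. norm (xn j - s c x0) \<le> 6 * e i" if j: "j \<ge> J" for j
      proof -
        obtain c1 where c1: "c1 \<in> unimodular" "norm (xn j - s c1 (aa (N i))) \<le> e i"
          using KN[of "xn j" i] xn1 J[OF j] by fastforce
        have "norm (xn j - s (c1 * c) x0) \<le> norm (xn j - s c1 (aa (N i))) + norm (s c1 (aa (N i)) - s c1 (s c x0))"
          using norm_triangle_ineq[of "xn j - s c1 (aa (N i))" "s c1 (aa (N i)) - s c1 (s c x0)"]
          by (simp add: unimodular_rot_mult[OF c1(1) c(1)])
        also have "\<dots> \<le> 6 * e i" using c1(2) c(2) by (simp add: unimodular_rot_diff[OF c1(1)])
        finally show ?thesis using unimodular_mult[OF c1(1) c(1)] by blast
      qed
      then show ?thesis by blast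
    qed
    have "\<exists>J. \<forall>j\<ge>J. \<exists>c\<in>unimodular. norm (xn j - s c x0) \<le> \<epsilon>" if \<epsilon>: "\<epsilon> > 0" for \<epsilon>
    proof -
      obtain i where i: "(1/2::real) ^ i < \<epsilon> / 6" using half_pow_small[of "\<epsilon>/6"] \<epsilon> by auto
      then have "6 * e i \<le> \<epsilon>" by (simp add: e_def)
      moreover obtain J where "\<forall>j\<ge>J. \<exists>c\<in>unimodular. norm (xn j - s c x0) \<le> 6 * e i"
        using close by blast
      ultimately show ?thesis by (meson order_trans)
    qed
    then show "\<exists>c\<in>F. norm c = 1 \<and> (\<exists>r. strict_mono r \<and> (\<lambda>n. xn (r n)) \<longlonglongrightarrow> s c x0)"
      using rotation_subsequence unfolding unimodular_def by blast
  qed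
qed

end


section \<open>The perturbation construction\<close>

text \<open>Given a nonzero polynomial \<open>P1\<close> and a small \<open>g0\<close>, we build a strongly norm attaining
  polynomial close to \<open>P1\<close> by adding infinitely many rank-one bumps
  \<open>P (n+1) = P n + \<gamma>(n) \<cdot> f(a n)(x)^k \<cdot> P n (a n)\<close>, where \<open>a n\<close> is an exposed point at which \<open>P n\<close> is
  nearly maximal and \<open>f (a n)\<close> its exposing functional.  The weights \<open>\<gamma>(n) = g0 \<cdot> 2^-(n*n)\<close> decay so
  fast that each bump dominates all later ones, which forces near-maximal points of the limit
  towards a rotation of \<open>a N\<close> for large \<open>N\<close>.\<close>

locale perturbation_sizes =
  fixes g0 :: real
  assumes g0_pos: "0 < g0"
begin

definition gam :: "nat \<Rightarrow> real" where
  "gam n = g0 * (1/2) ^ (n * n)"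

definition tail :: "nat \<Rightarrow> real" where
  "tail n = (\<Sum>i. gam (i + n))"

lemma gam_pos: "gam n > 0"
  using g0_pos by (simp add: gam_def)

lemma gam_le_geometric: "gam n \<le> g0 * (1/2) ^ n"
  unfolding gam_def using g0_pos by (intro mult_left_mono power_decreasing) (auto simp: le_square)

lemma gam_le: "gam n \<le> g0"
proof -
  have "(1/2::real) ^ n \<le> 1" by (rule power_le_one) auto
  then have "g0 * (1/2) ^ n \<le> g0" using g0_pos by (intro mult_left_le) auto
  then show ?thesis using gam_le_geometric[of n] by linarith
qed

lemma gam_antimono: "n \<le> m \<Longrightarrow> gam m \<le> gam n"
  unfolding gam_def using g0_pos by (intro mult_left_mono power_decreasing) (auto intro: mult_le_mono)

lemma summable_geometric_weights: "summable (\<lambda>n. g0 * (1/2::real) ^ n)"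
  by (intro summable_mult summable_geometric) simp

lemma summable_gam: "summable gam"
  by (rule summable_comparison_test'[OF summable_geometric_weights, of 0])
     (use gam_le_geometric gam_pos in \<open>simp add: less_imp_le\<close>)

lemma summable_gam_shift: "summable (\<lambda>i. gam (i + n))"
  by (rule summable_ignore_initial_segment[OF summable_gam])

lemma tail_0_le: "tail 0 \<le> 2 * g0"
proof -
  have "tail 0 = suminf gam" by (simp add: tail_def)
  also have "\<dots> \<le> (\<Sum>n. g0 * (1/2::real) ^ n)"
    by (rule suminf_le[OF gam_le_geometric summable_gam summable_geometric_weights])
  also have "\<dots> = 2 * g0"
    using suminf_mult[of "\<lambda>n. (1/2::real) ^ n" g0] suminf_geometric[of "1/2::real"] by simp
  finally show ?thesis .
qed

lemma partial_sum_le_tail_0: "(\<Sum>j<n. gam j) \<le> tail 0"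
  unfolding tail_def by (simp, rule sum_le_suminf[OF summable_gam]) (auto simp: gam_pos less_imp_le)

lemma tail_Suc_le: "tail (Suc n) \<le> gam n * (1/2) ^ n"
proof -
  have ex: "n * n + n + i + 1 \<le> (i + Suc n) * (i + Suc n)" for i
  proof -
    have "(i + Suc n) * (i + Suc n) = i * (i + Suc n) + Suc n * (i + Suc n)" by (rule add_mult_distrib)
    moreover have "Suc n * Suc n \<le> Suc n * (i + Suc n)" by (rule mult_le_mono2) simp
    moreover have "i \<le> i * (i + Suc n)" by simp
    ultimately show ?thesis by simp
  qed
  have b: "gam (i + Suc n) \<le> (gam n * (1/2) ^ n * (1/2)) * (1/2) ^ i" for i
  proof -
    have "gam (i + Suc n) \<le> g0 * (1/2) ^ (n * n + n + i + 1)"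
      unfolding gam_def using g0_pos ex[of i] by (intro mult_left_mono power_decreasing) auto
    also have "\<dots> = (gam n * (1/2) ^ n * (1/2)) * (1/2) ^ i" by (simp add: gam_def power_add)
    finally show ?thesis .
  qed
  have sg2: "summable (\<lambda>i. (gam n * (1/2) ^ n * (1/2)) * (1/2::real) ^ i)"
    by (intro summable_mult summable_geometric) simp
  have "tail (Suc n) \<le> (\<Sum>i. (gam n * (1/2) ^ n * (1/2)) * (1/2::real) ^ i)"
    unfolding tail_def by (rule suminf_le[OF b summable_gam_shift sg2])
  also have "\<dots> = gam n * (1/2) ^ n"
    using suminf_mult[of "\<lambda>n. (1/2::real) ^ n" "gam n * (1/2) ^ n * (1/2)"] suminf_geometric[of "1/2::real"]
    by simp
  finally show ?thesis .
qed

lemma tail_antimono: "n \<le> m \<Longrightarrow> tail m \<le> tail n"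
proof -
  have "tail (Suc n) = tail n - gam n" for n
    using suminf_split_head[OF summable_gam_shift[of n]] by (simp add: tail_def)
  then have "decseq tail" using gam_pos by (intro decseq_SucI) (simp add: less_imp_le)
  then show "n \<le> m \<Longrightarrow> tail m \<le> tail n" by (rule decseqD)
qed

end

text \<open>A bump of relative size \<open>g\<close> at a point that is \<open>g^2 M1\<close>-maximal does not decrease the norm.\<close>

lemma bump_norm_gain: fixes g M M1 :: real assumes "0 \<le> g" "g \<le> 1/4" "M1 \<le> M" "0 < M1"
  shows "M \<le> (1+g)*(M - g^2*M1)"
proof -
  have h1: "g * M1 \<le> g * M" using assms by (intro mult_left_mono) auto
  have "g * (1 + g) \<le> (1/4) * (5/4)" by (rule mult_mono) (use assms in auto)
  then have h2: "g * (1 + g) \<le> 1" by simp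
  have h3: "g^2 * M1 * (1 + g) \<le> g * M1"
  proof -
    have "g^2 * M1 * (1 + g) = (g * (1 + g)) * (g * M1)" by (simp add: power2_eq_square algebra_simps)
    also have "\<dots> \<le> 1 * (g * M1)" using h2 assms by (intro mult_right_mono) auto
    finally show ?thesis by simp
  qed
  have "(1+g)*(M - g^2*M1) = M + g * M - g^2 * M1 * (1 + g)" by (simp add: algebra_simps)
  then show ?thesis using h1 h3 by linarith
qed

text \<open>Growth of the norms: each bump multiplies the norm by at most \<open>1 + g\<close>.\<close>
lemma bump_norm_growth: fixes g S M M1 :: real assumes "0 \<le> g" "0 \<le> S" "S \<le> 1/2" "M \<le> M1 * (1 + 2*S)" "0 < M1"
  shows "M * (1 + g) \<le> M1 * (1 + 2*(S + g))"
proof -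
  have h1: "M * g \<le> M1 * (1 + 2*S) * g" using assms by (intro mult_right_mono) auto
  have h2: "(2 * S) * (M1 * g) \<le> 1 * (M1 * g)" using assms by (intro mult_right_mono) auto
  show ?thesis using h1 h2 assms(4) by (simp add: algebra_simps)
qed

text \<open>Bookkeeping for the key estimate: a near-maximal point of the limit polynomial makes the
  \<open>N\<close>-th bump nearly maximal, i.e. \<open>W = |f(a N)(x)|^k\<close> close to one.\<close>
lemma near_max_defect: fixes P Q Mi MN G W eta TT tau M1 :: real
  assumes a1: "Q \<ge> P - 2*M1*TT" and a2: "Mi \<ge> (1+G)*(MN - eta) - 2*M1*TT" and a3: "Q \<le> MN + G*W*MN" and a4: "P \<ge> Mi - tau"
  shows "G*MN*(1 - W) \<le> (1+G)*eta + 4*M1*TT + tau"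
proof -
  have e1: "G * MN * (1 - W) = G * MN - G * W * MN" by (simp add: algebra_simps)
  have e2: "(1 + G) * (MN - eta) = MN + G * MN - (1 + G) * eta" by (simp add: algebra_simps)
  from a1 a2 a3 a4 have "(1+G)*(MN - eta) - 4*M1*TT - tau \<le> MN + G*W*MN" by linarith
  then show ?thesis unfolding e1 using e2 by linarith
qed

lemma norm_add_scaleR_self:
  fixes y :: "'b::real_normed_vector" assumes "g \<ge> 0"
  shows "norm (y + g *\<^sub>R y) = (1 + g) * norm y"
proof -
  have "y + g *\<^sub>R y = (1 + g) *\<^sub>R y" by (simp add: algebra_simps)
  then show ?thesis using assms by simp
qed

lemma unit_rotation:
  assumes sf: "scalar_field F" and wF: "w \<in> F" and w0: "w \<noteq> 0"
  shows "cnj w / complex_of_real (norm w) \<in> F" and "norm (cnj w / complex_of_real (norm w)) = 1"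
    and "(cnj w / complex_of_real (norm w)) * w = complex_of_real (norm w)"
proof -
  show "cnj w / complex_of_real (norm w) \<in> F"
    by (intro sf_divide[OF sf] sf_cnj[OF sf] sf_of_real[OF sf] wF)
  show "norm (cnj w / complex_of_real (norm w)) = 1" using w0 by (simp add: norm_divide)
  have cw: "cnj w * w = complex_of_real (norm w) * complex_of_real (norm w)"
    using complex_norm_square[of w] by (simp add: mult.commute power2_eq_square)
  have "(cnj w / complex_of_real (norm w)) * w = cnj w * w / complex_of_real (norm w)" by simp
  also have "\<dots> = complex_of_real (norm w)" unfolding cw using w0 by simp
  finally show "(cnj w / complex_of_real (norm w)) * w = complex_of_real (norm w)" .
qed

text \<open>If \<open>g\<close> strongly exposes \<open>a\<close> (values of real part \<open>\<ge> 1 - d\<close> force \<open>e\<close>-closeness to \<open>a\<close>) and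
  \<open>|g x| > 1 - d\<close>, then \<open>x\<close> is \<open>e\<close>-close to a rotation of \<open>a\<close>: rotate \<open>x\<close> so that \<open>g x\<close> becomes positive.\<close>
lemma strongly_exposed_rotation:
  fixes sX :: "complex \<Rightarrow> 'a::real_normed_vector \<Rightarrow> 'a"
  assumes sf: "scalar_field F" and nsX: "normed_space_over F sX"
    and g: "F_linear F sX (*) g" and gF: "\<And>x. g x \<in> F"
    and expose: "\<And>x. norm x \<le> 1 \<Longrightarrow> Re (g x) \<ge> 1 - d \<Longrightarrow> norm (x - a) \<le> e"
    and x: "norm x \<le> 1" and big: "norm (g x) > 1 - d" and d: "d \<le> 1"
  shows "\<exists>c\<in>F. norm c = 1 \<and> norm (x - sX c a) \<le> e"
proof -
  define w where "w = g x"
  have w0: "w \<noteq> 0" using big d by (auto simp: w_def)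
  define lam where "lam = cnj w / complex_of_real (norm w)"
  have lamF: "lam \<in> F" and lam1: "norm lam = 1" and lamw: "lam * w = complex_of_real (norm w)"
    using unit_rotation[OF sf gF w0[unfolded w_def]] by (simp_all add: lam_def w_def)
  have "g (sX lam x) = complex_of_real (norm w)"
    using g lamF lamw unfolding F_linear_def w_def by auto
  then have re: "Re (g (sX lam x)) \<ge> 1 - d" using big by (simp add: w_def)
  have nx: "norm (sX lam x) \<le> 1" using ns_norm[OF sf nsX lamF] lam1 x by simp
  have close: "norm (sX lam x - a) \<le> e" by (rule expose[OF nx re])
  have cF: "cnj lam \<in> F" by (rule sf_cnj[OF sf lamF])
  have "x - sX (cnj lam) a = sX (cnj lam) (sX lam x - a)"
    using ns_cancel[OF sf nsX lamF lam1] ns_diff_vec[OF sf nsX cF] by simp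
  then have "norm (x - sX (cnj lam) a) = norm (sX lam x - a)"
    using ns_norm[OF sf nsX cF] lam1 by simp
  then show ?thesis using close cF lam1 by (intro bexI[of _ "cnj lam"]) auto
qed


text \<open>The data of the construction: exposed points \<open>A\<close> with exposing functionals \<open>f\<close> (modulus
  of exposure \<open>\<delta>\<close>), a closed F-subspace \<open>V\<close> of values on which the points of \<open>A\<close> are norming, and the
  polynomial \<open>P1\<close> to be approximated.\<close>
locale perturbation = perturbation_sizes g0 for g0 :: real +
  fixes F :: "complex set" and sX :: "complex \<Rightarrow> 'a::banach \<Rightarrow> 'a" and sY :: "complex \<Rightarrow> 'b::banach \<Rightarrow> 'b"
    and k :: nat and A :: "'a set" and f :: "'a \<Rightarrow> 'a \<Rightarrow> complex" and \<delta> :: "real \<Rightarrow> real"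
    and V :: "'b set" and P1 :: "'a \<Rightarrow> 'b"
  assumes sf: "scalar_field F" and nsX: "normed_space_over F sX" and nsY: "normed_space_over F sY"
    and k1: "k \<ge> 1" and A_ne: "A \<noteq> {}" and A_sph: "A \<subseteq> sphere 0 1"
    and f_linear: "\<And>a. a \<in> A \<Longrightarrow> F_linear F sX (*) (f a)"
    and f_in_F: "\<And>a x. a \<in> A \<Longrightarrow> f a x \<in> F"
    and f_bound: "\<And>a x. a \<in> A \<Longrightarrow> norm (f a x) \<le> norm x"
    and f_at: "\<And>a. a \<in> A \<Longrightarrow> f a a = 1"
    and f_exposes: "\<And>a e x. a \<in> A \<Longrightarrow> e > 0 \<Longrightarrow> norm x \<le> 1 \<Longrightarrow> Re (f a x) \<ge> 1 - \<delta> e \<Longrightarrow> norm (x - a) \<le> e"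
    and \<delta>_pos: "\<And>e. e > 0 \<Longrightarrow> \<delta> e > 0"
    and V_closed: "closed V" and V_add: "\<And>u v. u \<in> V \<Longrightarrow> v \<in> V \<Longrightarrow> u + v \<in> V"
    and V_scale: "\<And>c v. c \<in> F \<Longrightarrow> v \<in> V \<Longrightarrow> sY c v \<in> V" and V_0: "0 \<in> V"
    and norming: "\<And>Q. Q \<in> hpoly F sX sY k \<Longrightarrow> (\<forall>x. Q x \<in> V) \<Longrightarrow> pnorm Q \<le> (SUP a\<in>A. norm (Q a))"
    and P1: "P1 \<in> hpoly F sX sY k" and P1_V: "\<And>x. P1 x \<in> V" and P1_nonzero: "pnorm P1 > 0"
    and g0_le: "g0 \<le> 1/4"
begin

definition M1 :: real where "M1 = pnorm P1"

text \<open>The tolerance for choosing near-maximal points at stage \<open>n\<close>.\<close>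
definition eta :: "nat \<Rightarrow> real" where "eta n = (gam n)\<^sup>2 * M1"

definition choose_near_max :: "('a \<Rightarrow> 'b) \<Rightarrow> nat \<Rightarrow> 'a" where
  "choose_near_max Q n = (SOME a. a \<in> A \<and> pnorm Q - eta n < norm (Q a))"

definition bump :: "nat \<Rightarrow> 'a \<Rightarrow> 'b \<Rightarrow> 'a \<Rightarrow> 'b" where
  "bump n a y x = sY (complex_of_real (gam n) * f a x ^ k) y"

definition PP :: "nat \<Rightarrow> 'a \<Rightarrow> 'b" where
  "PP = rec_nat P1 (\<lambda>n Q x. Q x + bump n (choose_near_max Q n) (Q (choose_near_max Q n)) x)"

definition aa :: "nat \<Rightarrow> 'a" where "aa n = choose_near_max (PP n) n"
definition yy :: "nat \<Rightarrow> 'b" where "yy n = PP n (aa n)"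
definition Mn :: "nat \<Rightarrow> real" where "Mn n = pnorm (PP n)"

definition Pinf :: "'a \<Rightarrow> 'b" where "Pinf x = P1 x + (\<Sum>j. bump j (aa j) (yy j) x)"
definition Minf :: real where "Minf = pnorm Pinf"

lemma M1_pos: "M1 > 0"
  using P1_nonzero by (simp add: M1_def)

lemma eta_pos: "eta n > 0"
  unfolding eta_def using gam_pos[of n] M1_pos by simp

lemma gam_le_quarter: "gam n \<le> 1/4"
  using gam_le[of n] g0_le by linarith

lemma partial_sum_le_half: "(\<Sum>j<n. gam j) \<le> 1/2"
  using partial_sum_le_tail_0[of n] tail_0_le g0_le by linarith

lemma A_norm: "a \<in> A \<Longrightarrow> norm a \<le> 1"
  using A_sph by auto

lemma hpoly_bounded: "Q \<in> hpoly F sX sY k \<Longrightarrow> pbounded Q"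
  by (rule hpoly_pbounded[OF sf nsX nsY])

text \<open>Since \<open>A\<close> is norming for polynomials with values in \<open>V\<close>, near-maximal points exist in \<open>A\<close>.\<close>
lemma choose_near_max:
  assumes Q: "Q \<in> hpoly F sX sY k" "\<forall>x. Q x \<in> V"
  shows "choose_near_max Q n \<in> A \<and> pnorm Q - eta n < norm (Q (choose_near_max Q n))"
proof -
  have bdd: "bdd_above ((\<lambda>a. norm (Q a)) ` A)"
    unfolding bdd_above_def using pnorm_ge[OF hpoly_bounded[OF Q(1)] A_norm] by blast
  have "pnorm Q - eta n < (SUP a\<in>A. norm (Q a))" using norming[OF Q] eta_pos[of n] by linarith
  then have "\<exists>a. a \<in> A \<and> pnorm Q - eta n < norm (Q a)" using less_cSUP_iff[OF A_ne bdd] by blast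
  then show ?thesis unfolding choose_near_max_def by (rule someI_ex)
qed

lemma bump_in_F: "a \<in> A \<Longrightarrow> complex_of_real (gam n) * f a x ^ k \<in> F"
  by (intro sf_mult[OF sf] sf_of_real[OF sf] sf_power[OF sf] f_in_F)

lemma bump_hpoly: "a \<in> A \<Longrightarrow> bump n a y \<in> hpoly F sX sY k"
  unfolding bump_def[abs_def]
  by (rule hpoly_rank_one[OF sf nsX nsY f_linear f_in_F f_bound sf_of_real[OF sf]])

lemma bump_norm: "a \<in> A \<Longrightarrow> norm (bump n a y x) = gam n * norm (f a x) ^ k * norm y"
  using ns_norm[OF sf nsY bump_in_F, of a n x y] gam_pos[of n]
  by (simp add: bump_def norm_mult norm_power)

lemma bump_V: "a \<in> A \<Longrightarrow> y \<in> V \<Longrightarrow> bump n a y x \<in> V"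
  unfolding bump_def by (intro V_scale bump_in_F)

lemma bump_at: "a \<in> A \<Longrightarrow> bump n a y a = gam n *\<^sub>R y"
  by (simp add: bump_def f_at ns_of_real[OF sf nsY])

lemma bump_le: "a \<in> A \<Longrightarrow> norm x \<le> 1 \<Longrightarrow> norm (bump n a y x) \<le> gam n * norm y"
proof -
  assume a: "a \<in> A" and x: "norm x \<le> 1"
  have "norm (f a x) ^ k \<le> 1" using f_bound[OF a, of x] x by (intro power_le_one) auto
  then have "gam n * norm (f a x) ^ k * norm y \<le> gam n * 1 * norm y"
    using gam_pos[of n] by (intro mult_right_mono mult_left_mono) auto
  then show ?thesis using bump_norm[OF a] by simp
qed

lemma PP_0: "PP 0 = P1"
  by (simp add: PP_def)

lemma PP_Suc: "PP (Suc n) x = PP n x + bump n (aa n) (yy n) x"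
  by (simp add: PP_def aa_def yy_def)


lemma step_choice:
  assumes "PP n \<in> hpoly F sX sY k" "\<forall>x. PP n x \<in> V"
  shows "aa n \<in> A" and "Mn n - eta n < norm (yy n)" and "norm (yy n) \<le> Mn n" and "yy n \<in> V"
proof -
  show a: "aa n \<in> A" and "Mn n - eta n < norm (yy n)"
    using choose_near_max[OF assms, of n] unfolding aa_def yy_def Mn_def by blast+
  show "norm (yy n) \<le> Mn n"
    unfolding yy_def Mn_def by (rule pnorm_ge[OF hpoly_bounded[OF assms(1)] A_norm[OF a]])
  show "yy n \<in> V" using assms(2) by (simp add: yy_def)
qed

lemma step_at_aa:
  assumes "aa n \<in> A"
  shows "norm (PP (Suc n) (aa n)) = (1 + gam n) * norm (yy n)"
proof -
  have "PP (Suc n) (aa n) = yy n + gam n *\<^sub>R yy n"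
    by (simp add: PP_Suc bump_at[OF assms] yy_def)
  then show ?thesis using gam_pos[of n] norm_add_scaleR_self[of "gam n" "yy n"] by simp
qed

lemma step_bound:
  assumes "PP n \<in> hpoly F sX sY k" "aa n \<in> A" "norm (yy n) \<le> Mn n" and x: "norm x \<le> 1"
  shows "norm (PP (Suc n) x) \<le> Mn n + gam n * norm (f (aa n) x) ^ k * Mn n"
proof -
  have "norm (PP (Suc n) x) \<le> norm (PP n x) + norm (bump n (aa n) (yy n) x)"
    unfolding PP_Suc by (rule norm_triangle_ineq)
  also have "norm (PP n x) \<le> Mn n" unfolding Mn_def by (rule pnorm_ge[OF hpoly_bounded[OF assms(1)] x])
  also have "norm (bump n (aa n) (yy n) x) \<le> gam n * norm (f (aa n) x) ^ k * Mn n"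
    unfolding bump_norm[OF assms(2)] using gam_pos[of n] assms(3) by (intro mult_left_mono) auto
  finally show ?thesis by simp
qed

lemma PP_invariant:
  "PP n \<in> hpoly F sX sY k \<and> (\<forall>x. PP n x \<in> V) \<and> M1 \<le> Mn n \<and> Mn n \<le> M1 * (1 + 2 * (\<Sum>j<n. gam j))"
proof (induction n)
  case 0
  then show ?case using P1 P1_V by (simp add: PP_0 Mn_def M1_def)
next
  case (Suc n)
  then have Q: "PP n \<in> hpoly F sX sY k" and QV: "\<forall>x. PP n x \<in> V" and Ml: "M1 \<le> Mn n"
    and Mu: "Mn n \<le> M1 * (1 + 2 * (\<Sum>j<n. gam j))" by blast+
  note ch = step_choice[OF Q QV]
  have h: "PP (Suc n) \<in> hpoly F sX sY k"
    unfolding PP_Suc[abs_def] by (rule hpoly_add[OF sf nsX nsY Q bump_hpoly[OF ch(1)]])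
  have V: "\<forall>x. PP (Suc n) x \<in> V" unfolding PP_Suc using QV bump_V[OF ch(1,4)] V_add by blast
  have up: "Mn (Suc n) \<le> Mn n * (1 + gam n)"
    unfolding Mn_def[of "Suc n"]
  proof (rule pnorm_le)
    fix x :: 'a assume x: "norm x \<le> 1"
    have "norm (f (aa n) x) ^ k \<le> 1" using f_bound[OF ch(1), of x] x by (intro power_le_one) auto
    then have "gam n * norm (f (aa n) x) ^ k * Mn n \<le> gam n * 1 * Mn n"
      using gam_pos[of n] Ml M1_pos by (intro mult_left_mono mult_right_mono) auto
    then show "norm (PP (Suc n) x) \<le> Mn n * (1 + gam n)"
      using step_bound[OF Q ch(1,3) x] by (simp add: algebra_simps)
  qed
  have low: "Mn n \<le> Mn (Suc n)"
  proof -
    have "Mn n \<le> (1 + gam n) * (Mn n - eta n)"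
      unfolding eta_def by (rule bump_norm_gain) (use gam_pos[of n] gam_le_quarter[of n] Ml M1_pos in auto)
    also have "\<dots> \<le> (1 + gam n) * norm (yy n)"
      using ch(2) gam_pos[of n] by (intro mult_left_mono) auto
    also have "\<dots> = norm (PP (Suc n) (aa n))" by (rule step_at_aa[OF ch(1), symmetric])
    also have "\<dots> \<le> Mn (Suc n)" unfolding Mn_def by (rule pnorm_ge[OF hpoly_bounded[OF h] A_norm[OF ch(1)]])
    finally show ?thesis .
  qed
  have "Mn n * (1 + gam n) \<le> M1 * (1 + 2 * ((\<Sum>j<n. gam j) + gam n))"
    by (rule bump_norm_growth)
       (use gam_pos[of n] partial_sum_le_half[of n] gam_pos Mu M1_pos in \<open>auto simp: sum_nonneg less_imp_le\<close>)
  then have "Mn (Suc n) \<le> M1 * (1 + 2 * (\<Sum>j<Suc n. gam j))" using up by simp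
  then show ?case using h V Ml low by auto
qed

lemma PP_hpoly: "PP n \<in> hpoly F sX sY k"
  using PP_invariant by blast

lemma PP_V: "PP n x \<in> V"
  using PP_invariant by blast

lemma Mn_lower: "M1 \<le> Mn n"
  using PP_invariant by blast

lemma Mn_upper: "Mn n \<le> 2 * M1"
proof -
  have "Mn n \<le> M1 * (1 + 2 * (\<Sum>j<n. gam j))" using PP_invariant by blast
  also have "\<dots> \<le> M1 * 2" using partial_sum_le_half[of n] M1_pos by (intro mult_left_mono) auto
  finally show ?thesis by simp
qed

lemmas aa_in_A = step_choice(1)[OF PP_hpoly PP_V[THEN allI]]
lemmas yy_near_max = step_choice(2)[OF PP_hpoly PP_V[THEN allI]]
lemmas yy_le = step_choice(3)[OF PP_hpoly PP_V[THEN allI]]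
lemmas yy_V = step_choice(4)[OF PP_hpoly PP_V[THEN allI]]


lemma bump_series_bound: "norm (bump j (aa j) (yy j) x) \<le> (gam j * (2 * M1)) * norm x ^ k"
proof -
  have "norm (bump j (aa j) (yy j) x) = gam j * norm (f (aa j) x) ^ k * norm (yy j)"
    by (rule bump_norm[OF aa_in_A])
  also have "\<dots> \<le> gam j * norm x ^ k * (2 * M1)"
    using gam_pos[of j] yy_le[of j] Mn_upper[of j] f_bound[OF aa_in_A, of j x]
    by (intro mult_mono mult_left_mono power_mono) auto
  finally show ?thesis by (simp add: ac_simps)
qed

lemma summable_bumps: "summable (\<lambda>j. bump j (aa j) (yy j) x)"
  by (rule summable_comparison_test'[OF summable_mult2[OF summable_mult2[OF summable_gam]], of 0])
     (rule bump_series_bound)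

lemma PP_partial_sum: "PP n x = P1 x + (\<Sum>j<n. bump j (aa j) (yy j) x)"
  by (induction n) (simp_all add: PP_0 PP_Suc)

text \<open>The limit is a polynomial: the bumps come from multilinear maps with summable bounds.\<close>
lemma Pinf_hpoly: "Pinf \<in> hpoly F sX sY k"
proof -
  obtain L1 where L1: "F_multilinear F sX sY k L1" "P1 = (\<lambda>x. L1 (\<lambda>_. x))"
    using P1 by (rule hpolyE[OF sf nsX nsY])
  define Lt where "Lt j xs = sY (complex_of_real (gam j) * (\<Prod>i<k. f (aa j) (xs i))) (yy j)" for j xs
  note rank_one = ml_rank_one[OF sf nsX nsY f_linear[OF aa_in_A] f_in_F[OF aa_in_A] f_bound[OF aa_in_A]
      sf_of_real[OF sf]]
  have Ltb: "norm (Lt j xs) \<le> (gam j * (2 * M1)) * (\<Prod>i<k. norm (xs i))" for j xs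
  proof -
    have "norm (Lt j xs) \<le> (norm (complex_of_real (gam j)) * norm (yy j)) * (\<Prod>i<k. norm (xs i))"
      unfolding Lt_def by (rule rank_one(2))
    also have "\<dots> \<le> (gam j * (2 * M1)) * (\<Prod>i<k. norm (xs i))"
      using gam_pos[of j] yy_le[of j] Mn_upper[of j] by (intro mult_right_mono mult_left_mono prod_nonneg) auto
    finally show ?thesis .
  qed
  have Ltm: "F_multilinear F sX sY k (Lt j)" for j
    unfolding Lt_def by (rule rank_one(1))
  have Ls: "F_multilinear F sX sY k (\<lambda>xs. \<Sum>j. Lt j xs)"
    by (rule ml_series(1)[OF sf nsX nsY Ltm Ltb summable_mult2[OF summable_gam]])
  show ?thesis
  proof (rule hpolyI[OF sf nsX nsY ml_add_fun[OF sf nsX nsY L1(1) Ls]])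
    fix x
    have "Lt j (\<lambda>_. x) = bump j (aa j) (yy j) x" for j by (simp add: Lt_def bump_def)
    moreover have "P1 x = L1 (\<lambda>_. x)" using L1(2) by simp
    ultimately show "Pinf x = L1 (\<lambda>_. x) + (\<Sum>j. Lt j (\<lambda>_. x))" unfolding Pinf_def by simp
  qed
qed

lemma Pinf_bounded: "pbounded Pinf"
  by (rule hpoly_bounded[OF Pinf_hpoly])

lemma Pinf_V: "Pinf x \<in> V"
proof -
  have "(\<lambda>n. \<Sum>j<n. bump j (aa j) (yy j) x) \<longlonglongrightarrow> (\<Sum>j. bump j (aa j) (yy j) x)"
    by (rule summable_LIMSEQ[OF summable_bumps])
  moreover have "(\<Sum>j<n. bump j (aa j) (yy j) x) \<in> V" for n
    by (induction n) (simp_all add: V_0 V_add bump_V[OF aa_in_A yy_V])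
  ultimately have "(\<Sum>j. bump j (aa j) (yy j) x) \<in> V"
    by (intro Lim_in_closed_set[OF V_closed, of "\<lambda>n. \<Sum>j<n. bump j (aa j) (yy j) x" sequentially]) auto
  then show ?thesis unfolding Pinf_def by (intro V_add P1_V)
qed

lemma Pinf_tail:
  assumes x: "norm x \<le> 1"
  shows "norm (Pinf x - PP n x) \<le> 2 * M1 * tail n"
proof -
  have "Pinf x - PP n x = (\<Sum>j. bump j (aa j) (yy j) x) - (\<Sum>j<n. bump j (aa j) (yy j) x)"
    by (simp add: Pinf_def PP_partial_sum)
  also have "\<dots> = (\<Sum>j. bump (j + n) (aa (j + n)) (yy (j + n)) x)"
    by (rule suminf_minus_initial_segment[OF summable_bumps, symmetric])
  finally have e: "Pinf x - PP n x = (\<Sum>j. bump (j + n) (aa (j + n)) (yy (j + n)) x)" .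
  have s2: "summable (\<lambda>j. gam (j + n) * (2 * M1))"
    by (rule summable_mult2[OF summable_gam_shift])
  have bnd: "norm (bump (j + n) (aa (j + n)) (yy (j + n)) x) \<le> gam (j + n) * (2 * M1)" for j
  proof -
    have "norm (bump (j + n) (aa (j + n)) (yy (j + n)) x) \<le> gam (j + n) * norm (yy (j + n))"
      by (rule bump_le[OF aa_in_A x])
    also have "\<dots> \<le> gam (j + n) * (2 * M1)"
      using yy_le[of "j + n"] Mn_upper[of "j + n"] gam_pos[of "j + n"] by (intro mult_left_mono) auto
    finally show ?thesis .
  qed
  have "norm (\<Sum>j. bump (j + n) (aa (j + n)) (yy (j + n)) x) \<le> (\<Sum>j. gam (j + n) * (2 * M1))"
    by (rule norm_suminf_le[OF bnd s2])
  also have "\<dots> = tail n * (2 * M1)" unfolding tail_def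
    by (rule suminf_mult2[OF summable_gam_shift, symmetric])
  finally show ?thesis using e by (simp add: ac_simps)
qed

lemma Pinf_close_to_P1: "pnorm (\<lambda>x. Pinf x - P1 x) \<le> 4 * g0 * pnorm P1"
proof (rule pnorm_le)
  fix x :: 'a assume x: "norm x \<le> 1"
  have "norm (Pinf x - P1 x) \<le> 2 * M1 * tail 0" using Pinf_tail[OF x, of 0] by (simp add: PP_0)
  also have "\<dots> \<le> 2 * M1 * (2 * g0)" using tail_0_le M1_pos by (intro mult_left_mono) auto
  finally show "norm (Pinf x - P1 x) \<le> 4 * g0 * pnorm P1" by (simp add: M1_def ac_simps)
qed


lemma Minf_upper: "Minf \<le> (1 + gam n) * Mn n + 2 * M1 * tail (Suc n)"
  unfolding Minf_def
proof (rule pnorm_le)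
  fix x :: 'a assume x: "norm x \<le> 1"
  have "norm (f (aa n) x) ^ k \<le> 1" using f_bound[OF aa_in_A, of n x] x by (intro power_le_one) auto
  then have "gam n * norm (f (aa n) x) ^ k * Mn n \<le> gam n * 1 * Mn n"
    using gam_pos[of n] Mn_lower[of n] M1_pos by (intro mult_right_mono mult_left_mono) auto
  moreover have "norm (PP (Suc n) x) \<le> Mn n + gam n * norm (f (aa n) x) ^ k * Mn n"
    by (rule step_bound[OF PP_hpoly aa_in_A yy_le x])
  moreover have "(1 + gam n) * Mn n = Mn n + gam n * 1 * Mn n" by (simp add: algebra_simps)
  ultimately have "norm (PP (Suc n) x) \<le> (1 + gam n) * Mn n" by linarith
  moreover have "norm (Pinf x) \<le> norm (PP (Suc n) x) + norm (Pinf x - PP (Suc n) x)"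
    by (rule norm_triangle_sub)
  ultimately show "norm (Pinf x) \<le> (1 + gam n) * Mn n + 2 * M1 * tail (Suc n)"
    using Pinf_tail[OF x, of "Suc n"] by linarith
qed

lemma Pinf_at_aa: "norm (Pinf (aa n)) \<ge> (1 + gam n) * (Mn n - eta n) - 2 * M1 * tail (Suc n)"
proof -
  have "norm (PP (Suc n) (aa n)) \<le> norm (Pinf (aa n)) + norm (Pinf (aa n) - PP (Suc n) (aa n))"
    using norm_triangle_sub[of "PP (Suc n) (aa n)" "Pinf (aa n)"] by (simp add: norm_minus_commute)
  moreover have "norm (Pinf (aa n) - PP (Suc n) (aa n)) \<le> 2 * M1 * tail (Suc n)"
    by (rule Pinf_tail[OF A_norm[OF aa_in_A]])
  moreover have "(1 + gam n) * (Mn n - eta n) \<le> (1 + gam n) * norm (yy n)"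
    using yy_near_max[of n] gam_pos[of n] by (intro mult_left_mono) auto
  ultimately show ?thesis using step_at_aa[OF aa_in_A, of n] by linarith
qed

lemma Minf_pos: "Minf > 0"
proof -
  have "Mn 0 \<le> (1 + gam 0) * (Mn 0 - eta 0)"
    unfolding eta_def by (rule bump_norm_gain) (use gam_pos[of 0] gam_le_quarter[of 0] Mn_lower[of 0] M1_pos in auto)
  moreover have "norm (Pinf (aa 0)) \<le> Minf"
    unfolding Minf_def by (rule pnorm_ge[OF Pinf_bounded A_norm[OF aa_in_A]])
  moreover have "2 * M1 * tail (Suc 0) \<le> 2 * M1 * (1/4)"
    using tail_Suc_le[of 0] gam_le_quarter[of 0] M1_pos by (intro mult_left_mono) auto
  ultimately show ?thesis using Pinf_at_aa[of 0] Mn_lower[of 0] M1_pos by linarith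
qed

text \<open>From stage \<open>N\<close> on, the errors \<open>2 \<gamma>(N)^2 M1\<close> (from choosing near-maximal points) and
  \<open>4 M1 tail(N+1)\<close> (from later bumps) are negligible against the \<open>N\<close>-th bump \<open>\<gamma>(N) M1 \<theta>\<close>.\<close>
lemma defect_small:
  assumes \<theta>: "\<theta> > 0" and N: "(1/2::real) ^ N < \<theta> / 10"
  shows "2 * ((gam N)\<^sup>2 * M1) + 4 * M1 * tail (Suc N) < gam N * M1 * \<theta> / 2"
proof -
  have "g0 * (1/2::real) ^ N \<le> (1/4) * (1/2) ^ N" using g0_le by (intro mult_right_mono) auto
  then have "2 * gam N + 4 * (1/2) ^ N < \<theta> / 2" using gam_le_geometric[of N] N \<theta> by linarith
  then have "gam N * M1 * (2 * gam N + 4 * (1/2) ^ N) < gam N * M1 * (\<theta> / 2)"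
    using gam_pos[of N] M1_pos by (intro mult_strict_left_mono) auto
  moreover have "4 * M1 * tail (Suc N) \<le> 4 * M1 * (gam N * (1/2) ^ N)"
    using tail_Suc_le[of N] M1_pos by (intro mult_left_mono) auto
  moreover have "gam N * M1 * (2 * gam N + 4 * (1/2) ^ N) = 2 * ((gam N)\<^sup>2 * M1) + 4 * M1 * (gam N * (1/2) ^ N)"
    by (simp add: algebra_simps power2_eq_square)
  ultimately show ?thesis by simp
qed

lemma near_max_exposed:
  assumes \<theta>: "\<theta> > 0" and N: "(1/2::real) ^ N < \<theta> / 10"
    and x: "norm x \<le> 1" and big: "norm (Pinf x) \<ge> Minf - gam N * M1 * \<theta> / 2"
  shows "norm (f (aa N) x) > 1 - \<theta>"
proof -
  define G where "G = gam N"
  define W where "W = norm (f (aa N) x) ^ k"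
  have W1: "norm (f (aa N) x) \<le> 1" using f_bound[OF aa_in_A, of N x] x by simp
  have h1: "norm (PP (Suc N) x) \<ge> norm (Pinf x) - 2 * M1 * tail (Suc N)"
    using Pinf_tail[OF x, of "Suc N"] norm_triangle_sub[of "Pinf x" "PP (Suc N) x"] by linarith
  have h2: "Minf \<ge> (1 + G) * (Mn N - eta N) - 2 * M1 * tail (Suc N)"
    using Pinf_at_aa[of N] pnorm_ge[OF Pinf_bounded A_norm[OF aa_in_A[of N]]] unfolding Minf_def G_def
    by linarith
  have h3: "norm (PP (Suc N) x) \<le> Mn N + G * W * Mn N"
    using step_bound[OF PP_hpoly aa_in_A yy_le x] by (simp add: G_def W_def)
  have h4: "(1 + G) * eta N \<le> 2 * (G\<^sup>2 * M1)"
  proof -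
    have "(1 + G) * eta N \<le> 2 * eta N"
      using gam_le_quarter[of N] eta_pos[of N] unfolding G_def by (intro mult_right_mono) auto
    then show ?thesis by (simp add: eta_def G_def)
  qed
  have "G * Mn N * (1 - W) \<le> (1 + G) * eta N + 4 * M1 * tail (Suc N) + G * M1 * \<theta> / 2"
    by (rule near_max_defect[OF h1 h2 h3]) (use big G_def in simp)
  also have "\<dots> < G * M1 * \<theta>" using h4 defect_small[OF \<theta> N] by (simp add: G_def)
  also have "\<dots> \<le> G * Mn N * \<theta>"
    using gam_pos[of N] Mn_lower[of N] \<theta> unfolding G_def by (intro mult_right_mono mult_left_mono) auto
  finally have "G * Mn N * (1 - W) < G * Mn N * \<theta>" .
  moreover have "G * Mn N > 0" using gam_pos[of N] Mn_lower[of N] M1_pos by (simp add: G_def)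
  ultimately have "1 - W < \<theta>" by (simp add: mult_less_cancel_left_pos)
  moreover have "W \<le> norm (f (aa N) x) ^ 1" unfolding W_def using W1 k1 by (intro power_decreasing) auto
  ultimately show ?thesis by simp
qed

lemma later_points_near_max:
  assumes \<theta>: "\<theta> > 0" and N: "(1/2::real) ^ N < \<theta> / 10" and m: "m \<ge> N"
  shows "norm (Pinf (aa m)) \<ge> Minf - gam N * M1 * \<theta> / 2"
proof -
  have "gam m ^ 2 \<le> gam N ^ 2" using gam_antimono[OF m] gam_pos[of m] by (intro power_mono) auto
  then have "eta m \<le> (gam N)\<^sup>2 * M1" unfolding eta_def using M1_pos by (intro mult_right_mono) auto
  moreover have "(1 + gam m) * eta m \<le> 2 * eta m"
    using gam_le_quarter[of m] eta_pos[of m] by (intro mult_right_mono) auto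
  moreover have "4 * M1 * tail (Suc m) \<le> 4 * M1 * tail (Suc N)"
    using tail_antimono[of "Suc N" "Suc m"] m M1_pos by (intro mult_left_mono) auto
  moreover have "(1 + gam m) * (Mn m - eta m) = (1 + gam m) * Mn m - (1 + gam m) * eta m"
    by (simp add: algebra_simps)
  ultimately show ?thesis
    using Pinf_at_aa[of m] Minf_upper[of m] defect_small[OF \<theta> N] by linarith
qed

text \<open>The hypothesis of the strong attainment criterion, for the limit polynomial.\<close>
lemma key_estimate:
  assumes e: "e > 0"
  shows "\<exists>N \<tau>. \<tau> > 0 \<and>
        (\<forall>x. norm x \<le> 1 \<longrightarrow> norm (Pinf x) \<ge> Minf - \<tau> \<longrightarrow> (\<exists>c\<in>F. norm c = 1 \<and> norm (x - sX c (aa N)) \<le> e)) \<and>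
        (\<forall>m\<ge>N. norm (Pinf (aa m)) \<ge> Minf - \<tau>)"
proof -
  define \<theta> where "\<theta> = min (\<delta> e) (1/2)"
  have \<theta>: "\<theta> > 0" "\<theta> \<le> \<delta> e" "\<theta> \<le> 1/2" using \<delta>_pos[OF e] by (auto simp: \<theta>_def)
  obtain N where N: "(1/2::real) ^ N < \<theta> / 10" using half_pow_small[of "\<theta>/10"] \<theta> by auto
  have expose: "norm (x - aa N) \<le> e" if "norm x \<le> 1" "Re (f (aa N) x) \<ge> 1 - \<theta>" for x
    using f_exposes[OF aa_in_A e that(1)] that(2) \<theta>(2) by simp
  show ?thesis
  proof (intro exI[of _ N] exI[of _ "gam N * M1 * \<theta> / 2"] conjI allI impI)
    show "gam N * M1 * \<theta> / 2 > 0" using gam_pos[of N] M1_pos \<theta> by simp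
  next
    fix x :: 'a assume x: "norm x \<le> 1" and "Minf - gam N * M1 * \<theta> / 2 \<le> norm (Pinf x)"
    then have "norm (f (aa N) x) > 1 - \<theta>" using near_max_exposed[OF \<theta>(1) N] by blast
    then show "\<exists>c\<in>F. norm c = 1 \<and> norm (x - sX c (aa N)) \<le> e"
      using strongly_exposed_rotation[OF sf nsX f_linear[OF aa_in_A] f_in_F[OF aa_in_A] expose x] \<theta>(3)
      by simp
  next
    fix m assume "N \<le> m"
    then show "Minf - gam N * M1 * \<theta> / 2 \<le> norm (Pinf (aa m))" by (rule later_points_near_max[OF \<theta>(1) N])
  qed
qed

theorem Pinf_strongly_norm_attaining: "strongly_norm_attaining F sX Pinf"
proof -
  obtain x0 where x0: "norm x0 \<le> 1" and x0max: "\<forall>xn. (\<forall>n. norm (xn n) \<le> 1) \<longrightarrow>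
      (\<lambda>n. norm (Pinf (xn n))) \<longlonglongrightarrow> Minf \<longrightarrow>
      (\<exists>c\<in>F. norm c = 1 \<and> (\<exists>r. strict_mono r \<and> (\<lambda>n. xn (r n)) \<longlonglongrightarrow> sX c x0))"
    using strong_attainment_criterion[OF sf nsX A_norm[OF aa_in_A] key_estimate] by blast
  have "Pinf \<noteq> (\<lambda>_. 0)" using Minf_pos by (auto simp: Minf_def pnorm_zero_fun)
  then have "strongly_attains_at F sX Pinf x0"
    unfolding strongly_attains_at_def using x0 x0max by (simp add: Minf_def)
  then show ?thesis unfolding strongly_norm_attaining_def by blast
qed

end



section \<open>Density of strongly norm attaining polynomials\<close>

lemma unit_functional_le_norm:
  fixes g :: "'a::real_normed_vector \<Rightarrow> complex"
  assumes bl: "bounded_linear g" and g1: "pnorm g = 1"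
  shows "norm (g x) \<le> norm x"
proof -
  obtain K where K: "\<And>x. norm (g x) \<le> norm x * K" using bounded_linear.bounded[OF bl] by blast
  have gb: "pbounded g"
  proof (rule pboundedI[where B="\<bar>K\<bar>"])
    fix x :: 'a assume x: "norm x \<le> 1"
    have "norm x * K \<le> norm x * \<bar>K\<bar>" by (intro mult_left_mono) auto
    also have "\<dots> \<le> 1 * \<bar>K\<bar>" using x by (intro mult_right_mono) auto
    finally show "norm (g x) \<le> \<bar>K\<bar>" using K[of x] by simp
  qed
  have lin: "linear g" using bl by (rule bounded_linear.linear)
  show ?thesis
  proof (cases "x = 0")
    case True
    then show ?thesis using linear_0[OF lin] by simp
  next
    case False
    define u where "u = (1 / norm x) *\<^sub>R x"
    have u: "norm u \<le> 1" using False by (simp add: u_def)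
    have "x = norm x *\<^sub>R u" using False by (simp add: u_def)
    then have "g x = norm x *\<^sub>R g u" using linear_scale[OF lin, of "norm x" u] by metis
    then have "norm (g x) = norm x * norm (g u)" by simp
    also have "\<dots> \<le> norm x * 1" using pnorm_ge[OF gb u] g1 by (intro mult_left_mono) auto
    finally show ?thesis by simp
  qed
qed

lemma unif_strongly_exposed_functionals:
  assumes "unif_strongly_exposed F sX A"
  shows "\<exists>\<delta> f. A \<subseteq> sphere 0 1 \<and> (\<forall>e>0. \<delta> e > 0) \<and>
     (\<forall>a\<in>A. F_linear F sX (*) (f a) \<and> (\<forall>x. f a x \<in> F) \<and> (\<forall>x. norm (f a x) \<le> norm x) \<and> f a a = 1 \<and>
        (\<forall>e>0. \<forall>x. norm x \<le> 1 \<longrightarrow> Re (f a x) \<ge> 1 - \<delta> e \<longrightarrow> norm (x - a) \<le> e))"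
proof -
  obtain \<delta> f where A: "A \<subseteq> sphere 0 1" and dp: "\<forall>e>0. \<delta> e > 0"
    and fa: "\<forall>a\<in>A. F_linear F sX (*) (f a) \<and> bounded_linear (f a) \<and> (\<forall>x. f a x \<in> F) \<and>
          pnorm (f a) = 1 \<and> f a a = 1 \<and>
          (\<forall>e>0. \<forall>x. norm x \<le> 1 \<longrightarrow> Re (f a x) \<ge> 1 - \<delta> e \<longrightarrow> norm (x - a) \<le> e)"
    using assms unfolding unif_strongly_exposed_def by metis
  have "\<forall>a\<in>A. \<forall>x. norm (f a x) \<le> norm x" using fa unit_functional_le_norm by blast
  then show ?thesis using A dp fa by blast
qed

lemma rank_one_pnorm:
  fixes sX :: "complex \<Rightarrow> 'a::real_normed_vector \<Rightarrow> 'a" and t :: "complex \<Rightarrow> 'b::banach \<Rightarrow> 'b"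
  assumes sf: "scalar_field F" and nsX: "normed_space_over F sX" and nsY: "normed_space_over F t"
    and g: "F_linear F sX (*) g" and gF: "\<And>x. g x \<in> F" and gb: "\<And>x. norm (g x) \<le> norm x"
    and ga: "g a = 1" and a: "norm a \<le> 1"
  shows "(\<lambda>x. t (g x ^ k) y) \<in> hpoly F sX t k" and "pnorm (\<lambda>x. t (g x ^ k) y) = norm y"
proof -
  show "(\<lambda>x. t (g x ^ k) y) \<in> hpoly F sX t k"
    using hpoly_rank_one[OF sf nsX nsY g gF gb sf_of_real[OF sf], of 1 k y] by simp
  have n: "norm (t (g x ^ k) y) = norm (g x) ^ k * norm y" for x
    using ns_norm[OF sf nsY sf_power[OF sf gF]] by (simp add: norm_power)
  have le: "norm (t (g x ^ k) y) \<le> norm y" if "norm x \<le> 1" for x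
  proof -
    have "norm (g x) ^ k \<le> 1" using gb[of x] that by (intro power_le_one) auto
    then show ?thesis unfolding n by (simp add: mult_left_le_one_le)
  qed
  have pb: "pbounded (\<lambda>x. t (g x ^ k) y)" by (rule pboundedI[where B="norm y"]) (rule le)
  have "norm y \<le> pnorm (\<lambda>x. t (g x ^ k) y)"
    using pnorm_ge[OF pb a] n[of a] ga by simp
  moreover have "pnorm (\<lambda>x. t (g x ^ k) y) \<le> norm y" by (rule pnorm_le) (rule le)
  ultimately show "pnorm (\<lambda>x. t (g x ^ k) y) = norm y" by simp
qed

text \<open>A nonzero polynomial is perturbed by the construction
  with \<open>g0\<close> small; the zero polynomial is first replaced by a small rank-one polynomial.\<close>
lemma sna_dense_in_subspace:
  fixes F :: "complex set" and sX :: "complex \<Rightarrow> 'a::banach \<Rightarrow> 'a" and sY :: "complex \<Rightarrow> 'b::banach \<Rightarrow> 'b"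
    and k :: nat and A :: "'a set" and V :: "'b set"
  assumes sf: "scalar_field F" and nsX: "normed_space_over F sX" and nsY: "normed_space_over F sY"
    and k1: "k \<ge> 1" and A_ne: "A \<noteq> {}" and usx: "unif_strongly_exposed F sX A"
    and Vcl: "closed V" and Vadd: "\<And>u v. u \<in> V \<Longrightarrow> v \<in> V \<Longrightarrow> u + v \<in> V"
    and Vsc: "\<And>c v. c \<in> F \<Longrightarrow> v \<in> V \<Longrightarrow> sY c v \<in> V" and V0: "0 \<in> V"
    and y0: "ynz \<in> V" "ynz \<noteq> 0"
    and norming: "\<And>Q. Q \<in> hpoly F sX sY k \<Longrightarrow> (\<forall>x. Q x \<in> V) \<Longrightarrow> pnorm Q \<le> (SUP a\<in>A. norm (Q a))"
    and P: "P \<in> hpoly F sX sY k" and PV: "\<And>x. P x \<in> V" and \<epsilon>: "\<epsilon> > 0"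
  shows "\<exists>Q\<in>hpoly F sX sY k. (\<forall>x. Q x \<in> V) \<and> strongly_norm_attaining F sX Q \<and> pnorm (\<lambda>x. Q x - P x) < \<epsilon>"
proof -
  obtain \<delta> f where A_sph: "A \<subseteq> sphere 0 1" and dp: "\<And>e. e > 0 \<Longrightarrow> \<delta> e > 0"
    and fA: "\<And>a. a \<in> A \<Longrightarrow> F_linear F sX (*) (f a) \<and> (\<forall>x. f a x \<in> F) \<and> (\<forall>x. norm (f a x) \<le> norm x) \<and> f a a = 1 \<and>
        (\<forall>e>0. \<forall>x. norm x \<le> 1 \<longrightarrow> Re (f a x) \<ge> 1 - \<delta> e \<longrightarrow> norm (x - a) \<le> e)"
    using unif_strongly_exposed_functionals[OF usx] by metis
  have perturb: "\<exists>Q\<in>hpoly F sX sY k. (\<forall>x. Q x \<in> V) \<and> strongly_norm_attaining F sX Q \<and>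
           pnorm (\<lambda>x. Q x - P1 x) \<le> 4 * g0 * pnorm P1"
    if P1: "P1 \<in> hpoly F sX sY k" "\<And>x. P1 x \<in> V" "pnorm P1 > 0" and g0: "0 < g0" "g0 \<le> 1/4" for P1 g0
  proof -
    interpret perturbation g0 F sX sY k A f \<delta> V P1
      by unfold_locales (use g0 sf nsX nsY k1 A_ne A_sph fA dp Vcl Vadd Vsc V0 norming P1 in auto)
    show ?thesis using Pinf_hpoly Pinf_V Pinf_strongly_norm_attaining Pinf_close_to_P1 by blast
  qed
  have hpb: "Q \<in> hpoly F sX sY k \<Longrightarrow> pbounded Q" for Q by (rule hpoly_pbounded[OF sf nsX nsY])
  show ?thesis
  proof (cases "pnorm P > 0")
    case True
    define g0 where "g0 = min (1/4) (\<epsilon> / (8 * pnorm P))"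
    have g0: "0 < g0" "g0 \<le> 1/4" using True \<epsilon> by (auto simp: g0_def)
    obtain Q where Q: "Q \<in> hpoly F sX sY k" "\<forall>x. Q x \<in> V" "strongly_norm_attaining F sX Q"
      and d: "pnorm (\<lambda>x. Q x - P x) \<le> 4 * g0 * pnorm P"
      using perturb[OF P PV True g0] by blast
    have "4 * g0 * pnorm P \<le> 4 * (\<epsilon> / (8 * pnorm P)) * pnorm P"
      using True g0 by (intro mult_right_mono mult_left_mono) (auto simp: g0_def)
    also have "\<dots> = \<epsilon> / 2" using True by simp
    finally show ?thesis using Q d \<epsilon> by (intro bexI[of _ Q]) auto
  next
    case False
    then have P0: "P x = 0" for x
      using pnorm_nonneg[OF hpb[OF P]] hpoly_pnorm_zero[OF sf nsX nsY P k1, of x] by simp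
    obtain a0 where a0: "a0 \<in> A" using A_ne by blast
    define y1 where "y1 = sY (complex_of_real (\<epsilon> / (4 * norm ynz))) ynz"
    have y1V: "y1 \<in> V" unfolding y1_def by (intro Vsc sf_of_real[OF sf] y0(1))
    have "norm (complex_of_real (\<epsilon> / (4 * norm ynz))) = \<epsilon> / (4 * norm ynz)"
      unfolding norm_of_real using \<epsilon> by simp
    then have ny1: "norm y1 = \<epsilon> / 4"
      unfolding y1_def ns_norm[OF sf nsY sf_of_real[OF sf]] using y0(2) by simp
    define P1 where "P1 = (\<lambda>x. sY (f a0 x ^ k) y1)"
    have fa0: "F_linear F sX (*) (f a0)" "\<And>x. f a0 x \<in> F" "\<And>x. norm (f a0 x) \<le> norm x" "f a0 a0 = 1"
      using fA[OF a0] by auto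
    have a0n: "norm a0 \<le> 1" using A_sph a0 by auto
    note rank_one = rank_one_pnorm[OF sf nsX nsY fa0 a0n, of k y1]
    have rk: "P1 \<in> hpoly F sX sY k" "pnorm P1 = \<epsilon> / 4"
      using rank_one ny1 unfolding P1_def by simp_all
    have P1V: "P1 x \<in> V" for x
      unfolding P1_def by (intro Vsc y1V sf_power[OF sf] fa0)
    obtain Q where Q: "Q \<in> hpoly F sX sY k" "\<forall>x. Q x \<in> V" "strongly_norm_attaining F sX Q"
      and d: "pnorm (\<lambda>x. Q x - P1 x) \<le> 4 * (1/8) * pnorm P1"
      using perturb[OF rk(1) P1V, of "1/8"] rk(2) \<epsilon> by auto
    have "pnorm Q \<le> pnorm P1 + pnorm (\<lambda>x. Q x - P1 x)" by (rule pnorm_sub_le[OF hpb[OF Q(1)] hpb[OF rk(1)]])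
    then have "pnorm Q < \<epsilon>" using d rk(2) \<epsilon> by linarith
    moreover have "(\<lambda>x. Q x - P x) = Q" by (simp add: P0)
    ultimately show ?thesis using Q by (intro bexI[of _ Q]) auto
  qed
qed

lemma sna_dense_vector:
  fixes sX :: "complex \<Rightarrow> 'a::banach \<Rightarrow> 'a" and sY :: "complex \<Rightarrow> 'b::banach \<Rightarrow> 'b"
  assumes sf: "scalar_field F" and nsX: "normed_space_over F sX" and nsY: "normed_space_over F sY"
    and y0: "(y0::'b) \<noteq> 0" and k1: "k \<ge> 1" and A_ne: "A \<noteq> {}" and usx: "unif_strongly_exposed F sX A"
    and normS: "\<forall>P\<in>hpoly_scalar F sX k. pnorm P = (SUP a\<in>A. norm (P a))"
  shows "dense_in_pnorm {P \<in> hpoly F sX sY k. strongly_norm_attaining F sX P} (hpoly F sX sY k)"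
  unfolding dense_in_pnorm_def
proof (intro ballI allI impI)
  fix P \<epsilon> assume P: "P \<in> hpoly F sX sY k" and \<epsilon>: "(\<epsilon>::real) > 0"
  have A_cb: "A \<subseteq> cball 0 1" using usx by (auto simp: unif_strongly_exposed_def)
  have "\<exists>Q\<in>hpoly F sX sY k. (\<forall>x. Q x \<in> UNIV) \<and> strongly_norm_attaining F sX Q \<and> pnorm (\<lambda>x. Q x - P x) < \<epsilon>"
    by (rule sna_dense_in_subspace[where V=UNIV and ynz=y0, OF sf nsX nsY k1 A_ne usx closed_UNIV _ _ _ _ y0 _ P _ \<epsilon>])
       (simp_all add: norming_vector_valued[OF sf nsX nsY k1 A_ne A_cb normS])
  then show "\<exists>Q\<in>{P \<in> hpoly F sX sY k. strongly_norm_attaining F sX P}. pnorm (\<lambda>x. Q x - P x) < \<epsilon>" by blast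
qed

lemma sna_dense_scalar:
  fixes sX :: "complex \<Rightarrow> 'a::banach \<Rightarrow> 'a"
  assumes sf: "scalar_field F" and nsX: "normed_space_over F sX"
    and k1: "k \<ge> 1" and A_ne: "A \<noteq> {}" and usx: "unif_strongly_exposed F sX A"
    and normS: "\<forall>P\<in>hpoly_scalar F sX k. pnorm P = (SUP a\<in>A. norm (P a))"
    and P: "P \<in> hpoly_scalar F sX k" and \<epsilon>: "\<epsilon> > 0"
  shows "\<exists>Q\<in>hpoly_scalar F sX k. strongly_norm_attaining F sX Q \<and> pnorm (\<lambda>x. Q x - P x) < \<epsilon>"
proof -
  have norming: "pnorm Q \<le> (SUP a\<in>A. norm (Q a))" if "Q \<in> hpoly F sX (*) k" "\<forall>x. Q x \<in> F" for Q
    using normS that by (simp add: hpoly_scalar_def)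
  have "\<exists>Q\<in>hpoly F sX (*) k. (\<forall>x. Q x \<in> F) \<and> strongly_norm_attaining F sX Q \<and> pnorm (\<lambda>x. Q x - P x) < \<epsilon>"
    by (rule sna_dense_in_subspace[where V=F and ynz=1, OF sf nsX ns_complex[OF sf] k1 A_ne usx sf_closed[OF sf]
          sf_add[OF sf] sf_mult[OF sf] sf_0[OF sf] sf_1[OF sf] _ norming _ _ \<epsilon>])
       (use P in \<open>auto simp: hpoly_scalar_def\<close>)
  then show ?thesis by (auto simp: hpoly_scalar_def)
qed



section \<open>Lipschitz estimate for scalar homogeneous polynomials\<close>

text \<open>To compare \<open>Q\<close> at nearby points we restrict it to a line, where it becomes a polynomial of
  degree at most \<open>k\<close>; its coefficients are controlled by its values at the nodes \<open>0, \<dots>, k\<close> via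
  Lagrange interpolation.\<close>

definition lagr :: "nat \<Rightarrow> nat \<Rightarrow> complex poly" where
  "lagr k i = smult (1 / (\<Prod>j\<in>{..k} - {i}. (of_nat i - of_nat j)))
                    (\<Prod>j\<in>{..k} - {i}. [:- of_nat j, 1:])"

lemma lagr_degree: "i \<le> k \<Longrightarrow> degree (lagr k i) \<le> k"
proof -
  assume ik: "i \<le> k"
  have "degree (\<Prod>j\<in>{..k} - {i}. [:- of_nat j, 1:] :: complex poly) \<le> sum (degree \<circ> (\<lambda>j. [:- of_nat j, 1:] :: complex poly)) ({..k} - {i})"
    by (rule degree_prod_sum_le) simp
  also have "\<dots> \<le> sum (\<lambda>j. 1) ({..k} - {i})" by (rule sum_mono) simp
  also have "\<dots> \<le> k" using ik by (simp add: card_Diff_singleton)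
  finally show ?thesis unfolding lagr_def using degree_smult_le order_trans by blast
qed

lemma lagr_poly: "i \<le> k \<Longrightarrow> m \<le> k \<Longrightarrow> poly (lagr k i) (of_nat m) = (if m = i then 1 else 0)"
proof -
  assume i: "i \<le> k" and m: "m \<le> k"
  show ?thesis
  proof (cases "m = i")
    case True
    have "(\<Prod>j\<in>{..k} - {i}. (of_nat i - of_nat j :: complex)) \<noteq> 0" by (simp add: prod_zero_iff)
    then show ?thesis using True by (simp add: lagr_def poly_prod)
  next
    case False
    have "(\<Prod>j\<in>{..k} - {i}. poly [:- of_nat j, 1:] (of_nat m :: complex)) = 0"
      using False m by (intro prod_zero) (auto intro: bexI[of _ m])
    then show ?thesis using False by (simp add: lagr_def poly_prod)
  qed
qed

lemma lagr_interp:
  fixes q :: "complex poly"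
  assumes "degree q \<le> k"
  shows "q = (\<Sum>i\<le>k. smult (poly q (of_nat i)) (lagr k i))"
proof (rule poly_eqI_degree[of "of_nat ` {..k}"])
  fix x assume "x \<in> (of_nat ` {..k} :: complex set)"
  then obtain m where m: "m \<le> k" "x = of_nat m" by auto
  have "poly (\<Sum>i\<le>k. smult (poly q (of_nat i)) (lagr k i)) x = (\<Sum>i\<le>k. poly q (of_nat i) * (if m = i then 1 else 0))"
    using m by (simp add: poly_sum lagr_poly)
  also have "\<dots> = (\<Sum>i\<le>k. if i = m then poly q (of_nat i) else 0)" by (rule sum.cong) auto
  also have "\<dots> = poly q x" using m by (simp add: sum.delta')
  finally show "poly q x = poly (\<Sum>i\<le>k. smult (poly q (of_nat i)) (lagr k i)) x" by simp
next
  have "card (of_nat ` {..k} :: complex set) = Suc k" by (subst card_image) (auto simp: inj_on_def)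
  then show "degree q < card (of_nat ` {..k} :: complex set)" using assms by simp
  have "degree (\<Sum>i\<le>k. smult (poly q (of_nat i)) (lagr k i)) \<le> k"
    by (rule degree_sum_le) (use lagr_degree order_trans[OF degree_smult_le] in auto)
  then show "degree (\<Sum>i\<le>k. smult (poly q (of_nat i)) (lagr k i)) < card (of_nat ` {..k} :: complex set)"
    using \<open>card _ = _\<close> by simp
qed

lemma coeff_bound:
  "\<exists>B\<ge>0. \<forall>(q::complex poly) M. degree q \<le> k \<longrightarrow> (\<forall>i\<le>k. norm (poly q (of_nat i)) \<le> M) \<longrightarrow>
      (\<forall>j. norm (coeff q j) \<le> B * M)"
proof -
  define B where "B = (\<Sum>j\<le>k. \<Sum>i\<le>k. norm (coeff (lagr k i) j))"
  have B0: "B \<ge> 0" unfolding B_def by (intro sum_nonneg) auto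
  have "norm (coeff q j) \<le> B * M" if q: "degree q \<le> k" and qM: "\<forall>i\<le>k. norm (poly q (of_nat i)) \<le> M" for q :: "complex poly" and M j
  proof (cases "j \<le> k")
    case False
    then have "coeff q j = 0" using q by (intro coeff_eq_0) simp
    moreover have "M \<ge> 0" using qM[rule_format, of 0] by (meson norm_ge_zero order_trans zero_le)
    ultimately show ?thesis using B0 by simp
  next
    case True
    have "coeff q j = coeff (\<Sum>i\<le>k. smult (poly q (of_nat i)) (lagr k i)) j"
      using lagr_interp[OF q] by simp
    also have "\<dots> = (\<Sum>i\<le>k. poly q (of_nat i) * coeff (lagr k i) j)" by (simp add: coeff_sum)
    finally have "norm (coeff q j) \<le> (\<Sum>i\<le>k. norm (poly q (of_nat i)) * norm (coeff (lagr k i) j))"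
      by (metis (no_types, lifting) norm_mult norm_sum sum.cong)
    also have "\<dots> \<le> (\<Sum>i\<le>k. M * norm (coeff (lagr k i) j))"
      using qM by (intro sum_mono mult_right_mono) auto
    also have "\<dots> = M * (\<Sum>i\<le>k. norm (coeff (lagr k i) j))" by (simp add: sum_distrib_left)
    finally have c1: "norm (coeff q j) \<le> M * (\<Sum>i\<le>k. norm (coeff (lagr k i) j))" .
    have sB: "(\<Sum>i\<le>k. norm (coeff (lagr k i) j)) \<le> B"
      unfolding B_def using True by (intro member_le_sum[of j "{..k}" "\<lambda>j. \<Sum>i\<le>k. norm (coeff (lagr k i) j)"]) (auto intro: sum_nonneg)
    have M0: "M \<ge> 0" using qM[rule_format, of 0] by (meson norm_ge_zero order_trans zero_le)
    have "M * (\<Sum>i\<le>k. norm (coeff (lagr k i) j)) \<le> M * B" using sB M0 by (intro mult_left_mono)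
    then show ?thesis using c1 by (simp add: mult.commute)
  qed
  then show ?thesis using B0 by blast
qed

context
  fixes F :: "complex set" and s :: "complex \<Rightarrow> 'a::real_normed_vector \<Rightarrow> 'a" and k :: nat
  assumes sf: "scalar_field F" and nsX: "normed_space_over F s"
begin

lemma ml_expand:
  assumes L: "F_multilinear F s (*) k L"
  shows "m \<le> k \<Longrightarrow> \<exists>q::complex poly. degree q \<le> m \<and>
            (\<forall>r::real. L (\<lambda>i. if i < m then u + r *\<^sub>R h else v i) = poly q (of_real r))"
proof (induction m arbitrary: v)
  case 0
  show ?case by (intro exI[of _ "[:L v:]"]) simp
next
  case (Suc m)
  then have m: "m < k" by simp
  obtain q1 where q1: "degree q1 \<le> m" "\<forall>r::real. L (\<lambda>i. if i < m then u + r *\<^sub>R h else (v(m := u)) i) = poly q1 (of_real r)"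
    using Suc.IH[of "v(m := u)"] Suc.prems by auto
  obtain q2 where q2: "degree q2 \<le> m" "\<forall>r::real. L (\<lambda>i. if i < m then u + r *\<^sub>R h else (v(m := h)) i) = poly q2 (of_real r)"
    using Suc.IH[of "v(m := h)"] Suc.prems by auto
  have ns: "normed_space_over F ((*) :: complex \<Rightarrow> complex \<Rightarrow> complex)" by (rule ns_complex[OF sf])
  have eq: "L (\<lambda>i. if i < Suc m then u + r *\<^sub>R h else v i) = poly (q1 + [:0, 1:] * q2) (of_real r)" for r :: real
  proof -
    define W where "W = (\<lambda>i. if i < m then u + r *\<^sub>R h else v i)"
    have e0: "(\<lambda>i. if i < Suc m then u + r *\<^sub>R h else v i) = W(m := u + r *\<^sub>R h)" by (auto simp: W_def)
    have e1: "W(m := u) = (\<lambda>i. if i < m then u + r *\<^sub>R h else (v(m := u)) i)" by (auto simp: W_def)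
    have e2: "W(m := h) = (\<lambda>i. if i < m then u + r *\<^sub>R h else (v(m := h)) i)" by (auto simp: W_def)
    have "L (W(m := u + r *\<^sub>R h)) = L (W(m := u)) + L (W(m := r *\<^sub>R h))"
      by (rule ml_add[OF sf nsX ns L m])
    also have "L (W(m := r *\<^sub>R h)) = L (W(m := s (complex_of_real r) h))" by (simp add: ns_of_real[OF sf nsX])
    also have "\<dots> = complex_of_real r * L (W(m := h))"
      by (rule ml_smult[OF sf nsX ns L m sf_of_real[OF sf]])
    finally have s1: "L (W(m := u + r *\<^sub>R h)) = L (W(m := u)) + complex_of_real r * L (W(m := h))" .
    have s2: "L (W(m := u)) = poly q1 (of_real r)" unfolding e1 using q1(2) by blast
    have s3: "L (W(m := h)) = poly q2 (of_real r)" unfolding e2 using q2(2) by blast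
    show ?thesis unfolding e0 s1 s2 s3 by simp
  qed
  have "degree (q1 + [:0, 1:] * q2) \<le> Suc m"
  proof (rule degree_add_le)
    show "degree q1 \<le> Suc m" using q1(1) by simp
    have "degree ([:0, 1:] * q2) \<le> degree [:0, (1::complex):] + degree q2" by (rule degree_mult_le)
    then show "degree ([:0, 1:] * q2) \<le> Suc m" using q2(1) by simp
  qed
  then show ?case using eq by blast
qed

lemma hpoly_line_poly:
  assumes Q: "Q \<in> hpoly F s (*) k"
  shows "\<exists>q::complex poly. degree q \<le> k \<and> (\<forall>r::real. Q (u + r *\<^sub>R h) = poly q (of_real r))"
proof -
  have ns: "normed_space_over F ((*) :: complex \<Rightarrow> complex \<Rightarrow> complex)" by (rule ns_complex[OF sf])
  obtain L where L: "F_multilinear F s (*) k L" "Q = (\<lambda>x. L (\<lambda>_. x))" using Q by (rule hpolyE[OF sf nsX ns])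
  obtain q where q: "degree q \<le> k" "\<forall>r::real. L (\<lambda>i. if i < k then u + r *\<^sub>R h else u) = poly q (of_real r)"
    using ml_expand[OF L(1) order_refl, of u h "\<lambda>_. u"] by blast
  have "Q (u + r *\<^sub>R h) = L (\<lambda>i. if i < k then u + r *\<^sub>R h else u)" for r :: real
    unfolding L(2) by (rule ml_cong[OF sf nsX ns L(1)]) simp
  then show ?thesis using q by auto
qed

text \<open>Coefficients of the restriction of \<open>Q\<close> to the segment from \<open>y\<close> in direction \<open>h\<close>: rescaling
  the line so that the interpolation nodes \<open>0, \<dots>, k\<close> lie at distance at most \<open>k + 1\<close> from the
  origin, the \<open>j\<close>-th coefficient is at most \<open>B \<parallel>Q\<parallel> (k+1)^k \<parallel>h\<parallel>^j\<close>.\<close>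
lemma line_poly_coeff_bound:
  assumes k1: "k \<ge> 1" and Q: "Q \<in> hpoly F s (*) k"
    and B: "\<And>p M j. degree (p::complex poly) \<le> k \<Longrightarrow> (\<forall>i\<le>k. norm (poly p (of_nat i)) \<le> M) \<Longrightarrow>
      norm (coeff p j) \<le> B * M"
    and y: "norm y \<le> 1" and \<eta>: "0 < norm h"
    and q: "degree q \<le> k" "\<And>r::real. Q (y + r *\<^sub>R h) = poly q (of_real r)"
  shows "norm (coeff q j) \<le> B * (pnorm Q * (real k + 1) ^ k) * norm h ^ j"
proof -
  have ns: "normed_space_over F ((*) :: complex \<Rightarrow> complex \<Rightarrow> complex)" by (rule ns_complex[OF sf])
  have pQ: "pnorm Q \<ge> 0" by (rule hpoly_pnorm_nonneg[OF sf nsX ns Q])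
  have Qb: "norm (Q z) \<le> pnorm Q * norm z ^ k" for z by (rule hpoly_pnorm_bound[OF sf nsX ns Q k1])
  define \<eta> where "\<eta> = norm h"
  define q2 where "q2 = pcompose q [:0, complex_of_real (1 / \<eta>):]"
  have dq2: "degree q2 \<le> k" unfolding q2_def using q(1) by (simp add: degree_pcompose)
  define M where "M = pnorm Q * (real k + 1) ^ k"
  have q2M: "\<forall>i\<le>k. norm (poly q2 (of_nat i)) \<le> M"
  proof (intro allI impI)
    fix i assume i: "i \<le> k"
    have "poly q2 (of_nat i) = poly q (of_real (real i / \<eta>))"
      unfolding q2_def by (simp add: poly_pcompose)
    also have "\<dots> = Q (y + (real i / \<eta>) *\<^sub>R h)" by (rule q(2)[symmetric])
    finally have e: "poly q2 (of_nat i) = Q (y + (real i / \<eta>) *\<^sub>R h)" .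
    have "norm (y + (real i / \<eta>) *\<^sub>R h) \<le> norm y + norm ((real i / \<eta>) *\<^sub>R h)" by (rule norm_triangle_ineq)
    also have "norm ((real i / \<eta>) *\<^sub>R h) = real i" using \<eta> by (simp add: \<eta>_def)
    finally have "norm (y + (real i / \<eta>) *\<^sub>R h) \<le> real k + 1" using y i by linarith
    then have "norm (y + (real i / \<eta>) *\<^sub>R h) ^ k \<le> (real k + 1) ^ k" by (intro power_mono) auto
    then have "pnorm Q * norm (y + (real i / \<eta>) *\<^sub>R h) ^ k \<le> M"
      unfolding M_def using pQ by (intro mult_left_mono) auto
    then show "norm (poly q2 (of_nat i)) \<le> M" using e Qb[of "y + (real i / \<eta>) *\<^sub>R h"] by simp
  qed
  have "coeff q2 j = complex_of_real (1 / \<eta>) ^ j * coeff q j"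
    unfolding q2_def by (rule coeff_pcompose_linear)
  then have "norm (coeff q2 j) = norm (coeff q j) / \<eta> ^ j"
    using \<eta> by (simp add: \<eta>_def norm_mult norm_power norm_divide power_one_over)
  moreover have "norm (coeff q2 j) \<le> B * M" by (rule B[OF dq2 q2M])
  ultimately have "norm (coeff q j) / \<eta> ^ j \<le> B * M" by simp
  then show ?thesis using \<eta> by (simp add: divide_le_eq M_def \<eta>_def)
qed

text \<open>Increments of size at most one: \<open>Q (y + h) - Q y\<close> is the sum of the non-constant coefficients
  of the line polynomial, each of order \<open>\<parallel>h\<parallel>\<close>.\<close>
lemma hpoly_small_increment:
  assumes k1: "k \<ge> 1" and Q: "Q \<in> hpoly F s (*) k" and B0: "B \<ge> 0"
    and B: "\<And>q M j. degree (q::complex poly) \<le> k \<Longrightarrow> (\<forall>i\<le>k. norm (poly q (of_nat i)) \<le> M) \<Longrightarrow>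
      norm (coeff q j) \<le> B * M"
    and y: "norm y \<le> 1" and \<eta>: "0 < norm h" "norm h \<le> 1"
  shows "norm (Q (y + h) - Q y) \<le> (real k * B * (real k + 1) ^ k) * pnorm Q * norm h"
proof -
  have ns: "normed_space_over F ((*) :: complex \<Rightarrow> complex \<Rightarrow> complex)" by (rule ns_complex[OF sf])
  have pQ: "pnorm Q \<ge> 0" by (rule hpoly_pnorm_nonneg[OF sf nsX ns Q])
  obtain q where q: "degree q \<le> k" "\<And>r::real. Q (y + r *\<^sub>R h) = poly q (of_real r)"
    using hpoly_line_poly[OF Q, of y h] by blast
  define BM where "BM = B * (pnorm Q * (real k + 1) ^ k)"
  have BM0: "BM \<ge> 0" unfolding BM_def using B0 pQ by simp
  have cq: "norm (coeff q j) \<le> BM * norm h ^ j" for j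
    unfolding BM_def by (rule line_poly_coeff_bound[OF k1 Q _ y \<eta>(1) q]) (fact B)
  have "Q (y + h) - Q y = poly q 1 - poly q 0"
    using q(2)[of 1] q(2)[of 0] by simp
  also have "poly q 1 - poly q 0 = (\<Sum>i\<le>degree q. coeff q i) - coeff q 0"
    by (simp add: poly_altdef poly_0_coeff_0)
  also have "(\<Sum>i\<le>degree q. coeff q i) = coeff q 0 + (\<Sum>i\<in>{1..degree q}. coeff q i)"
    by (simp add: atMost_atLeast0 sum.atLeast_Suc_atMost)
  finally have "norm (Q (y + h) - Q y) \<le> (\<Sum>i\<in>{1..degree q}. norm (coeff q i))"
    by (simp add: norm_sum)
  also have "\<dots> \<le> (\<Sum>i\<in>{1..degree q}. BM * norm h)"
  proof (rule sum_mono)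
    fix i assume i: "i \<in> {1..degree q}"
    have "norm h ^ i \<le> norm h ^ 1" using \<eta> i by (intro power_decreasing) auto
    then have "BM * norm h ^ i \<le> BM * norm h" using BM0 by (intro mult_left_mono) auto
    then show "norm (coeff q i) \<le> BM * norm h"
      using cq[of i] by linarith
  qed
  also have "\<dots> = real (degree q) * (BM * norm h)" by simp
  also have "\<dots> \<le> real k * (BM * norm h)" using q(1) BM0 by (intro mult_right_mono) auto
  finally show ?thesis by (simp add: BM_def ac_simps)
qed

lemma hpoly_lipschitz:
  assumes k1: "k \<ge> 1"
  shows "\<exists>C>0. \<forall>Q\<in>hpoly F s (*) k. \<forall>x y. norm x \<le> 1 \<longrightarrow> norm y \<le> 1 \<longrightarrow>
           norm (Q x - Q y) \<le> C * pnorm Q * norm (x - y)"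
proof -
  have ns: "normed_space_over F ((*) :: complex \<Rightarrow> complex \<Rightarrow> complex)" by (rule ns_complex[OF sf])
  obtain B where B0: "B \<ge> 0" and B: "\<And>q M j. degree (q::complex poly) \<le> k \<Longrightarrow> (\<forall>i\<le>k. norm (poly q (of_nat i)) \<le> M) \<Longrightarrow>
      norm (coeff q j) \<le> B * M"
    using coeff_bound[of k] by blast
  define C where "C = real k * B * (real k + 1) ^ k + 2"
  have Cp: "C > 0" unfolding C_def using B0 by (simp add: add_nonneg_pos)
  have "norm (Q x - Q y) \<le> C * pnorm Q * norm (x - y)"
    if Q: "Q \<in> hpoly F s (*) k" and x: "norm x \<le> 1" and y: "norm y \<le> 1" for Q x y
  proof -
    have pQ: "pnorm Q \<ge> 0" by (rule hpoly_pnorm_nonneg[OF sf nsX ns Q])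
    have Qb1: "norm z \<le> 1 \<Longrightarrow> norm (Q z) \<le> pnorm Q" for z
      by (rule pnorm_ge[OF hpoly_pbounded[OF sf nsX ns Q]])
    consider "norm (x - y) > 1" | "norm (x - y) = 0" | "0 < norm (x - y)" "norm (x - y) \<le> 1" by fastforce
    then show ?thesis
    proof cases
      case 1
      have "norm (Q x - Q y) \<le> 2 * pnorm Q * 1"
        using Qb1[OF x] Qb1[OF y] norm_triangle_ineq4[of "Q x" "Q y"] by linarith
      also have "\<dots> \<le> C * pnorm Q * norm (x - y)"
        using 1 pQ B0 unfolding C_def by (intro mult_mono) auto
      finally show ?thesis .
    next
      case 2
      then show ?thesis by simp
    next
      case 3
      have "norm (Q (y + (x - y)) - Q y) \<le> (real k * B * (real k + 1) ^ k) * pnorm Q * norm (x - y)"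
        by (rule hpoly_small_increment[OF k1 Q B0 B y 3])
      also have "\<dots> \<le> C * pnorm Q * norm (x - y)"
        unfolding C_def using pQ by (intro mult_right_mono) auto
      finally show ?thesis by simp
    qed
  qed
  then show ?thesis using Cp by blast
qed

end


section \<open>Strong norm attainment implies Frechet differentiability\<close>

lemma sq_expand: fixes p q :: complex and d :: real
  shows "(cmod (p + complex_of_real d * q))^2 = (cmod p)^2 + 2*d*Re(cnj p * q) + d^2 * (cmod q)^2"
  unfolding cmod_power2 by (simp add: power2_eq_square algebra_simps)
lemma sqrt_step: fixes X M Y :: real assumes "0 \<le> X" "X^2 \<le> M^2 + Y" "M > 0"
  shows "X \<le> M + Y / (2*M)"
proof (cases "M + Y / (2*M) \<ge> 0")
  case True
  have "(M + Y / (2*M))^2 = M^2 + Y + (Y / (2*M))^2" using assms(3)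
    by (simp add: power2_eq_square field_simps)
  then have "X^2 \<le> (M + Y / (2*M))^2" using assms(2) by (smt (verit) zero_le_power2)
  then show ?thesis using True by (rule power2_le_imp_le)
next
  case False
  then have "Y / (2*M) < - M" by simp
  then have "Y < - M * (2 * M)" using assms(3) by (simp add: divide_less_eq)
  moreover have "- M * (2 * M) = - 2 * M^2" by (simp add: power2_eq_square)
  moreover have "M^2 > 0" using assms(3) by simp
  ultimately have "M^2 + Y < 0" by linarith
  moreover have "X^2 \<ge> 0" by simp
  ultimately show ?thesis using assms(2) by linarith
qed
lemma Re_cnj_mult_perturb: fixes p q p0 q0 :: complex and a b M :: real
  assumes "norm (p - p0) \<le> a" "norm (q - q0) \<le> b" "norm q \<le> 1" "norm p0 \<le> M"
  shows "Re (cnj p * q) \<le> Re (cnj p0 * q0) + a + M * b"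
proof -
  have "Re (cnj p * q) = Re (cnj (p - p0) * q) + Re (cnj p0 * (q - q0)) + Re (cnj p0 * q0)"
    by (simp add: algebra_simps)
  also have "Re (cnj (p - p0) * q) \<le> norm (cnj (p - p0) * q)" by (rule complex_Re_le_cmod)
  also have "norm (cnj (p - p0) * q) \<le> a * 1"
  proof -
    have "norm (cnj (p - p0) * q) = norm (p - p0) * norm q" by (metis complex_mod_cnj norm_mult)
    moreover have "0 \<le> a" using assms(1) norm_ge_zero order_trans by blast
    ultimately show ?thesis using assms mult_mono[of "norm (p - p0)" a "norm q" 1] by simp
  qed
  also have "Re (cnj p0 * (q - q0)) \<le> norm (cnj p0 * (q - q0))" by (rule complex_Re_le_cmod)
  also have "norm (cnj p0 * (q - q0)) \<le> M * b"
  proof -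
    have "norm (cnj p0 * (q - q0)) = norm p0 * norm (q - q0)" by (metis complex_mod_cnj norm_mult)
    moreover have "M \<ge> 0" using assms(4) norm_ge_zero order_trans by blast
    ultimately show ?thesis using assms(2,4) mult_mono[of "norm p0" M "norm (q - q0)" b] by simp
  qed
  finally show ?thesis by simp
qed

lemma perturbed_modulus_bound:
  fixes p q p0 q0 :: complex and d M a b :: real
  assumes M: "M > 0" and d: "d \<ge> 0" and p: "norm p \<le> M" and q: "norm q \<le> 1"
    and pa: "norm (p - p0) \<le> a" and qb: "norm (q - q0) \<le> b" and p0: "norm p0 \<le> M"
  shows "norm (p + complex_of_real d * q) \<le> M + d * (Re (cnj p0 * q0) + a + M * b) / M + d^2 / (2 * M)"
proof -
  have re: "Re (cnj p * q) \<le> Re (cnj p0 * q0) + a + M * b" by (rule Re_cnj_mult_perturb[OF pa qb q p0])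
  have "(norm (p + complex_of_real d * q))^2 = (norm p)^2 + 2*d*Re(cnj p * q) + d^2 * (norm q)^2"
    by (rule sq_expand)
  also have "(norm p)^2 \<le> M^2" using p by (intro power_mono) auto
  also have "2*d*Re(cnj p * q) \<le> 2*d*(Re (cnj p0 * q0) + a + M * b)" using re d by (intro mult_left_mono) auto
  also have "d^2 * (norm q)^2 \<le> d^2 * 1"
  proof -
    have "(norm q)^2 \<le> 1" using q by (simp add: power_le_one)
    then show ?thesis by (intro mult_left_mono) auto
  qed
  finally have "(norm (p + complex_of_real d * q))^2 \<le> M^2 + (2*d*(Re (cnj p0 * q0) + a + M * b) + d^2)" by simp
  then have "norm (p + complex_of_real d * q) \<le> M + (2*d*(Re (cnj p0 * q0) + a + M * b) + d^2) / (2*M)"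
    by (rule sqrt_step[OF norm_ge_zero _ M])
  also have "\<dots> = M + d * (Re (cnj p0 * q0) + a + M * b) / M + d^2 / (2 * M)"
    using M by (simp add: field_simps)
  finally show ?thesis .
qed

text \<open>The symmetric second difference of the norm at \<open>P\<close> in direction \<open>R\<close>; the norm is Frechet
  differentiable at \<open>P\<close> iff \<open>sym_diff P R d / d \<rightarrow> 0\<close> uniformly over the unit sphere.\<close>
definition sym_diff :: "('a::real_normed_vector \<Rightarrow> complex) \<Rightarrow> ('a \<Rightarrow> complex) \<Rightarrow> real \<Rightarrow> real" where
  "sym_diff P R d = pnorm (\<lambda>x. P x + complex_of_real d * R x) + pnorm (\<lambda>x. P x - complex_of_real d * R x) - 2 * pnorm P"

lemma pbounded_cmult: "pbounded R \<Longrightarrow> pbounded (\<lambda>x. c * (R x :: complex))"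
  by (rule pboundedI[where B="norm c * pnorm R"]) (simp add: norm_mult mult_left_mono pnorm_ge)

lemma sym_diff_sym: "sym_diff P R (- d) = sym_diff P R d"
  unfolding sym_diff_def by (simp add: add.commute)

lemma sym_diff_nonneg:
  assumes P: "pbounded P" and R: "pbounded R"
  shows "sym_diff P R d \<ge> 0"
proof -
  have b1: "pbounded (\<lambda>x. P x + complex_of_real d * R x)" by (intro pbounded_add P pbounded_cmult R)
  have b2: "pbounded (\<lambda>x. P x - complex_of_real d * R x)" by (intro pbounded_diff P pbounded_cmult R)
  have "pnorm (\<lambda>x. 2 * P x) = 2 * pnorm P" using pnorm_scale[OF P, of 2] by simp
  moreover have "(\<lambda>x. 2 * P x) = (\<lambda>x. (P x + complex_of_real d * R x) + (P x - complex_of_real d * R x))"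
    by (simp add: fun_eq_iff)
  moreover have "pnorm (\<lambda>x. (P x + complex_of_real d * R x) + (P x - complex_of_real d * R x)) \<le>
      pnorm (\<lambda>x. P x + complex_of_real d * R x) + pnorm (\<lambda>x. P x - complex_of_real d * R x)"
    by (rule pnorm_add[OF b1 b2])
  ultimately have "2 * pnorm P \<le> pnorm (\<lambda>x. P x + complex_of_real d * R x) + pnorm (\<lambda>x. P x - complex_of_real d * R x)"
    by metis
  then show ?thesis unfolding sym_diff_def by linarith
qed

lemma frechet_from_small:
  fixes P :: "'a::real_normed_vector \<Rightarrow> complex" and S :: "('a \<Rightarrow> complex) set"
  assumes S: "S \<noteq> {}" and P: "pbounded P" and Sb: "\<And>R. R \<in> S \<Longrightarrow> pbounded R"
    and small: "\<And>e. e > 0 \<Longrightarrow> \<exists>\<rho>>0. \<forall>d. 0 < d \<and> d < \<rho> \<longrightarrow> (\<forall>R\<in>S. sym_diff P R d \<le> e * d)"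
  shows "((\<lambda>d. SUP R\<in>S. sym_diff P R d / d) \<longlongrightarrow> 0) (at 0)"
proof (rule tendstoI)
  fix e :: real assume e: "e > 0"
  obtain \<rho> where \<rho>: "\<rho> > 0" and sm: "\<And>d R. 0 < d \<Longrightarrow> d < \<rho> \<Longrightarrow> R \<in> S \<Longrightarrow> sym_diff P R d \<le> (e/2) * d"
    using small[of "e/2"] e by auto
  obtain R0 where R0: "R0 \<in> S" using S by blast
  show "eventually (\<lambda>d. dist (SUP R\<in>S. sym_diff P R d / d) 0 < e) (at 0)"
    unfolding eventually_at
  proof (intro exI[of _ \<rho>] conjI \<rho> ballI impI)
    fix d :: real assume "d \<noteq> 0 \<and> dist d 0 < \<rho>"
    then have d0: "d \<noteq> 0" and dr: "\<bar>d\<bar> < \<rho>" by auto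
    show "dist (SUP R\<in>S. sym_diff P R d / d) 0 < e"
    proof (cases "d > 0")
      case True
      have up: "sym_diff P R d / d \<le> e/2" if "R \<in> S" for R
        using sm[OF True _ that] dr True by (simp add: divide_le_eq)
      have nn: "sym_diff P R d / d \<ge> 0" if "R \<in> S" for R
        using sym_diff_nonneg[OF P Sb[OF that]] True by simp
      have "(SUP R\<in>S. sym_diff P R d / d) \<le> e/2" using S up by (intro cSUP_least) auto
      moreover have "(SUP R\<in>S. sym_diff P R d / d) \<ge> sym_diff P R0 d / d"
        by (rule cSUP_upper[OF R0]) (use up in \<open>auto simp: bdd_above_def intro!: exI[of _ "e/2"]\<close>)
      ultimately show ?thesis using nn[OF R0] e by (simp add: dist_norm)
    next
      case False
      then have dn: "- d > 0" using d0 by simp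
      have eqs: "sym_diff P R d / d = - (sym_diff P R (- d) / (- d))" for R using sym_diff_sym[of P R d] by simp
      have up: "sym_diff P R (- d) / (- d) \<le> e/2" if "R \<in> S" for R
      proof -
        have "sym_diff P R (- d) \<le> e/2 * (- d)" using sm[OF dn _ that] dr by simp
        then show ?thesis by (subst pos_divide_le_eq[OF dn])
      qed
      have nn: "sym_diff P R (- d) / (- d) \<ge> 0" if "R \<in> S" for R
        using sym_diff_nonneg[OF P Sb[OF that], of "-d"] dn by (intro divide_nonneg_pos) auto
      have "(SUP R\<in>S. sym_diff P R d / d) \<le> 0" using S nn by (intro cSUP_least) (auto simp: eqs)
      moreover have "(SUP R\<in>S. sym_diff P R d / d) \<ge> sym_diff P R0 d / d"
        by (rule cSUP_upper[OF R0]) (use nn in \<open>auto simp: bdd_above_def eqs intro!: exI[of _ 0]\<close>)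
      moreover have "sym_diff P R0 d / d \<ge> - (e/2)" using up[OF R0] by (simp add: eqs)
      ultimately show ?thesis using e by (simp add: dist_norm)
    qed
  qed
qed




lemma cnj_rot: "norm (c::complex) = 1 \<Longrightarrow> cnj (c ^ k * a) * (c ^ k * b) = cnj a * b"
proof -
  assume c: "norm c = 1"
  have "cnj c * c = 1" using c by (metis complex_norm_square mult.commute norm_one of_real_1 power_one)
  then have "cnj (c ^ k) * c ^ k = 1" by (metis complex_cnj_power power_mult_distrib power_one)
  then have "cnj (c ^ k * a) * (c ^ k * b) = (cnj (c ^ k) * c ^ k) * (cnj a * b)" by (simp add: ac_simps)
  then show ?thesis using \<open>cnj (c ^ k) * c ^ k = 1\<close> by simp
qed

text \<open>Strong attainment at \<open>x0\<close> is uniform: every sufficiently near-maximal point of the unit ball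
  is close to a rotation of \<open>x0\<close> (otherwise a maximizing sequence would stay away from the orbit).\<close>
lemma strongly_attains_uniformly:
  fixes Q :: "'a::real_normed_vector \<Rightarrow> 'b::real_normed_vector"
  assumes sa: "strongly_attains_at F sX Q x0" and Qpb: "pbounded Q" and e: "e > 0"
  shows "\<exists>\<tau>>0. \<forall>z. norm z \<le> 1 \<longrightarrow> norm (Q z) \<ge> pnorm Q - \<tau> \<longrightarrow> (\<exists>c\<in>F. norm c = 1 \<and> norm (z - sX c x0) \<le> e)"
proof -
  define M where "M = pnorm Q"
  have maxseq: "\<And>xn. (\<forall>n. norm (xn n) \<le> 1) \<Longrightarrow> (\<lambda>n. norm (Q (xn n))) \<longlonglongrightarrow> pnorm Q \<Longrightarrow>
      (\<exists>c\<in>F. norm c = 1 \<and> (\<exists>r. strict_mono r \<and> (\<lambda>n. xn (r n)) \<longlonglongrightarrow> sX c x0))"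
    using sa unfolding strongly_attains_at_def by blast
  have "\<exists>\<tau>>0. \<forall>z. norm z \<le> 1 \<longrightarrow> norm (Q z) \<ge> M - \<tau> \<longrightarrow> (\<exists>c\<in>F. norm c = 1 \<and> norm (z - sX c x0) \<le> e)"
proof (rule ccontr)
  assume "\<not> ?thesis"
  then have bad: "\<forall>\<tau>>0. \<exists>z. norm z \<le> 1 \<and> norm (Q z) \<ge> M - \<tau> \<and> (\<forall>c\<in>F. norm c = 1 \<longrightarrow> norm (z - sX c x0) > e)"
    by (auto simp: not_le)
  have "\<forall>n. \<exists>z. norm z \<le> 1 \<and> norm (Q z) \<ge> M - inverse (real (Suc n)) \<and> (\<forall>c\<in>F. norm c = 1 \<longrightarrow> norm (z - sX c x0) > e)"
    using bad by simp
  then obtain zn where zn1: "\<And>n. norm (zn n) \<le> 1" and zn2: "\<And>n. norm (Q (zn n)) \<ge> M - inverse (real (Suc n))"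
    and zn3: "\<And>n c. c \<in> F \<Longrightarrow> norm c = 1 \<Longrightarrow> norm (zn n - sX c x0) > e"
    by metis
  have lim: "(\<lambda>n. norm (Q (zn n))) \<longlonglongrightarrow> pnorm Q"
  proof (rule tendsto_sandwich[of "\<lambda>n. M - inverse (real (Suc n))" _ _ "\<lambda>n. M"])
    show "eventually (\<lambda>n. M - inverse (real (Suc n)) \<le> norm (Q (zn n))) sequentially" using zn2 by simp
    show "eventually (\<lambda>n. norm (Q (zn n)) \<le> M) sequentially"
      unfolding M_def using pnorm_ge[OF Qpb zn1] by simp
    have "(\<lambda>n. M - inverse (real (Suc n))) \<longlonglongrightarrow> M - 0"
      by (intro tendsto_diff tendsto_const LIMSEQ_inverse_real_of_nat)
    then show "(\<lambda>n. M - inverse (real (Suc n))) \<longlonglongrightarrow> pnorm Q" by (simp add: M_def)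
    show "(\<lambda>n. M) \<longlonglongrightarrow> pnorm Q" by (simp add: M_def)
  qed
  obtain c r where c: "c \<in> F" "norm c = 1" and r: "strict_mono r" and cv: "(\<lambda>n. zn (r n)) \<longlonglongrightarrow> sX c x0"
    using maxseq[OF _ lim] zn1 by blast
  have "eventually (\<lambda>n. dist (zn (r n)) (sX c x0) < e) sequentially" using cv e by (rule tendstoD)
  then obtain n where "dist (zn (r n)) (sX c x0) < e" by (auto simp: eventually_sequentially)
  then show False using zn3[OF c, of "r n"] by (simp add: dist_norm)
qed
  then show ?thesis by (simp add: M_def)
qed

text \<open>One-sided estimate of \<open>\<parallel>Q + d R\<parallel>\<close> for small \<open>d > 0\<close>: a near-maximal point \<open>z\<close> of \<open>Q + d R\<close> is
  near-maximal for \<open>Q\<close>, hence close to a rotation of \<open>x0\<close>, and expanding \<open>|p + d q|^2\<close> there gives a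
  first-order term \<open>d Re(cnj(Q x0) R x0) / M\<close> which is odd in \<open>R\<close>.\<close>
lemma perturbed_norm_upper:
  fixes sX :: "complex \<Rightarrow> 'a::real_normed_vector \<Rightarrow> 'a" and Q R :: "'a \<Rightarrow> complex"
  assumes sf: "scalar_field F" and nsX: "normed_space_over F sX"
    and Qh: "Q \<in> hpoly F sX (*) k" and M_def: "M = pnorm Q" and Mpos: "M > 0"
    and R: "R \<in> hpoly F sX (*) k" "pnorm R = 1"
    and Lip: "\<And>R x y. R \<in> hpoly F sX (*) k \<Longrightarrow> norm x \<le> 1 \<Longrightarrow> norm y \<le> 1 \<Longrightarrow>
      norm (R x - R y) \<le> C * pnorm R * norm (x - y)" and Cp: "C > 0"
    and x0n: "norm x0 \<le> 1"
    and \<tau>c: "\<And>z. norm z \<le> 1 \<Longrightarrow> norm (Q z) \<ge> M - \<tau> \<Longrightarrow> \<exists>c\<in>F. norm c = 1 \<and> norm (z - sX c x0) \<le> e"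
    and d: "0 < d" "d * (2 + \<eta>) < \<tau>" and \<eta>: "\<eta> > 0"
  shows "pnorm (\<lambda>x. Q x + complex_of_real d * R x) \<le>
        M + d * Re (cnj (Q x0) * R x0) / M + 2 * d * C * e + d^2 / (2 * M) + d * \<eta>"
proof -
  have ns: "normed_space_over F ((*) :: complex \<Rightarrow> complex \<Rightarrow> complex)" by (rule ns_complex[OF sf])
  have hpb: "R \<in> hpoly F sX (*) k \<Longrightarrow> pbounded R" for R by (rule hpoly_pbounded[OF sf nsX ns])
  have Qpb: "pbounded Q" by (rule hpb[OF Qh])
  have Rpb: "pbounded R" by (rule hpb[OF R(1)])
  define Pd where "Pd = (\<lambda>x. Q x + complex_of_real d * R x)"
  have b1: "pbounded Pd" unfolding Pd_def by (intro pbounded_add Qpb pbounded_cmult Rpb)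
  have "pnorm Pd - d * \<eta> < (SUP z\<in>cball 0 1. norm (Pd z))" using d \<eta> by (simp add: pnorm_def)
  moreover have ne: "cball (0::'a) 1 \<noteq> {}" by simp
  ultimately have "\<exists>z\<in>cball 0 1. pnorm Pd - d * \<eta> < norm (Pd z)"
    using less_cSUP_iff[OF ne pbounded_bdd[OF b1]] by blast
  then obtain z where zb: "z \<in> cball 0 1" and zbig: "pnorm Pd - d * \<eta> < norm (Pd z)" by blast
  have z: "norm z \<le> 1" using zb by simp
  have Rz: "norm (R z) \<le> 1" using pnorm_ge[OF Rpb z] R(2) by simp
  have Pdge: "pnorm Pd \<ge> M - d"
  proof -
    have "pnorm Q \<le> pnorm Pd + pnorm (\<lambda>x. Q x - Pd x)" by (rule pnorm_sub_le[OF Qpb b1])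
    moreover have "(\<lambda>x. Q x - Pd x) = (\<lambda>x. (- complex_of_real d) * R x)" by (simp add: Pd_def fun_eq_iff)
    moreover have "pnorm (\<lambda>x. (- complex_of_real d) * R x) = d" using pnorm_scale[OF Rpb, of "- complex_of_real d"] R(2) d
      by simp
    ultimately show ?thesis by (simp add: M_def)
  qed
  have Qz: "norm (Q z) \<ge> M - \<tau>"
  proof -
    have "norm (Pd z) \<le> norm (Q z) + norm (complex_of_real d * R z)" unfolding Pd_def by (rule norm_triangle_ineq)
    also have "norm (complex_of_real d * R z) \<le> d * 1" using Rz d by (simp add: norm_mult mult_left_mono)
    finally have "norm (Q z) \<ge> M - d - d * \<eta> - d" using zbig Pdge by linarith
    moreover have "d * (2 + \<eta>) < \<tau>" by (rule d(2))
    ultimately show ?thesis by (simp add: algebra_simps)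
  qed
  obtain c where c: "c \<in> F" "norm c = 1" and zc: "norm (z - sX c x0) \<le> e" using \<tau>c[OF z Qz] by blast
  define z' where "z' = sX c x0"
  have z': "norm z' \<le> 1" unfolding z'_def using ns_norm[OF sf nsX c(1)] c(2) x0n by simp
  have p0: "Q z' = c ^ k * Q x0" unfolding z'_def by (rule hpoly_hom[OF sf nsX ns Qh c(1)])
  have q0: "R z' = c ^ k * R x0" unfolding z'_def by (rule hpoly_hom[OF sf nsX ns R(1) c(1)])
  have pz: "norm (Q z) \<le> M" unfolding M_def by (rule pnorm_ge[OF Qpb z])
  have p0n: "norm (Q z') \<le> M" unfolding M_def by (rule pnorm_ge[OF Qpb z'])
  have pa: "norm (Q z - Q z') \<le> C * M * e"
  proof -
    have "norm (Q z - Q z') \<le> C * pnorm Q * norm (z - z')" by (rule Lip[OF Qh z z'])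
    also have "\<dots> \<le> C * pnorm Q * e" using zc Cp pnorm_nonneg[OF Qpb] unfolding z'_def by (intro mult_left_mono) auto
    finally show ?thesis by (simp add: M_def)
  qed
  have qb: "norm (R z - R z') \<le> M * 0 + C * e"
  proof -
    have "norm (R z - R z') \<le> C * pnorm R * norm (z - z')" by (rule Lip[OF R(1) z z'])
    also have "\<dots> \<le> C * 1 * e" using zc Cp R(2) unfolding z'_def by simp
    finally show ?thesis by simp
  qed
  have est: "norm (Q z + complex_of_real d * R z) \<le>
      M + d * (Re (cnj (Q z') * R z') + C * M * e + M * (M * 0 + C * e)) / M + d^2 / (2 * M)"
    by (rule perturbed_modulus_bound[OF Mpos less_imp_le[OF d(1)] pz Rz pa qb p0n])
  have rr: "Re (cnj (Q z') * R z') = Re (cnj (Q x0) * R x0)" by (simp only: p0 q0 cnj_rot[OF c(2)])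
  have "d * (Re (cnj (Q x0) * R x0) + C * M * e + M * (M * 0 + C * e)) / M =
        d * Re (cnj (Q x0) * R x0) / M + 2 * d * C * e" using Mpos by (simp add: field_simps)
  then have "norm (Pd z) \<le> M + d * Re (cnj (Q x0) * R x0) / M + 2 * d * C * e + d^2 / (2 * M)"
    using est rr unfolding Pd_def by simp
  then show ?thesis using zbig unfolding Pd_def by linarith
qed

text \<open>Strongly norm attaining scalar polynomials are points of Frechet differentiability of the
  norm of \<open>P(^k X)\<close>: the symmetric difference quotient is \<open>o(d)\<close> uniformly on the unit sphere,
  because the first-order terms of \<open>\<parallel>Q + dR\<parallel>\<close> and \<open>\<parallel>Q - dR\<parallel>\<close> cancel.\<close>
lemma sna_imp_frechet:
  fixes F :: "complex set" and sX :: "complex \<Rightarrow> 'a::banach \<Rightarrow> 'a" and k :: nat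
  assumes sf: "scalar_field F" and nsX: "normed_space_over F sX" and k1: "k \<ge> 1"
    and Q: "Q \<in> hpoly_scalar F sX k" and sna: "strongly_norm_attaining F sX Q"
  shows "frechet_diff_norm_at (hpoly_scalar F sX k) Q"
proof -
  have ns: "normed_space_over F ((*) :: complex \<Rightarrow> complex \<Rightarrow> complex)" by (rule ns_complex[OF sf])
  define S where "S = {R \<in> hpoly_scalar F sX k. pnorm R = 1}"
  have Sh: "R \<in> S \<Longrightarrow> R \<in> hpoly F sX (*) k \<and> pnorm R = 1" for R by (simp add: S_def hpoly_scalar_def)
  have Qh: "Q \<in> hpoly F sX (*) k" using Q by (simp add: hpoly_scalar_def)
  have hpb: "R \<in> hpoly F sX (*) k \<Longrightarrow> pbounded R" for R by (rule hpoly_pbounded[OF sf nsX ns])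
  have Qpb: "pbounded Q" by (rule hpb[OF Qh])
  obtain C where Cp: "C > 0" and Lip: "\<And>R x y. R \<in> hpoly F sX (*) k \<Longrightarrow> norm x \<le> 1 \<Longrightarrow> norm y \<le> 1 \<Longrightarrow>
      norm (R x - R y) \<le> C * pnorm R * norm (x - y)"
    using hpoly_lipschitz[OF sf nsX k1] by blast
  obtain x0 where sa: "strongly_attains_at F sX Q x0" using sna unfolding strongly_norm_attaining_def by blast
  have Qne: "Q \<noteq> (\<lambda>_. 0)" and x0n: "norm x0 \<le> 1" using sa unfolding strongly_attains_at_def by blast+
  define M where "M = pnorm Q"
  have Mpos: "M > 0"
  proof -
    have "M \<noteq> 0" using hpoly_pnorm_zero[OF sf nsX ns Qh k1] Qne by (auto simp: M_def)
    then show ?thesis using pnorm_nonneg[OF Qpb] by (simp add: M_def)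
  qed
  have small: "\<exists>\<rho>>0. \<forall>d. 0 < d \<and> d < \<rho> \<longrightarrow> (\<forall>R\<in>S. sym_diff Q R d \<le> \<epsilon> * d)" if \<epsilon>: "\<epsilon> > 0" for \<epsilon>
  proof -
    define e where "e = \<epsilon> / (16 * C)"
    have ep: "e > 0" unfolding e_def using \<epsilon> Cp by simp
    obtain \<tau> where \<tau>: "\<tau> > 0" and \<tau>c: "\<And>z. norm z \<le> 1 \<Longrightarrow> norm (Q z) \<ge> M - \<tau> \<Longrightarrow> \<exists>c\<in>F. norm c = 1 \<and> norm (z - sX c x0) \<le> e"
      using strongly_attains_uniformly[OF sa Qpb ep] unfolding M_def by blast
    define \<rho> where "\<rho> = min (\<tau> / (2 + \<epsilon>/4)) (\<epsilon> * M / 4)"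
    have \<rho>p: "\<rho> > 0" unfolding \<rho>_def using \<tau> \<epsilon> Mpos by (simp add: add_pos_pos)
    show ?thesis
    proof (intro exI[of _ \<rho>] conjI \<rho>p allI impI ballI)
      fix d R assume d: "0 < d \<and> d < \<rho>" and RS: "R \<in> S"
      have Rh: "R \<in> hpoly F sX (*) k" and R1: "pnorm R = 1" using Sh[OF RS] by auto
      have dt: "d * (2 + \<epsilon> / 4) < \<tau>" using d \<epsilon> unfolding \<rho>_def by (simp add: less_divide_eq add_pos_pos)
      note upper = perturbed_norm_upper[OF sf nsX Qh M_def Mpos _ _ Lip Cp x0n \<tau>c _ dt]
      define R' where "R' = (\<lambda>x. (-1) * R x)"
      have R'h: "R' \<in> hpoly F sX (*) k"
        unfolding R'_def by (rule hpoly_compose[where t="(*)" and t'="(*)" and B=1, OF Rh F_linear_cmult]) simp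
      have R'1: "pnorm R' = 1" unfolding R'_def using pnorm_scale[OF hpb[OF Rh], of "-1"] R1 by simp
      have o1: "pnorm (\<lambda>x. Q x + complex_of_real d * R x) \<le>
          M + d * Re (cnj (Q x0) * R x0) / M + 2 * d * C * e + d^2 / (2 * M) + d * (\<epsilon> / 4)"
        using upper[OF Rh R1] d \<epsilon> by simp
      have o2: "pnorm (\<lambda>x. Q x + complex_of_real d * R' x) \<le>
          M + d * Re (cnj (Q x0) * R' x0) / M + 2 * d * C * e + d^2 / (2 * M) + d * (\<epsilon> / 4)"
        using upper[OF R'h R'1] d \<epsilon> by simp
      have e2: "(\<lambda>x. Q x + complex_of_real d * R' x) = (\<lambda>x. Q x - complex_of_real d * R x)"
        by (simp add: R'_def fun_eq_iff)
      have "Re (cnj (Q x0) * R' x0) = - Re (cnj (Q x0) * R x0)" by (simp add: R'_def)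
      then have e3: "d * Re (cnj (Q x0) * R' x0) / M = - (d * Re (cnj (Q x0) * R x0) / M)"
        by (simp only: mult_minus_right minus_divide_left)
      have N1: "sym_diff Q R d \<le> 2 * (2 * d * C * e) + 2 * (d^2 / (2 * M)) + d * \<epsilon> / 2"
        using o1 o2[unfolded e2] e3 unfolding sym_diff_def M_def[symmetric] by linarith
      have t1: "2 * (2 * d * C * e) = d * \<epsilon> / 4" unfolding e_def using Cp by simp
      have t2: "2 * (d^2 / (2 * M)) \<le> d * \<epsilon> / 4"
      proof -
        have "d \<le> \<epsilon> * M / 4" using d unfolding \<rho>_def by simp
        then have "d * d \<le> d * (\<epsilon> * M / 4)" using d by (intro mult_left_mono) auto
        then show ?thesis using Mpos by (simp add: power2_eq_square divide_le_eq field_simps)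
      qed
      have "sym_diff Q R d \<le> d * \<epsilon> / 4 + d * \<epsilon> / 4 + d * \<epsilon> / 2" using N1 t1 t2 by linarith
      then show "sym_diff Q R d \<le> \<epsilon> * d" by (simp add: algebra_simps)
    qed
  qed
  have Sne: "S \<noteq> {}"
  proof -
    define R0 where "R0 = (\<lambda>x. complex_of_real (1 / M) * Q x)"
    have "R0 \<in> hpoly_scalar F sX k" unfolding R0_def by (rule hpoly_scalar_cmult[OF sf Q sf_of_real[OF sf]])
    moreover have "pnorm R0 = 1" unfolding R0_def using pnorm_scale[OF Qpb, of "complex_of_real (1 / M)"] Mpos
      by (simp add: M_def norm_divide)
    ultimately show ?thesis unfolding S_def by blast
  qed
  have "((\<lambda>d. SUP R\<in>S. sym_diff Q R d / d) \<longlongrightarrow> 0) (at 0)"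
    by (rule frechet_from_small[OF Sne Qpb _ small]) (use Sh hpb in blast)
  then show ?thesis unfolding frechet_diff_norm_at_def sym_diff_def S_def .
qed


section \<open>The set of Frechet differentiability points is a G-delta\<close>

text \<open>The quotient \<open>sym_diff P R d / d\<close> is monotone in \<open>d > 0\<close> (by convexity of the norm) and
  Lipschitz in \<open>P\<close>; hence Frechet differentiability at \<open>P\<close> means that the supremum of the
  quotient over the unit sphere drops below \<open>1/(n+1)\<close> for some \<open>d\<close>, for every \<open>n\<close>, and each of
  these conditions defines an open set.\<close>

lemma pnorm_convex_comb:
  fixes f g :: "'a::real_normed_vector \<Rightarrow> complex"
  assumes f: "pbounded f" and g: "pbounded g" and l: "0 \<le> l" "l \<le> 1"
  shows "pnorm (\<lambda>x. complex_of_real l * f x + complex_of_real (1 - l) * g x) \<le> l * pnorm f + (1 - l) * pnorm g"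
proof -
  have "pnorm (\<lambda>x. complex_of_real l * f x + complex_of_real (1 - l) * g x) \<le>
        pnorm (\<lambda>x. complex_of_real l * f x) + pnorm (\<lambda>x. complex_of_real (1 - l) * g x)"
    by (intro pnorm_add pbounded_cmult f g)
  also have "pnorm (\<lambda>x. complex_of_real l * f x) = l * pnorm f"
    unfolding pnorm_scale[OF f] norm_of_real using l by simp
  also have "pnorm (\<lambda>x. complex_of_real (1 - l) * g x) = (1 - l) * pnorm g"
    unfolding pnorm_scale[OF g] norm_of_real using l by simp
  finally show ?thesis .
qed

text \<open>Monotonicity of the difference quotient, from convexity of \<open>d \<mapsto> pnorm (P + d R)\<close>.\<close>
lemma sym_diff_mono:
  fixes P R :: "'a::real_normed_vector \<Rightarrow> complex"
  assumes P: "pbounded P" and R: "pbounded R" and d: "0 < d'" "d' \<le> d"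
  shows "sym_diff P R d' / d' \<le> sym_diff P R d / d"
proof -
  define l where "l = d' / d"
  have l: "0 \<le> l" "l \<le> 1" using d by (auto simp: l_def)
  have dl: "d' = l * d" using d by (simp add: l_def)
  have bp: "pbounded (\<lambda>x. P x + complex_of_real t * R x)" for t by (intro pbounded_add P pbounded_cmult R)
  have c1: "pnorm (\<lambda>x. P x + complex_of_real d' * R x) \<le> l * pnorm (\<lambda>x. P x + complex_of_real d * R x) + (1 - l) * pnorm P"
  proof -
    have "(\<lambda>x. P x + complex_of_real d' * R x) =
          (\<lambda>x. complex_of_real l * (P x + complex_of_real d * R x) + complex_of_real (1 - l) * P x)"
      by (simp add: dl fun_eq_iff algebra_simps)
    then show ?thesis using pnorm_convex_comb[OF bp P l, of d] by simp
  qed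
  have c2: "pnorm (\<lambda>x. P x - complex_of_real d' * R x) \<le> l * pnorm (\<lambda>x. P x - complex_of_real d * R x) + (1 - l) * pnorm P"
  proof -
    have bm: "pbounded (\<lambda>x. P x - complex_of_real d * R x)" by (intro pbounded_diff P pbounded_cmult R)
    have "(\<lambda>x. P x - complex_of_real d' * R x) =
          (\<lambda>x. complex_of_real l * (P x - complex_of_real d * R x) + complex_of_real (1 - l) * P x)"
      by (simp add: dl fun_eq_iff algebra_simps)
    then show ?thesis using pnorm_convex_comb[OF bm P l] by simp
  qed
  have "sym_diff P R d' \<le> l * sym_diff P R d" unfolding sym_diff_def using c1 c2 by (simp add: algebra_simps)
  then have "sym_diff P R d' / d' \<le> l * sym_diff P R d / d'" using d by (simp add: divide_right_mono)
  also have "l * sym_diff P R d / d' = sym_diff P R d / d" using d by (simp add: l_def)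
  finally show ?thesis .
qed

lemma sym_diff_upper:
  fixes P R :: "'a::real_normed_vector \<Rightarrow> complex"
  assumes P: "pbounded P" and R: "pbounded R" and R1: "pnorm R = 1" and d: "d > 0"
  shows "sym_diff P R d \<le> 2 * d"
proof -
  have "pnorm (\<lambda>x. P x + complex_of_real d * R x) \<le> pnorm P + pnorm (\<lambda>x. complex_of_real d * R x)"
    by (intro pnorm_add P pbounded_cmult R)
  moreover have "pnorm (\<lambda>x. P x - complex_of_real d * R x) \<le> pnorm P + pnorm (\<lambda>x. complex_of_real d * R x)"
    by (intro pnorm_diff P pbounded_cmult R)
  moreover have "pnorm (\<lambda>x. complex_of_real d * R x) = d" using pnorm_scale[OF R] R1 d by simp
  ultimately show ?thesis unfolding sym_diff_def by linarith
qed

lemma sym_diff_lip: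
  fixes P P' R :: "'a::real_normed_vector \<Rightarrow> complex"
  assumes P: "pbounded P" and P': "pbounded P'" and R: "pbounded R"
  shows "sym_diff P' R d \<le> sym_diff P R d + 4 * pnorm (\<lambda>x. P' x - P x)"
proof -
  have bp: "pbounded (\<lambda>x. Q x + complex_of_real d * R x)" if "pbounded Q" for Q
    by (intro pbounded_add that pbounded_cmult R)
  have bm: "pbounded (\<lambda>x. Q x - complex_of_real d * R x)" if "pbounded Q" for Q
    by (intro pbounded_diff that pbounded_cmult R)
  have a1: "pnorm (\<lambda>x. P' x + complex_of_real d * R x) \<le> pnorm (\<lambda>x. P x + complex_of_real d * R x) + pnorm (\<lambda>x. P' x - P x)"
  proof -
    have "pnorm (\<lambda>x. P' x + complex_of_real d * R x) \<le> pnorm (\<lambda>x. P x + complex_of_real d * R x) +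
          pnorm (\<lambda>x. (P' x + complex_of_real d * R x) - (P x + complex_of_real d * R x))"
      by (rule pnorm_sub_le[OF bp[OF P'] bp[OF P]])
    then show ?thesis by simp
  qed
  have a2: "pnorm (\<lambda>x. P' x - complex_of_real d * R x) \<le> pnorm (\<lambda>x. P x - complex_of_real d * R x) + pnorm (\<lambda>x. P' x - P x)"
  proof -
    have "pnorm (\<lambda>x. P' x - complex_of_real d * R x) \<le> pnorm (\<lambda>x. P x - complex_of_real d * R x) +
          pnorm (\<lambda>x. (P' x - complex_of_real d * R x) - (P x - complex_of_real d * R x))"
      by (rule pnorm_sub_le[OF bm[OF P'] bm[OF P]])
    then show ?thesis by simp
  qed
  have a3: "pnorm P \<le> pnorm P' + pnorm (\<lambda>x. P' x - P x)"
  proof -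
    have "pnorm P \<le> pnorm P' + pnorm (\<lambda>x. P x - P' x)" by (rule pnorm_sub_le[OF P P'])
    moreover have "pnorm (\<lambda>x. P x - P' x) = pnorm (\<lambda>x. P' x - P x)"
      using pnorm_scale[OF pbounded_diff[OF P' P], of "-1"] by (simp add: algebra_simps)
    ultimately show ?thesis by simp
  qed
  show ?thesis unfolding sym_diff_def using a1 a2 a3 by linarith
qed

definition sup_quotient :: "('a::real_normed_vector \<Rightarrow> complex) set \<Rightarrow> ('a \<Rightarrow> complex) \<Rightarrow> real \<Rightarrow> real" where
  "sup_quotient H P d = (SUP R\<in>{R \<in> H. pnorm R = 1}. sym_diff P R d / d)"

context
  fixes H :: "('a::real_normed_vector \<Rightarrow> complex) set"
  assumes Hb: "\<And>P. P \<in> H \<Longrightarrow> pbounded P" and Sne: "{R \<in> H. pnorm R = 1} \<noteq> {}"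
begin

lemma sup_quotient_upper:
  assumes P: "P \<in> H" and d: "d > 0" and R: "R \<in> H" "pnorm R = 1"
  shows "sym_diff P R d / d \<le> sup_quotient H P d"
proof -
  have "sym_diff P R d / d \<le> 2" if "R \<in> H" "pnorm R = 1" for R
    using sym_diff_upper[OF Hb[OF P] Hb[OF that(1)] that(2) d] d by (simp add: divide_le_eq)
  then have "bdd_above ((\<lambda>R. sym_diff P R d / d) ` {R \<in> H. pnorm R = 1})"
    by (auto simp: bdd_above_def)
  then show ?thesis unfolding sup_quotient_def by (rule cSUP_upper[rotated]) (use R in simp)
qed

lemma sup_quotient_lip:
  assumes P: "P \<in> H" and Q: "Q \<in> H" and d: "d > 0"
  shows "sup_quotient H Q d \<le> sup_quotient H P d + 4 * pnorm (\<lambda>x. Q x - P x) / d"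
  unfolding sup_quotient_def[of H Q]
proof (rule cSUP_least[OF Sne])
  fix R assume R: "R \<in> {R \<in> H. pnorm R = 1}"
  have "sym_diff Q R d \<le> sym_diff P R d + 4 * pnorm (\<lambda>x. Q x - P x)"
    using sym_diff_lip[OF Hb[OF P] Hb[OF Q]] Hb R by blast
  then have "sym_diff Q R d / d \<le> sym_diff P R d / d + 4 * pnorm (\<lambda>x. Q x - P x) / d"
    using d by (simp add: add_divide_distrib[symmetric] divide_right_mono)
  also have "sym_diff P R d / d \<le> sup_quotient H P d" using R by (intro sup_quotient_upper[OF P d]) auto
  finally show "sym_diff Q R d / d \<le> sup_quotient H P d + 4 * pnorm (\<lambda>x. Q x - P x) / d" by simp
qed

lemma open_quotient_level: "open_in_pnorm {P \<in> H. \<exists>d>0. sup_quotient H P d < c} H"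
  unfolding open_in_pnorm_def
proof (intro conjI ballI)
  show "{P \<in> H. \<exists>d>0. sup_quotient H P d < c} \<subseteq> H" by auto
next
  fix P assume "P \<in> {P \<in> H. \<exists>d>0. sup_quotient H P d < c}"
  then obtain d where P: "P \<in> H" and d: "d > 0" and Dd: "sup_quotient H P d < c" by auto
  define r where "r = (c - sup_quotient H P d) * d / 4"
  have rp: "r > 0" unfolding r_def using Dd d by simp
  show "\<exists>r>0. \<forall>Q\<in>H. pnorm (\<lambda>x. Q x - P x) < r \<longrightarrow> Q \<in> {P \<in> H. \<exists>d>0. sup_quotient H P d < c}"
  proof (intro exI[of _ r] conjI rp ballI impI)
    fix Q assume Q: "Q \<in> H" and QP: "pnorm (\<lambda>x. Q x - P x) < r"
    have "sup_quotient H Q d \<le> sup_quotient H P d + 4 * pnorm (\<lambda>x. Q x - P x) / d"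
      by (rule sup_quotient_lip[OF P Q d])
    also have "4 * pnorm (\<lambda>x. Q x - P x) / d < 4 * r / d" using QP d by (simp add: divide_strict_right_mono)
    also have "4 * r / d = c - sup_quotient H P d" unfolding r_def using d by simp
    finally show "Q \<in> {P \<in> H. \<exists>d>0. sup_quotient H P d < c}" using Q d by auto
  qed
qed

lemma frechet_iff_quotient_levels:
  assumes P: "P \<in> H"
  shows "frechet_diff_norm_at H P \<longleftrightarrow> (\<forall>n. \<exists>d>0. sup_quotient H P d < 1 / real (Suc n))"
proof -
  define S where "S = {R \<in> H. pnorm R = 1}"
  have fr: "frechet_diff_norm_at H P \<longleftrightarrow> (sup_quotient H P \<longlongrightarrow> 0) (at 0)"
    unfolding frechet_diff_norm_at_def sup_quotient_def[abs_def] sym_diff_def ..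
  show ?thesis
  proof
    assume "frechet_diff_norm_at H P"
    then have lim: "(sup_quotient H P \<longlongrightarrow> 0) (at 0)" using fr by simp
    show "\<forall>n. \<exists>d>0. sup_quotient H P d < 1 / real (Suc n)"
    proof
      fix n
      have "eventually (\<lambda>d. dist (sup_quotient H P d) 0 < 1 / real (Suc n)) (at 0)"
        using lim by (rule tendstoD) simp
      then obtain \<rho> where \<rho>: "\<rho> > 0"
        and h: "\<And>d. d \<noteq> 0 \<Longrightarrow> dist d 0 < \<rho> \<Longrightarrow> dist (sup_quotient H P d) 0 < 1 / real (Suc n)"
        unfolding eventually_at by auto
      have "dist (sup_quotient H P (\<rho>/2)) 0 < 1 / real (Suc n)" using \<rho> by (intro h) auto
      then show "\<exists>d>0. sup_quotient H P d < 1 / real (Suc n)" using \<rho> by (intro exI[of _ "\<rho>/2"]) auto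
    qed
  next
    assume Un: "\<forall>n. \<exists>d>0. sup_quotient H P d < 1 / real (Suc n)"
    have "((\<lambda>d. SUP R\<in>S. sym_diff P R d / d) \<longlongrightarrow> 0) (at 0)"
    proof (rule frechet_from_small[OF Sne[folded S_def] Hb[OF P]])
      show "R \<in> S \<Longrightarrow> pbounded R" for R using Hb by (auto simp: S_def)
      fix e :: real assume e: "e > 0"
      obtain n where n: "1 / real (Suc n) < e" using e by (metis nat_approx_posE)
      obtain d0 where d0: "d0 > 0" "sup_quotient H P d0 < 1 / real (Suc n)" using Un by blast
      show "\<exists>\<rho>>0. \<forall>d. 0 < d \<and> d < \<rho> \<longrightarrow> (\<forall>R\<in>S. sym_diff P R d \<le> e * d)"
      proof (intro exI[of _ d0] conjI d0(1) allI impI ballI)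
        fix d R assume d: "0 < d \<and> d < d0" and R: "R \<in> S"
        have "sym_diff P R d / d \<le> sym_diff P R d0 / d0"
          using d R Hb by (intro sym_diff_mono[OF Hb[OF P]]) (auto simp: S_def)
        also have "\<dots> \<le> sup_quotient H P d0" using R by (intro sup_quotient_upper[OF P d0(1)]) (auto simp: S_def)
        also have "\<dots> < e" using d0(2) n by linarith
        finally show "sym_diff P R d \<le> e * d" using d by (simp add: divide_less_eq)
      qed
    qed
    then show "frechet_diff_norm_at H P" using fr by (simp add: sup_quotient_def[abs_def] S_def)
  qed
qed

lemma gdelta_frechet: "gdelta_in_pnorm {P \<in> H. frechet_diff_norm_at H P} H"
proof -
  define U where "U n = {P \<in> H. \<exists>d>0. sup_quotient H P d < 1 / real (Suc n)}" for n
  have "{P \<in> H. frechet_diff_norm_at H P} = (\<Inter>n. U n)"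
    using frechet_iff_quotient_levels by (auto simp: U_def)
  moreover have "open_in_pnorm (U n) H" for n unfolding U_def by (rule open_quotient_level)
  ultimately show ?thesis unfolding gdelta_in_pnorm_def by blast
qed

end

lemma frechet_dense_scalar:
  fixes sX :: "complex \<Rightarrow> 'a::banach \<Rightarrow> 'a"
  assumes sf: "scalar_field F" and nsX: "normed_space_over F sX"
    and k1: "k \<ge> 1" and A_ne: "A \<noteq> {}" and usx: "unif_strongly_exposed F sX A"
    and normS: "\<forall>P\<in>hpoly_scalar F sX k. pnorm P = (SUP a\<in>A. norm (P a))"
  shows "dense_in_pnorm {P \<in> hpoly_scalar F sX k. frechet_diff_norm_at (hpoly_scalar F sX k) P}
           (hpoly_scalar F sX k)"
  unfolding dense_in_pnorm_def
proof (intro ballI allI impI)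
  fix P \<epsilon> assume P: "P \<in> hpoly_scalar F sX k" and \<epsilon>: "(\<epsilon>::real) > 0"
  obtain Q where Q: "Q \<in> hpoly_scalar F sX k" "strongly_norm_attaining F sX Q" "pnorm (\<lambda>x. Q x - P x) < \<epsilon>"
    using sna_dense_scalar[OF sf nsX k1 A_ne usx normS P \<epsilon>] by blast
  then show "\<exists>Q\<in>{P \<in> hpoly_scalar F sX k. frechet_diff_norm_at (hpoly_scalar F sX k) P}.
      pnorm (\<lambda>x. Q x - P x) < \<epsilon>"
    using sna_imp_frechet[OF sf nsX k1 Q(1,2)] by blast
qed

text \<open>The Frechet differentiability points form a \<open>G\<delta>\<close>: the unit sphere of \<open>P(^k X)\<close> is nonempty,
  as witnessed by \<open>f(a)^k\<close> for an exposed point \<open>a\<close>.\<close>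
lemma frechet_gdelta_scalar:
  fixes sX :: "complex \<Rightarrow> 'a::banach \<Rightarrow> 'a"
  assumes sf: "scalar_field F" and nsX: "normed_space_over F sX"
    and A_ne: "A \<noteq> {}" and usx: "unif_strongly_exposed F sX A"
  shows "gdelta_in_pnorm {P \<in> hpoly_scalar F sX k. frechet_diff_norm_at (hpoly_scalar F sX k) P}
           (hpoly_scalar F sX k)"
proof (rule gdelta_frechet)
  have ns: "normed_space_over F ((*) :: complex \<Rightarrow> complex \<Rightarrow> complex)" by (rule ns_complex[OF sf])
  show "P \<in> hpoly_scalar F sX k \<Longrightarrow> pbounded P" for P
    using hpoly_pbounded[OF sf nsX ns] by (auto simp: hpoly_scalar_def)
  obtain a0 where a0: "a0 \<in> A" using A_ne by blast
  obtain fA where A_sph: "A \<subseteq> sphere 0 1"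
    and fA: "\<And>a. a \<in> A \<Longrightarrow> F_linear F sX (*) (fA a) \<and> (\<forall>x. fA a x \<in> F) \<and>
        (\<forall>x. norm (fA a x) \<le> norm x) \<and> fA a a = 1"
    using unif_strongly_exposed_functionals[OF usx] by metis
  have f: "F_linear F sX (*) (fA a0)" "\<And>x. fA a0 x \<in> F" "\<And>x. norm (fA a0 x) \<le> norm x" "fA a0 a0 = 1"
    using fA[OF a0] by auto
  have a0n: "norm a0 \<le> 1" using A_sph a0 by auto
  note R0 = rank_one_pnorm[OF sf nsX ns f a0n, of k 1]
  have "(\<lambda>x. fA a0 x ^ k * 1) \<in> hpoly_scalar F sX k"
    using R0(1) sf_power[OF sf f(2)] by (simp add: hpoly_scalar_def)
  then show "{R \<in> hpoly_scalar F sX k. pnorm R = 1} \<noteq> {}" using R0(2) by auto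
qed

theorem theorem3p1:
  fixes F :: "complex set"
    and sX :: "complex \<Rightarrow> 'a::banach \<Rightarrow> 'a"
    and sY :: "complex \<Rightarrow> 'b::banach \<Rightarrow> 'b"
    and k :: nat
    and A :: "'a set"
  assumes "scalar_field F"
    and "normed_space_over F sX"
    and "normed_space_over F sY"
    and "\<exists>y::'b. y \<noteq> 0"
    and "k \<ge> 1"
    and "A \<noteq> {}"
    and "unif_strongly_exposed F sX A"
    and "\<forall>P\<in>hpoly_scalar F sX k. pnorm P = (SUP a\<in>A. norm (P a))"
  shows "dense_in_pnorm {P \<in> hpoly F sX sY k. strongly_norm_attaining F sX P} (hpoly F sX sY k)
       \<and> dense_in_pnorm {P \<in> hpoly_scalar F sX k. frechet_diff_norm_at (hpoly_scalar F sX k) P}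
           (hpoly_scalar F sX k)
       \<and> gdelta_in_pnorm {P \<in> hpoly_scalar F sX k. frechet_diff_norm_at (hpoly_scalar F sX k) P}
           (hpoly_scalar F sX k)"
proof -
  obtain y0 :: 'b where y0: "y0 \<noteq> 0" using assms(4) by blast
  show ?thesis
    using sna_dense_vector[OF assms(1-3) y0 assms(5-8)]
      frechet_dense_scalar[OF assms(1,2,5-8)]
      frechet_gdelta_scalar[OF assms(1,2,6,7)]
    by blast
qed

end
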